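(* Let $V$ be the irreducible representation of $\mathfrak{o}_5$ with highest weight $[m_{-2},m_{-1}]$, where $m_{-2}\ge m_{-1}\ge0$ are both integers or both half-integers, realized in the space of functions on the group as the subrepresentation generated by $a_{-2}^{m_{-2}-m_{-1}}a_{-2,-1}^{m_{-1}}$. Fix $s_{-2}$. In the space of $\mathfrak{o}_3$-highest vectors of $V$ with $\mathfrak{o}_3$-weight $s_{-2}$ there exists a base indexed by $\sigma\in\{0,1\}$ and diagrams $$\begin{pmatrix}m_{-2}&& m_{-1} && 0\\ &k_{-2}&& k_{-1}\\ &&s_{-2}\end{pmatrix}$$ whose entries are all integer or all half-integer (except the fixed entry $0$), according to the type of the highest weight, and which satisfy the betweenness conditions $$m_{-2}\ge k_{-2}\ge m_{-1}\ge k_{-1}\ge 0,\qquad k_{-2}\ge s_{-2}\ge k_{-1},$$ where, in the case of integer highest weight, $\sigma=1$ is allowed only if $k_{-1}\ge1$. To such an index there corresponds the function $$a_{-2,0}^{\sigma}\,a_{1}^{m_{-2}-k_{-2}}\,a_{-2,-1}^{k_{-1}-\sigma}\,\mathcal{F}_{\gamma}(a,\mathcal{B}^1),$$ where $a=(a_{-2},a_{-1},a_{-2,1},a_{-1,1})$, $\gamma=(s_{-2}-m_{-1},\,k_{-2}-s_{-2},\,m_{-1}-k_{-1},\,0)$ and $\mathcal{B}^1=\mathbb{Z}\langle(1,-1,-1,1)\rangle\subset\mathbb{Z}^4$. The $(-2)$-component of the weight of this vector is $s_{-2}$, and its $(-1)$-component equals $$2(k_{-2}+k_{-1})-(m_{-2}+m_{-1})-s_{-2}-\sigma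 .$$
   Context: Coordinates of $\mathbb{C}^5$ are indexed by $-2,-1,0,1,2$. $SO_5$ is the group of linear transformations (of determinant $1$) preserving the scalar product whose matrix has ones on the second diagonal and zeros elsewhere. Its Lie algebra $\mathfrak{o}_5$ is spanned by $F_{i,j}=E_{i,j}-E_{-j,-i}$, $i,j\in\{\pm2,\pm1,0\}$. The group acts on functions on itself by right shifts, and hence so does $\mathfrak{o}_5$. Let $a_i^j$ be the matrix-element function ($i$ column index, $j$ row index), $a_i=a_i^{-2}$, and $a_{i_1,i_2}=\det(a_i^j)_{i=i_1,i_2}^{j=-2,-1}$. The generator $F_{i,j}$ acts by $F_{i,j}a_{i_1}=a_{i_1|_{j\mapsto i}}-a_{i_1|_{-i\mapsto -j}}$, where $i_1|_{j\mapsto i}$ means that the index $j$ is replaced by $i$ and the term is $0$ if $i_1\ne j$; the action on $a_{i_1,i_2}$ is analogous, and on products it is given by the Leibniz rule. Weights are the eigenvalues of $(F_{-2,-2},F_{-1,-1})$, called the $(-2)$- and $(-1)$-components. In the half-integer case functions are considered on the double cover $Spin_5\simeq Sp_4$ of $SO_5$, on which the pull-back of $a_{-2,-1}$ is the square of a regular function; half-integer powers of $a_{-2,-1}$ are defined by fixing such a square root. The subalgebra is $\mathfrak{o}_3=\langle F_{0,-2},F_{-2,-2},F_{-2,0}\rangle$; an $\mathfrak{o}_3$-highest vector is a vector annihilated by $F_{-2,0}$, and its $\mathfrak{o}_3$-weight is its $F_{-2,-2}$-eigenvalue. For a lattice $\mathcal{B}\subset\mathbb{Z}^N$ and $\gamma\in\mathbb{Z}^N$,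 the hypergeometric $\Gamma$-series in $z=(z_1,\dots,z_N)$ is $$\mathcal{F}_\gamma(z,\mathcal{B})=\sum_{v\in\mathcal{B}}\frac{z^{v+\gamma}}{\Gamma(v+\gamma+1)},\qquad z^{v+\gamma}=\prod_i z_i^{v_i+\gamma_i},\quad \Gamma(v+\gamma+1)=\prod_i\Gamma(v_i+\gamma_i+1),$$ where summands in which some component $v_i+\gamma_i$ is a negative integer are zero. *)

theory Defs
  imports "HOL-Analysis.Analysis" "HOL-Library.Function_Algebras"
begin

subsection \<open>Matrices and the two groups\<close>

text \<open>
  The coordinates of the five-dimensional space are indexed by the numeral type 5 of residues
  modulo 5, whose elements are \<open>-2, -1, 0, 1, 2\<close>; negation of indices is negation modulo 5.
\<close>

definition mat_unit :: "'n \<Rightarrow> 'n \<Rightarrow> complex^'n^'n" where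
  "mat_unit i j = (\<chi> p q. if p = i \<and> q = j then 1 else 0)"

definition scalar_prod_mat :: "complex^5^5" where
  "scalar_prod_mat = (\<chi> i j. if i = - j then 1 else 0)"

definition SO5 :: "(complex^5^5) set" where
  "SO5 = {g. transpose g ** scalar_prod_mat ** g = scalar_prod_mat \<and> det g = 1}"

definition gen_F :: "5 \<Rightarrow> 5 \<Rightarrow> complex^5^5" where
  "gen_F i j = mat_unit i j - mat_unit (- j) (- i)"

definition symp_mat :: "complex^4^4" where
  "symp_mat = mat_unit 1 4 + mat_unit 2 3 - mat_unit 3 2 - mat_unit 4 1"

definition Sp4 :: "(complex^4^4) set" where
  "Sp4 = {h. transpose h ** symp_mat ** h = symp_mat}"

definition sp4 :: "(complex^4^4) set" where
  "sp4 = {X. transpose X ** symp_mat + symp_mat ** X = 0}"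

text \<open>
  The double covering of \<^const>\<open>SO5\<close> by \<^const>\<open>Sp4\<close>. The second exterior power of the
  four-dimensional space is the space of antisymmetric matrices, \<open>e\<^sub>p \<and> e\<^sub>q\<close> being the
  matrix \<open>E\<^sub>p\<^sub>q - E\<^sub>q\<^sub>p\<close>, and \<open>h\<close> acts on it by \<open>A \<mapsto> h A h\<^sup>T\<close>. The five
  matrices \<open>ext_basis j\<close> span the primitive part, which is invariant under \<^const>\<open>Sp4\<close>. With
  respect to the scalar product that sends \<open>(u, v)\<close> to minus the coefficient of
  \<open>e\<^sub>1 \<and> e\<^sub>2 \<and> e\<^sub>3 \<and> e\<^sub>4\<close> in \<open>u \<and> v\<close>, their Gram matrix is
  \<^const>\<open>scalar_prod_mat\<close>.
\<close>

definition wedge :: "4 \<Rightarrow> 4 \<Rightarrow> complex^4^4" where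
  "wedge p q = mat_unit p q - mat_unit q p"

definition ext_basis :: "5 \<Rightarrow> complex^4^4" where
  "ext_basis j =
     (if j = -2 then wedge 1 2
      else if j = -1 then wedge 1 3
      else if j = 0 then (1 / sqrt 2) *\<^sub>R (wedge 1 4 - wedge 2 3)
      else if j = 1 then wedge 2 4
      else - wedge 3 4)"

text \<open>\<open>ext_coord i A\<close> is the coefficient of \<open>A\<close> at \<open>ext_basis i\<close>, for \<open>A\<close> in their span.\<close>

definition ext_coord :: "5 \<Rightarrow> complex^4^4 \<Rightarrow> complex" where
  "ext_coord i A =
     (if i = -2 then A $ 1 $ 2
      else if i = -1 then A $ 1 $ 3
      else if i = 0 then (A $ 1 $ 4 - A $ 2 $ 3) / complex_of_real (sqrt 2)
      else if i = 1 then A $ 2 $ 4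
      else - (A $ 3 $ 4))"

definition cover :: "complex^4^4 \<Rightarrow> complex^5^5" where
  "cover h = (\<chi> i j. ext_coord i (h ** ext_basis j ** transpose h))"

text \<open>The differential of \<^const>\<open>cover\<close> at the identity.\<close>

definition dcover :: "complex^4^4 \<Rightarrow> complex^5^5" where
  "dcover X = (\<chi> i j. ext_coord i (X ** ext_basis j + ext_basis j ** transpose X))"

subsection \<open>Functions on a matrix group\<close>

text \<open>
  A function on a group \<open>G\<close> of matrices is represented by its extension by zero to all matrices.
\<close>

definition on_group :: "(complex^'n^'n) set \<Rightarrow> (complex^'n^'n \<Rightarrow> complex) \<Rightarrow> complex^'n^'n \<Rightarrow> complex"
  where "on_group G f = (\<lambda>g. if g \<in> G then f g else 0)"

inductive polynomial_fun :: "(complex^'n^'n \<Rightarrow> complex) \<Rightarrow> bool" where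
  "polynomial_fun (\<lambda>g. c)"
| "polynomial_fun (\<lambda>g. g $ i $ j)"
| "polynomial_fun f \<Longrightarrow> polynomial_fun f' \<Longrightarrow> polynomial_fun (\<lambda>g. f g + f' g)"
| "polynomial_fun f \<Longrightarrow> polynomial_fun f' \<Longrightarrow> polynomial_fun (\<lambda>g. f g * f' g)"

text \<open>
  Matrices of both groups have determinant 1, so inverting the determinant gives no further
  regular functions.
\<close>

definition regular_on :: "(complex^'n^'n) set \<Rightarrow> (complex^'n^'n \<Rightarrow> complex) \<Rightarrow> bool" where
  "regular_on G f \<longleftrightarrow> (\<exists>P. polynomial_fun P \<and> f = on_group G P)"

definition fscale :: "complex \<Rightarrow> ('a \<Rightarrow> complex) \<Rightarrow> 'a \<Rightarrow> complex" where
  "fscale c f = (\<lambda>x. c * f x)"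

interpretation fun_vs: vector_space fscale
  by unfold_locales (simp_all add: fscale_def fun_eq_iff algebra_simps)

definition mat_exp :: "complex^'n^'n \<Rightarrow> complex^'n^'n" where
  "mat_exp X = (\<chi> i j. \<Sum>n. (((**) X ^^ n) (mat 1)) $ i $ j / fact n)"

text \<open>The action of a Lie algebra element by right shifts.\<close>

definition lie_shift ::
  "(complex^'n^'n) set \<Rightarrow> complex^'n^'n \<Rightarrow> (complex^'n^'n \<Rightarrow> complex) \<Rightarrow> complex^'n^'n \<Rightarrow> complex"
  where
  "lie_shift G X f = on_group G (\<lambda>g. deriv (\<lambda>t. f (g ** mat_exp (map_matrix ((*) t) X))) 0)"

definition act_SO5 :: "5 \<Rightarrow> 5 \<Rightarrow> (complex^5^5 \<Rightarrow> complex) \<Rightarrow> complex^5^5 \<Rightarrow> complex" where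
  "act_SO5 i j = lie_shift SO5 (gen_F i j)"

definition act_Sp4 :: "5 \<Rightarrow> 5 \<Rightarrow> (complex^4^4 \<Rightarrow> complex) \<Rightarrow> complex^4^4 \<Rightarrow> complex" where
  "act_Sp4 i j = lie_shift Sp4 (inv_into sp4 dcover (gen_F i j))"

text \<open>
  In the next two definitions \<open>act i j\<close> is the action of \<open>gen_F i j\<close> on functions.
\<close>

definition generated_subrep ::
  "(5 \<Rightarrow> 5 \<Rightarrow> ('a \<Rightarrow> complex) \<Rightarrow> 'a \<Rightarrow> complex) \<Rightarrow> ('a \<Rightarrow> complex) \<Rightarrow> ('a \<Rightarrow> complex) set"
  where
  "generated_subrep act f =
     \<Inter>{W. fun_vs.subspace W \<and> f \<in> W \<and> (\<forall>i j. \<forall>u\<in>W. act i j u \<in> W)}"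

definition o3_highest_vectors ::
  "(5 \<Rightarrow> 5 \<Rightarrow> ('a \<Rightarrow> complex) \<Rightarrow> 'a \<Rightarrow> complex) \<Rightarrow> ('a \<Rightarrow> complex) set \<Rightarrow> real
     \<Rightarrow> ('a \<Rightarrow> complex) set" where
  "o3_highest_vectors act V s =
     {f \<in> V. act (-2) 0 f = 0 \<and> act (-2) (-2) f = fscale (of_real s) f}"

definition is_indexed_basis ::
  "'i set \<Rightarrow> ('i \<Rightarrow> 'a \<Rightarrow> complex) \<Rightarrow> ('a \<Rightarrow> complex) set \<Rightarrow> bool" where
  "is_indexed_basis I v U \<longleftrightarrow>
     inj_on v I \<and> fun_vs.independent (v ` I) \<and> fun_vs.span (v ` I) = U"

subsection \<open>Matrix elements, minors and the Gamma-series\<close>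

definition elt :: "5 \<Rightarrow> complex^5^5 \<Rightarrow> complex" where
  "elt i g = g $ (-2) $ i"

definition minor :: "5 \<Rightarrow> 5 \<Rightarrow> complex^5^5 \<Rightarrow> complex" where
  "minor i j g = g $ (-2) $ i * g $ (-1) $ j - g $ (-2) $ j * g $ (-1) $ i"

text \<open>
  Only exponent vectors without negative components contribute, so for the lattice used below the
  sum is finite.
\<close>

definition Gamma_hyp_series :: "int^'N \<Rightarrow> complex^'N \<Rightarrow> (int^'N) set \<Rightarrow> complex" where
  "Gamma_hyp_series \<gamma> z B =
     (\<Sum>\<^sub>\<infinity>v\<in>B. if \<exists>i. v $ i + \<gamma> $ i < 0 then 0
        else (\<Prod>i\<in>UNIV. z $ i powi (v $ i + \<gamma> $ i)) /
             (\<Prod>i\<in>UNIV. Gamma (of_int (v $ i + \<gamma> $ i + 1))))"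

definition lattice_B1 :: "(int^4) set" where
  "lattice_B1 = range (\<lambda>k. k *s vector [1, -1, -1, 1])"

subsection \<open>Diagrams and the corresponding functions\<close>

definition half_integers :: "real set" where
  "half_integers = {x. x - 1/2 \<in> \<int>}"

text \<open>
  Indices are triples \<open>(\<sigma>, k2, k1)\<close>, where \<open>m2, m1, k2, k1, s\<close> stand for
  the entries with subscripts \<open>-2, -1, -2, -1, -2\<close> of the diagram, and \<open>T\<close> is the set of integers
  or of half-integers according to the type of the highest weight.
\<close>

definition diagram_indices :: "real set \<Rightarrow> real \<Rightarrow> real \<Rightarrow> real \<Rightarrow> (nat \<times> real \<times> real) set" where
  "diagram_indices T m2 m1 s =
     {(\<sigma>, k2, k1). \<sigma> \<in> {0, 1} \<and> k2 \<in> T \<and> k1 \<in> T \<and> s \<in> T \<and>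
        m2 \<ge> k2 \<and> k2 \<ge> m1 \<and> m1 \<ge> k1 \<and> k1 \<ge> 0 \<and> k2 \<ge> s \<and> s \<ge> k1 \<and>
        (T = \<int> \<longrightarrow> \<sigma> = 1 \<longrightarrow> k1 \<ge> 1)}"

text \<open>
  The value at \<open>g\<close> of the function attached to an index; \<open>pw x\<close> is the value at the given group
  element of the power with exponent \<open>x\<close> of \<open>minor (-2) (-1)\<close>. The floors are taken of
  integers, since all entries of a diagram have the same type.
\<close>

definition diagram_value ::
  "real \<Rightarrow> real \<Rightarrow> real \<Rightarrow> nat \<times> real \<times> real \<Rightarrow> (real \<Rightarrow> complex) \<Rightarrow> complex^5^5 \<Rightarrow> complex"
  where
  "diagram_value m2 m1 s = (\<lambda>(\<sigma>, k2, k1) pw g.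
     minor (-2) 0 g ^ \<sigma> * elt 1 g powi \<lfloor>m2 - k2\<rfloor> * pw (k1 - real \<sigma>) *
     Gamma_hyp_series (vector [\<lfloor>s - m1\<rfloor>, \<lfloor>k2 - s\<rfloor>, \<lfloor>m1 - k1\<rfloor>, 0])
       (vector [elt (-2) g, elt (-1) g, minor (-2) 1 g, minor (-1) 1 g]) lattice_B1)"

definition highest_value :: "real \<Rightarrow> real \<Rightarrow> (real \<Rightarrow> complex) \<Rightarrow> complex^5^5 \<Rightarrow> complex" where
  "highest_value m2 m1 pw g = elt (-2) g powi \<lfloor>m2 - m1\<rfloor> * pw m1"

definition minor_pow :: "complex^5^5 \<Rightarrow> real \<Rightarrow> complex" where
  "minor_pow g x = minor (-2) (-1) g powi \<lfloor>x\<rfloor>"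

text \<open>Here \<open>r\<close> is a square root of \<open>minor (-2) (-1)\<close> on the covering group.\<close>

definition root_pow :: "(complex^4^4 \<Rightarrow> complex) \<Rightarrow> complex^4^4 \<Rightarrow> real \<Rightarrow> complex" where
  "root_pow r h x = r h powi \<lfloor>2 * x\<rfloor>"

text \<open>
  For \<open>\<sigma> = 1\<close> and \<open>k1 = 1/2\<close> the exponent of \<open>minor (-2) (-1)\<close> is \<open>-1/2\<close>. The attached function
  on \<^const>\<open>Sp4\<close> is therefore the regular function given by the formula on the dense open set
  where that minor does not vanish.
\<close>

definition corresponds_on_cover ::
  "(complex^4^4 \<Rightarrow> complex) \<Rightarrow> (complex^4^4 \<Rightarrow> complex) \<Rightarrow> bool" where
  "corresponds_on_cover f expr \<longleftrightarrow>
     regular_on Sp4 f \<and> (\<forall>h\<in>Sp4. minor (-2) (-1) (cover h) \<noteq> 0 \<longrightarrow> f h = expr h)"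

definition minus1_weight :: "real \<Rightarrow> real \<Rightarrow> real \<Rightarrow> nat \<times> real \<times> real \<Rightarrow> real" where
  "minus1_weight m2 m1 s = (\<lambda>(\<sigma>, k2, k1). 2 * (k2 + k1) - (m2 + m1) - s - real \<sigma>)"

text \<open>The pull-back of \<open>minor (-2) (-1)\<close> to the covering group is the square of a regular function.\<close>

lemma unit_conj: "(h ** mat_unit p q ** transpose h) $ i $ j = h $ i $ p * h $ j $ q"
proof -
  have "(h ** mat_unit p q) $ i $ l = (if l = q then h $ i $ p else 0)" for l
    by (simp add: matrix_matrix_mult_def mat_unit_def if_distrib[of "\<lambda>x. _ * x"] cong: if_cong)
  then show ?thesis
    by (simp add: matrix_matrix_mult_def[of "h ** mat_unit p q"] transpose_def
        if_distrib[of "\<lambda>x. x * _"] cong: if_cong)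
qed

lemma wedge_conj: "(h ** wedge p q ** transpose h) $ i $ j = h $ i $ p * h $ j $ q - h $ i $ q * h $ j $ p"
proof -
  have "h ** wedge p q ** transpose h = h ** mat_unit p q ** transpose h - h ** mat_unit q p ** transpose h"
    unfolding wedge_def by (simp add: vec_eq_iff matrix_matrix_mult_def sum_subtractf algebra_simps)
  then show ?thesis by (simp add: unit_conj)
qed

lemma Sp4_form:
  assumes "h \<in> Sp4"
  shows "h$1$p * h$4$q + h$2$p * h$3$q - h$3$p * h$2$q - h$4$p * h$1$q = symp_mat $ p $ q"
proof -
  have "(transpose h ** mat_unit i j ** h) $ p $ q = h$i$p * h$j$q" for i j
    using unit_conj[of "transpose h" i j p q] by (simp add: transpose_def)
  moreover have "transpose h ** symp_mat ** h = transpose h ** mat_unit 1 4 ** h + transpose h ** mat_unit 2 3 ** h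
     - transpose h ** mat_unit 3 2 ** h - transpose h ** mat_unit 4 1 ** h"
    unfolding symp_mat_def by (simp add: vec_eq_iff matrix_matrix_mult_def sum_subtractf sum.distrib algebra_simps)
  moreover have "(transpose h ** symp_mat ** h) $ p $ q = symp_mat $ p $ q"
    using assms by (simp add: Sp4_def)
  ultimately show ?thesis by simp
qed

lemma minor_cover_eq_square:
  assumes "h \<in> Sp4"
  shows "minor (-2) (-1) (cover h) = (h $ 1 $ 1)\<^sup>2"
proof -
  have ne: "(-1::5) \<noteq> -2" by simp
  have "h$1$1 * h$4$2 + h$2$1 * h$3$2 - h$3$1 * h$2$2 - h$4$1 * h$1$2 = 0"
    "h$1$1 * h$4$3 + h$2$1 * h$3$3 - h$3$1 * h$2$3 - h$4$1 * h$1$3 = 0"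
    "h$1$2 * h$4$3 + h$2$2 * h$3$3 - h$3$2 * h$2$3 - h$4$2 * h$1$3 = 1"
    using Sp4_form[OF assms, of 1 2] Sp4_form[OF assms, of 1 3] Sp4_form[OF assms, of 2 3]
    by (simp_all add: symp_mat_def mat_unit_def)
  then show ?thesis
    by (simp add: minor_def cover_def ext_coord_def ext_basis_def wedge_conj ne) algebra
qed

lemma square_root_exists:
  "\<exists>r. regular_on Sp4 r \<and> (\<forall>h\<in>Sp4. (r h)\<^sup>2 = minor (-2) (-1) (cover h))"
  by (intro exI[of _ "on_group Sp4 (\<lambda>h. h $ 1 $ 1)"])
     (auto simp: regular_on_def on_group_def minor_cover_eq_square
           intro: exI[of _ "\<lambda>h. h $ 1 $ 1"] polynomial_fun.intros)

end

theory Submission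
  imports Defs
begin

text \<open>
  Everything happens on the symplectic group; integer highest weights are pulled back along the
  covering, which is onto \<^const>\<open>SO5\<close>. With \<open>N = 2 * m1\<close> and \<open>M = m2 - m1\<close> the highest vector is
  \<open>x\<^sub>1\<^sup>N p\<^sub>1\<^sub>2\<^sup>M\<close>, where \<open>x\<^sub>i\<close> are the entries of the first row and \<open>p\<^sub>i\<^sub>j\<close> the minors of the first two
  rows. Its translate by the adjoint of \<open>g\<close> is the kernel \<open>\<Sum>m. cnj (m g) m(h)\<close>, \<open>m\<close> running over the
  products of \<open>N\<close> coordinates \<open>x\<^sub>i\<close> and \<open>M\<close> coordinates \<open>p\<^sub>i\<^sub>j\<close>; since this kernel is positive, the
  generated representation \<open>V\<close> is the span of all these products.

  A vector of \<open>V\<close> annihilated by \<open>F\<^sub>-\<^sub>2\<^sub>,\<^sub>0\<close> is invariant under a one-parameter unipotent group, which moves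
  every point with \<open>x\<^sub>1 \<noteq> 0\<close> to one with \<open>x\<^sub>3 = 0\<close>. Hence, after multiplication by a power of \<open>x\<^sub>1\<close>, it is a
  combination of monomials in \<open>x\<^sub>1\<close>, \<open>x\<^sub>2\<close>, \<open>y = x\<^sub>2 x\<^sub>3 - x\<^sub>1 x\<^sub>4\<close>, \<open>p\<^sub>1\<^sub>2\<close>, \<open>p\<^sub>1\<^sub>3\<close>, \<open>p\<^sub>2\<^sub>4\<close>. By the single relation
  \<open>p\<^sub>1\<^sub>2 y = p\<^sub>1\<^sub>3 x\<^sub>2\<^sup>2 + p\<^sub>2\<^sub>4 x\<^sub>1\<^sup>2\<close> the monomials of given degrees and weight are, up to terms divisible by a
  higher power of \<open>x\<^sub>1\<close>, determined by the exponents of \<open>x\<^sub>1\<close> and \<open>p\<^sub>2\<^sub>4\<close>, and the \<open>\<Gamma>\<close>-series, whose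
  coefficients are positive, can serve as their representatives. Restriction to the divisor \<open>x\<^sub>1 = 0\<close>
  shows both that the power of \<open>x\<^sub>1\<close> can be divided out again and that the functions are linearly
  independent.
\<close>

subsection \<open>The matrix exponential\<close>

text \<open>The covering group serves integer weights as well because there the functions with two
  subscripts become quadratic polynomials in the first row. In particular \<open>a_{-2,-1}\<close>
  and \<open>a_{-2,0}\<close> turn into x1^2 and a multiple of x1 x2, so \<sigma> only records a
  parity: if j = 2 k1 - \<sigma> is the exponent of x1, then \<sigma> is N - j modulo 2, and for
  integer weights the condition k1 >= 1 for \<sigma> = 1 says that j is not negative.

  The obstacle is the division by x1, since the slice x3 = 0 introduces denominators. It is met by
  enlarging the problem: x1^L f has degree N + L in the first row, and the family spanning that
  larger space is chosen so that its members with exponent at least L are x1^L times the wanted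
  functions. Those with smaller exponent must then drop out.

  Cancelling x1 requires that the regular functions on the group form an integral domain. This comes
  from generation by root subgroups: any two points lie on a curve with polynomial entries. The same
  generation leads from invariance under the Lie algebra to invariance under the group.\<close>

abbreviation mat_pow :: "complex^'n^'n \<Rightarrow> nat \<Rightarrow> complex^'n^'n" where
  "mat_pow X n \<equiv> ((**) X ^^ n) (mat 1)"

definition mscale :: "complex \<Rightarrow> complex^'n^'n \<Rightarrow> complex^'n^'n" where
  "mscale t X = map_matrix ((*) t) X"

lemma matrix_mult_entry: "(A ** B) $ i $ j = (\<Sum>k\<in>UNIV. A $ i $ k * B $ k $ j)"
  by (simp add: matrix_matrix_mult_def)

lemma mat_entry: "(mat c) $ i $ j = (if i = j then c else 0)"
  by (simp add: mat_def)

lemma mscale_entry [simp]: "mscale t X $ i $ j = t * X $ i $ j"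
  by (simp add: mscale_def map_matrix_def)

lemma mscale_mult_left: "mscale t X ** Y = mscale t (X ** Y)"
  by (simp add: vec_eq_iff matrix_mult_entry sum_distrib_left mult.assoc)

lemma mscale_mult_right: "Y ** mscale t X = mscale t (Y ** X)"
  by (simp add: vec_eq_iff matrix_mult_entry sum_distrib_left mult.left_commute)

lemma mat_pow_mscale: "mat_pow (mscale t X) n = mscale (t ^ n) (mat_pow X n)"
proof (induction n)
  case 0
  show ?case by (simp add: vec_eq_iff)
next
  case (Suc n)
  have "mat_pow (mscale t X) (Suc n) = mscale t X ** mat_pow (mscale t X) n" by simp
  also have "\<dots> = mscale t X ** mscale (t ^ n) (mat_pow X n)" by (simp only: Suc)
  also have "\<dots> = mscale (t ^ Suc n) (X ** mat_pow X n)"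
    by (simp only: mscale_mult_left mscale_mult_right) (simp add: vec_eq_iff)
  finally show ?case by simp
qed

lemma mat_pow_bound: "norm (mat_pow X n $ i $ j) \<le> (\<Sum>a\<in>UNIV. \<Sum>b\<in>UNIV. norm (X $ a $ b)) ^ n"
proof (induction n arbitrary: i j)
  case 0
  show ?case by (simp add: mat_entry)
next
  case (Suc n)
  let ?B = "\<Sum>a\<in>UNIV. \<Sum>b\<in>UNIV. norm (X $ a $ b)"
  have "norm (mat_pow X (Suc n) $ i $ j) \<le> (\<Sum>k\<in>UNIV. norm (X $ i $ k) * ?B ^ n)"
    by (simp add: matrix_mult_entry)
       (rule sum_norm_le, simp add: norm_mult mult_left_mono Suc)
  also have "\<dots> = (\<Sum>k\<in>UNIV. norm (X $ i $ k)) * ?B ^ n"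
    by (simp add: sum_distrib_right)
  also have "\<dots> \<le> ?B * ?B ^ n"
    by (intro mult_right_mono member_le_sum[of i UNIV "\<lambda>a. \<Sum>b\<in>UNIV. norm (X $ a $ b)"])
       (auto intro!: sum_nonneg zero_le_power)
  finally show ?case by simp
qed

lemma summable_mat_exp: "summable (\<lambda>n. mat_pow X n $ i $ j / fact n * t ^ n)"
proof (rule summable_comparison_test)
  let ?B = "\<Sum>a\<in>UNIV. \<Sum>b\<in>UNIV. norm (X $ a $ b)"
  show "\<exists>N. \<forall>n\<ge>N. norm (mat_pow X n $ i $ j / fact n * t ^ n) \<le> inverse (fact n) * (?B * norm t) ^ n"
    by (auto simp: norm_mult norm_divide norm_power power_mult_distrib field_simps
        intro!: mult_left_mono[OF mat_pow_bound])
  show "summable (\<lambda>n. inverse (fact n) * (?B * norm t) ^ n)"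
    by (rule summable_exp)
qed

lemma mat_exp_entry: "mat_exp (mscale t X) $ i $ j = (\<Sum>n. mat_pow X n $ i $ j / fact n * t ^ n)"
  by (simp add: mat_exp_def mat_pow_mscale mult_ac)

lemma mat_exp_zero: "mat_exp (mscale 0 X) = mat 1"
proof -
  have "mat_exp (mscale 0 X) $ i $ j = mat 1 $ i $ j" for i j
  proof -
    have "(\<Sum>n. mat_pow X n $ i $ j / fact n * 0 ^ n) = mat 1 $ i $ j"
      by (subst suminf_finite[of "{0}"]) auto
    then show ?thesis
      unfolding mat_exp_entry by simp
  qed
  then show ?thesis by (simp add: vec_eq_iff)
qed

lemma mat_exp_square_zero:
  assumes "X ** X = 0"
  shows "mat_exp (mscale t X) = mat 1 + mscale t X"
proof -
  have z: "mat_pow X n = 0" if "n \<notin> {0, 1}" for n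
  proof -
    have "n = Suc (Suc (n - 2))" using that by auto
    then obtain k where k: "n = Suc (Suc k)" by blast
    show ?thesis
      by (simp add: k matrix_mul_assoc assms)
  qed
  have "mat_exp (mscale t X) $ i $ j = (mat 1 + mscale t X) $ i $ j" for i j
    unfolding mat_exp_entry by (subst suminf_finite[of "{0, 1}"]) (auto simp: z)
  then show ?thesis by (simp add: vec_eq_iff)
qed

definition has_mat_deriv :: "(complex \<Rightarrow> complex^'n^'m) \<Rightarrow> complex^'n^'m \<Rightarrow> complex \<Rightarrow> bool" where
  "has_mat_deriv c c' t \<longleftrightarrow> (\<forall>i j. ((\<lambda>s. c s $ i $ j) has_field_derivative c' $ i $ j) (at t))"

lemma has_mat_deriv_const: "has_mat_deriv (\<lambda>s. A) 0 t"
  by (simp add: has_mat_deriv_def)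

lemma has_mat_deriv_mult:
  fixes a :: "complex \<Rightarrow> complex^'n^'m" and b :: "complex \<Rightarrow> complex^'k^'n"
  assumes "has_mat_deriv a a' t" and "has_mat_deriv b b' t"
  shows "has_mat_deriv (\<lambda>s. a s ** b s) (a' ** b t + a t ** b') t"
  unfolding has_mat_deriv_def
proof (intro allI)
  fix i j
  show "((\<lambda>s. (a s ** b s) $ i $ j) has_field_derivative (a' ** b t + a t ** b') $ i $ j) (at t)"
    unfolding matrix_mult_entry vector_add_component sum.distrib[symmetric]
    by (rule DERIV_sum)
       (use assms in \<open>auto simp: has_mat_deriv_def intro!: derivative_eq_intros\<close>)
qed

lemma has_mat_deriv_transpose:
  "has_mat_deriv a a' t \<Longrightarrow> has_mat_deriv (\<lambda>s. transpose (a s)) (transpose a') t"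
  by (simp add: has_mat_deriv_def transpose_def)

lemma has_mat_deriv_exp: "has_mat_deriv (\<lambda>t. mat_exp (mscale t X)) (X ** mat_exp (mscale t X)) t"
  unfolding has_mat_deriv_def
proof (intro allI)
  fix i j
  have s: "summable (\<lambda>n. X $ i $ k * (mat_pow X n $ k $ j / fact n * t ^ n))" for k
    by (intro summable_mult summable_mat_exp)
  have "diffs (\<lambda>n. mat_pow X n $ i $ j / fact n) n * t ^ n
      = (\<Sum>k\<in>UNIV. X $ i $ k * (mat_pow X n $ k $ j / fact n * t ^ n))" for n
  proof -
    have "diffs (\<lambda>n. mat_pow X n $ i $ j / fact n) n = (X ** mat_pow X n) $ i $ j / fact n"
      unfolding diffs_def by (simp del: of_nat_Suc)
    then show ?thesis
      by (simp add: matrix_mult_entry sum_distrib_left sum_distrib_right sum_divide_distrib mult_ac)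
  qed
  then have "(\<Sum>n. diffs (\<lambda>n. mat_pow X n $ i $ j / fact n) n * t ^ n)
     = (X ** mat_exp (mscale t X)) $ i $ j"
    by (simp add: matrix_mult_entry mat_exp_entry suminf_sum[OF s] suminf_mult[OF summable_mat_exp]
        del: times_divide_eq_left times_divide_eq_right)
  with termdiffs_strong_converges_everywhere[OF summable_mat_exp[of X i j], of t]
  show "((\<lambda>t. mat_exp (mscale t X) $ i $ j) has_field_derivative (X ** mat_exp (mscale t X))
      $ i $ j) (at t)"
    by (simp add: mat_exp_entry)
qed

lemma matrix_mult_zero: "A ** 0 = 0" "0 ** A = 0"
  by (simp_all add: vec_eq_iff matrix_mult_entry)

lemma matrix_mult_distrib:
  "A ** (B + C) = A ** B + A ** C" "(A + B) ** C = A ** C + B ** C"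
  by (simp_all add: vec_eq_iff matrix_mult_entry sum.distrib algebra_simps)

text \<open>With \<open>E = mat_exp (mscale t X)\<close> the left side has derivative
  \<open>transpose E ** (transpose X ** S + S ** X) ** E = 0\<close> in \<open>t\<close>, and at
  \<open>t = 0\<close> it equals \<open>S\<close>.\<close>

lemma mat_exp_preserves_form:
  assumes "transpose X ** S + S ** X = 0"
  shows "transpose (mat_exp (mscale t X)) ** S ** mat_exp (mscale t X) = S"
proof -
  let ?E = "\<lambda>t. mat_exp (mscale t X)"
  have d: "has_mat_deriv (\<lambda>t. transpose (?E t) ** S ** ?E t) 0 t" for t
  proof -
    have 1: "has_mat_deriv (\<lambda>t. transpose (?E t) ** S) (transpose (?E t) ** transpose X ** S) t"
      using has_mat_deriv_mult[OF has_mat_deriv_transpose[OF has_mat_deriv_exp[of X t]]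
          has_mat_deriv_const[of S]]
      by (simp add: matrix_mult_zero matrix_transpose_mul)
    have "transpose (?E t) ** transpose X ** S ** ?E t + transpose (?E t) ** S ** (X ** ?E t)
      = transpose (?E t) ** (transpose X ** S + S ** X) ** ?E t"
      by (simp add: matrix_mult_distrib matrix_mul_assoc)
    then show ?thesis
      using has_mat_deriv_mult[OF 1 has_mat_deriv_exp[of X t]] by (simp add: assms matrix_mult_zero)
  qed
  have "(transpose (?E t) ** S ** ?E t) $ i $ j = S $ i $ j" for i j
  proof -
    obtain c where "\<And>t. (transpose (?E t) ** S ** ?E t) $ i $ j = c"
      using has_field_derivative_zero_constant[of UNIV "\<lambda>t. (transpose (?E t) ** S ** ?E t) $ i $ j"] d
      by (auto simp: has_mat_deriv_def)
    from this[of t] this[of 0] show ?thesis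
      by (simp add: mat_exp_zero transpose_mat)
  qed
  then show ?thesis by (simp add: vec_eq_iff)
qed

text \<open>Invariance of the nondegenerate \<open>S\<close> forces the determinant to be 1 or -1;
  being continuous in \<open>t\<close> on the connected plane, it keeps its value 1 at
  \<open>t = 0\<close>.\<close>

lemma det_mat_exp:
  assumes "transpose X ** S + S ** X = 0" and "det S \<noteq> 0"
  shows "det (mat_exp (mscale t X)) = 1"
proof -
  let ?d = "\<lambda>t. det (mat_exp (mscale t X))"
  have "?d t * ?d t * det S = det S" for t
    using arg_cong[OF mat_exp_preserves_form[OF assms(1), of t], of det]
    by (simp add: det_mul mult_ac)
  then have sq: "?d t * ?d t = 1" for t
    using assms(2) by simp
  have pm: "?d t = 1 \<or> ?d t = - 1" for t
    using square_eq_1_iff[of "?d t"] sq[of t] by simp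
  have "(\<lambda>t. mat_exp (mscale t X) $ i $ j) differentiable_on UNIV" for i j
    using has_mat_deriv_exp[of X]
    unfolding has_mat_deriv_def differentiable_on_def has_field_derivative_def differentiable_def
        by blast
  then have "continuous_on UNIV (\<lambda>t. mat_exp (mscale t X) $ i $ j)" for i j
    by (simp add: differentiable_imp_continuous_on)
  then have "continuous_on UNIV ?d"
    unfolding det_def
    by (intro continuous_on_sum continuous_on_mult continuous_on_prod continuous_on_const) auto
  moreover have "?d ` UNIV \<subseteq> {1, -1}" using pm by auto
  then have "finite (?d ` UNIV)" by (rule finite_subset) simp
  ultimately have "?d constant_on UNIV"
    by (intro continuous_finite_range_constant) auto
  then obtain y where "\<And>t. ?d t = y"
    unfolding constant_on_def by blast
  from this[of t] this[of 0] show ?thesis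
    by (simp add: mat_exp_zero)
qed

subsection \<open>Regular functions and right shifts\<close>

lemma polynomial_fun_sum: "(\<And>i. i \<in> A \<Longrightarrow> polynomial_fun (f i)) \<Longrightarrow> polynomial_fun (\<lambda>g. \<Sum>i\<in>A. f i g)"
  by (induction A rule: infinite_finite_induct) (auto intro: polynomial_fun.intros)

lemma polynomial_fun_prod: "(\<And>i. i \<in> A \<Longrightarrow> polynomial_fun (f i)) \<Longrightarrow> polynomial_fun (\<lambda>g. \<Prod>i\<in>A. f i g)"
  by (induction A rule: infinite_finite_induct) (auto intro: polynomial_fun.intros)

lemma polynomial_fun_power: "polynomial_fun f \<Longrightarrow> polynomial_fun (\<lambda>g. f g ^ n)"
  by (induction n) (auto intro: polynomial_fun.intros)

lemma polynomial_fun_uminus: "polynomial_fun f \<Longrightarrow> polynomial_fun (\<lambda>g. - f g)"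
  using polynomial_fun.intros(4)[OF polynomial_fun.intros(1)[of "-1"], of f] by simp

lemma polynomial_fun_diff:
  "polynomial_fun f \<Longrightarrow> polynomial_fun f' \<Longrightarrow> polynomial_fun (\<lambda>g. f g - f' g)"
  using polynomial_fun.intros(3)[OF _ polynomial_fun_uminus, of f f'] by simp

lemmas polynomial_fun_intros =
  polynomial_fun.intros polynomial_fun_sum polynomial_fun_prod polynomial_fun_power
  polynomial_fun_uminus polynomial_fun_diff

text \<open>The chain rule in a form that hides the gradient: one number \<open>D\<close> serves all
  curves with the same position and velocity at 0. In \<open>pull_act\<close> this compares two
  curves in SO5 without proving that the covering commutes with exponentials.\<close>

lemma polynomial_fun_curve_deriv:
  assumes "polynomial_fun P"
  obtains D where
    "\<And>c. c 0 = g \<Longrightarrow> has_mat_deriv c c' 0 \<Longrightarrow> ((\<lambda>t. P (c t)) has_field_derivative D) (at 0)"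
proof -
  have "\<exists>D. \<forall>c. c 0 = g \<longrightarrow> has_mat_deriv c c' 0 \<longrightarrow> ((\<lambda>t. P (c t)) has_field_derivative D) (at 0)"
    using assms
  proof induction
    case (1 k)
    show ?case by (rule exI[of _ 0]) simp
  next
    case (2 i j)
    show ?case by (rule exI[of _ "c' $ i $ j"]) (simp add: has_mat_deriv_def)
  next
    case (3 f f')
    then obtain D D' where "\<And>c. c 0 = g \<Longrightarrow> has_mat_deriv c c' 0 \<Longrightarrow> ((\<lambda>t. f (c t))
        has_field_derivative D) (at 0)"
      "\<And>c. c 0 = g \<Longrightarrow> has_mat_deriv c c' 0 \<Longrightarrow> ((\<lambda>t. f' (c t)) has_field_derivative D') (at 0)"
      by blast
    then show ?case
      by (intro exI[of _ "D + D'"]) (auto intro!: derivative_intros)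
  next
    case (4 f f')
    then obtain D D' where "\<And>c. c 0 = g \<Longrightarrow> has_mat_deriv c c' 0 \<Longrightarrow> ((\<lambda>t. f (c t))
        has_field_derivative D) (at 0)"
      "\<And>c. c 0 = g \<Longrightarrow> has_mat_deriv c c' 0 \<Longrightarrow> ((\<lambda>t. f' (c t)) has_field_derivative D') (at 0)"
      by blast
    then show ?case
      by (intro exI[of _ "D * f' g + D' * f g"]) (auto intro!: derivative_eq_intros)
  qed
  then show ?thesis using that by blast
qed

lemma has_mat_deriv_shift: "has_mat_deriv (\<lambda>t. g ** mat_exp (mscale t X)) (g ** X) 0"
  using has_mat_deriv_mult[OF has_mat_deriv_const[of g] has_mat_deriv_exp[of X 0]]
  by (simp add: mat_exp_zero matrix_mult_zero)

text \<open>The right shift on functions of arbitrary matrices; \<open>lie_shift_on_group\<close>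
  restricts it to a group. Since it maps polynomials to polynomials, actions can be
  iterated.\<close>

definition poly_shift :: "complex^'n^'n \<Rightarrow> (complex^'n^'n \<Rightarrow> complex) \<Rightarrow> complex^'n^'n \<Rightarrow> complex" where
  "poly_shift X P = (\<lambda>g. deriv (\<lambda>t. P (g ** mat_exp (mscale t X))) 0)"

lemma poly_shift_deriv:
  assumes "polynomial_fun P"
  shows "((\<lambda>t. P (g ** mat_exp (mscale t X))) has_field_derivative poly_shift X P g) (at 0)"
proof -
  obtain D where D: "\<And>c. c 0 = g \<Longrightarrow> has_mat_deriv c (g ** X) 0 \<Longrightarrow>
      ((\<lambda>t. P (c t)) has_field_derivative D) (at 0)"
    using polynomial_fun_curve_deriv[OF assms] by blast
  have "((\<lambda>t. P (g ** mat_exp (mscale t X))) has_field_derivative D) (at 0)"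
    by (rule D) (simp_all add: mat_exp_zero has_mat_deriv_shift)
  then show ?thesis unfolding poly_shift_def by (simp add: DERIV_imp_deriv)
qed

lemma poly_shift_eqI:
  "((\<lambda>t. P (g ** mat_exp (mscale t X))) has_field_derivative D) (at 0) \<Longrightarrow> poly_shift X P g = D"
  by (simp add: poly_shift_def DERIV_imp_deriv)

lemma poly_shift_const: "poly_shift X (\<lambda>g. c) = (\<lambda>g. 0)"
  by (simp add: poly_shift_def)

lemma poly_shift_entry: "poly_shift X (\<lambda>g. g $ i $ j) = (\<lambda>g. \<Sum>k\<in>UNIV. g $ i $ k * X $ k $ j)"
proof (rule ext, rule poly_shift_eqI)
  fix g
  show "((\<lambda>t. (g ** mat_exp (mscale t X)) $ i $ j) has_field_derivative
     (\<Sum>k\<in>UNIV. g $ i $ k * X $ k $ j)) (at 0)"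
    using has_mat_deriv_shift[of g X] unfolding has_mat_deriv_def matrix_mult_entry[of g X, symmetric]
    by blast
qed

lemma poly_shift_add:
  "polynomial_fun f \<Longrightarrow> polynomial_fun f' \<Longrightarrow>
    poly_shift X (\<lambda>g. f g + f' g) = (\<lambda>g. poly_shift X f g + poly_shift X f' g)"
  by (rule ext, rule poly_shift_eqI) (auto intro!: derivative_intros poly_shift_deriv)

lemma poly_shift_mult:
  "polynomial_fun f \<Longrightarrow> polynomial_fun f' \<Longrightarrow>
    poly_shift X (\<lambda>g. f g * f' g) = (\<lambda>g. poly_shift X f g * f' g + f g * poly_shift X f' g)"
  by (rule ext, rule poly_shift_eqI)
     (auto intro!: derivative_eq_intros poly_shift_deriv simp: mat_exp_zero)

lemma polynomial_fun_poly_shift: "polynomial_fun P \<Longrightarrow> polynomial_fun (poly_shift X P)"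
  by (induction rule: polynomial_fun.induct)
     (auto simp: poly_shift_const poly_shift_entry poly_shift_add poly_shift_mult
           intro!: polynomial_fun_intros)

lemma on_group_eq_iff: "on_group G f = on_group G f' \<longleftrightarrow> (\<forall>g\<in>G. f g = f' g)"
  by (auto simp: on_group_def fun_eq_iff)

lemma lie_shift_on_group:
  assumes "\<And>g t. g \<in> G \<Longrightarrow> g ** mat_exp (mscale t X) \<in> G"
  shows "lie_shift G X (on_group G P) = on_group G (poly_shift X P)"
  unfolding lie_shift_def poly_shift_def mscale_def[symmetric] on_group_eq_iff using assms by
      (simp add: on_group_def)

lemma on_group_simps:
  "on_group G f + on_group G f' = on_group G (\<lambda>h. f h + f' h)"
  "on_group G f * on_group G f' = on_group G (\<lambda>h. f h * f' h)"
  "fscale c (on_group G f) = on_group G (\<lambda>h. c * f h)"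
  "on_group G (\<lambda>h. 0) = 0" "on_group G (on_group G f) = on_group G f"
  by (auto simp: on_group_def fun_eq_iff fscale_def)

lemma regularI: "polynomial_fun P \<Longrightarrow> regular_on G (on_group G P)"
  by (auto simp: regular_on_def)

lemma regularE:
  assumes "regular_on G f"
  obtains P where "polynomial_fun P" "f = on_group G P"
  using assms by (auto simp: regular_on_def)

lemma on_group_regular: "regular_on G f \<Longrightarrow> on_group G f = f"
  by (auto elim!: regularE simp: on_group_simps)

lemma regular_zero: "regular_on G 0"
  using regularI[OF polynomial_fun.intros(1)[of 0]] by (simp add: on_group_simps)

lemma regular_add: "regular_on G f \<Longrightarrow> regular_on G f' \<Longrightarrow> regular_on G (f + f')"
  and regular_mult: "regular_on G f \<Longrightarrow> regular_on G f' \<Longrightarrow> regular_on G (f * f')"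
  and regular_scale: "regular_on G f \<Longrightarrow> regular_on G (fscale c f)"
  by (auto elim!: regularE simp: on_group_simps intro!: regularI polynomial_fun_intros)

lemma subspace_regular: "fun_vs.subspace {f. regular_on G f}"
  by (rule fun_vs.subspaceI) (auto intro: regular_zero regular_add regular_scale)

lemma regular_span: "S \<subseteq> {f. regular_on G f} \<Longrightarrow> f \<in> fun_vs.span S \<Longrightarrow> regular_on G f"
  using fun_vs.span_minimal[OF _ subspace_regular] by blast

lemma fscale_mult: "fscale c f * g = fscale c (f * g)" "g * fscale c f = fscale c (g * f)"
  by (auto simp: fscale_def fun_eq_iff)

lemma fscale_simps: "fscale 0 f = 0" "fscale c (fscale d f) = fscale (c * d) f" "fscale 1 f = f"
  "fscale c (f + g) = fscale c f + fscale c g" "fscale (c + d) f = fscale c f + fscale d f"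
      "fscale c 0 = 0"
  by (auto simp: fscale_def fun_eq_iff algebra_simps)

text \<open>What the actions on SO5 and on Sp4 have in common. Linearity, the Leibniz rule and the
  preservation of regular functions are derived from it once for both.\<close>

definition shift_action ::
  "(complex^'n^'n) set \<Rightarrow> (5 \<Rightarrow> 5 \<Rightarrow> (complex^'n^'n \<Rightarrow> complex) \<Rightarrow> complex^'n^'n \<Rightarrow> complex) \<Rightarrow> bool" where
  "shift_action G act \<longleftrightarrow> (\<exists>X. \<forall>i j P. act i j (on_group G P) = on_group G (poly_shift (X i j) P))"

context
  fixes G :: "(complex^'n^'n) set" and act
  assumes act: "shift_action G act"
begin

lemma act_regular:
  assumes "regular_on G f"
  shows "regular_on G (act i j f)"
  using act assms
  by (auto elim!: regularE simp: shift_action_def intro!: regularI polynomial_fun_poly_shift)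

lemma act_zero: "act i j 0 = 0"
proof -
  obtain X where "act i j (on_group G P) = on_group G (poly_shift (X i j) P)" for P
    using act unfolding shift_action_def by blast
  from this[of "\<lambda>h. 0"] show ?thesis by (simp only: poly_shift_const on_group_simps(4))
qed

lemma act_add: "regular_on G f \<Longrightarrow> regular_on G f' \<Longrightarrow> act i j (f + f') = act i j f + act i j f'"
  and act_mult: "regular_on G f \<Longrightarrow> regular_on G f' \<Longrightarrow> act i j (f * f') = act i j f * f' + f * act i j f'"
  and act_scale: "regular_on G f \<Longrightarrow> act i j (fscale c f) = fscale c (act i j f)"
  using act by (auto elim!: regularE simp: shift_action_def on_group_simps poly_shift_add
      poly_shift_mult
      poly_shift_const polynomial_fun.intros)

lemma o3_highest_subspace:
  assumes V: "fun_vs.subspace V" "V \<subseteq> {f. regular_on G f}"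
  shows "fun_vs.subspace (o3_highest_vectors act V s)"
proof (rule fun_vs.subspaceI)
  show "0 \<in> o3_highest_vectors act V s"
    by (simp add: o3_highest_vectors_def act_zero fscale_simps fun_vs.subspace_0[OF V(1)])
  fix f g assume fg: "f \<in> o3_highest_vectors act V s" "g \<in> o3_highest_vectors act V s"
  then have r: "regular_on G f" "regular_on G g" using V(2) by (auto simp: o3_highest_vectors_def)
  then show "f + g \<in> o3_highest_vectors act V s"
    using fg by (simp add: o3_highest_vectors_def act_add fscale_simps fun_vs.subspace_add[OF V(1)])
  show "fscale c f \<in> o3_highest_vectors act V s" for c
    using fg r by (simp add: o3_highest_vectors_def act_scale fscale_simps mult.commute
        fun_vs.subspace_scale[OF V(1)])
qed

end

subsection \<open>Indices\<close>

lemma exhaust_5: "(x::5) = -2 \<or> x = -1 \<or> x = 0 \<or> x = 1 \<or> x = 2"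
proof (induct x)
  case (of_int z)
  then have "z = 0 \<or> z = 1 \<or> z = 2 \<or> z = 3 \<or> z = 4" by simp linarith
  then show ?case by (elim disjE) simp_all
qed

lemma forall_5: "(\<forall>i::5. P i) \<longleftrightarrow> P (-2) \<and> P (-1) \<and> P 0 \<and> P 1 \<and> P 2"
proof
  assume P: "P (-2) \<and> P (-1) \<and> P 0 \<and> P 1 \<and> P 2"
  show "\<forall>i. P i"
  proof
    fix i
    show "P i" using exhaust_5[of i] P by (elim disjE) simp_all
  qed
qed blast

lemma UNIV_5: "(UNIV :: 5 set) = {-2, -1, 0, 1, 2}"
  by (rule set_eqI) (simp only: UNIV_I insert_iff empty_iff exhaust_5 simp_thms)

lemma index5_distinct [simp]:
  "(-2::5) \<noteq> -1" "(-1::5) \<noteq> -2" "(-2::5) \<noteq> 1" "(1::5) \<noteq> -2" "(-2::5) \<noteq> 2" "(2::5) \<noteq> -2"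
  "(-1::5) \<noteq> 1" "(1::5) \<noteq> -1" "(-1::5) \<noteq> 2" "(2::5) \<noteq> -1" "(1::5) \<noteq> 2" "(2::5) \<noteq> 1"
  "(-2::5) \<noteq> 0" "(0::5) \<noteq> -2" "(-1::5) \<noteq> 0" "(0::5) \<noteq> -1" "(1::5) \<noteq> 0" "(0::5) \<noteq> 1"
  "(2::5) \<noteq> 0" "(0::5) \<noteq> 2"
  by simp_all

lemma sum_5: "sum f (UNIV :: 5 set) = f (-2) + f (-1) + f 0 + f 1 + f 2"
  unfolding UNIV_5
  by (simp only: sum.insert sum.empty finite.intros insert_iff empty_iff index5_distinct simp_thms
      add.assoc add_0_right)

lemma index4_distinct [simp]:
  "(1::4) \<noteq> 2" "(1::4) \<noteq> 3" "(1::4) \<noteq> 4" "(2::4) \<noteq> 1" "(2::4) \<noteq> 3" "(2::4) \<noteq> 4"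
  "(3::4) \<noteq> 1" "(3::4) \<noteq> 2" "(3::4) \<noteq> 4" "(4::4) \<noteq> 1" "(4::4) \<noteq> 2" "(4::4) \<noteq> 3"
  by simp_all

lemma vector_4 [simp]:
  "(vector [a, b, c, d] :: 'a::zero^4) $ 1 = a"
  "(vector [a, b, c, d] :: 'a::zero^4) $ 2 = b"
  "(vector [a, b, c, d] :: 'a::zero^4) $ 3 = c"
  "(vector [a, b, c, d] :: 'a::zero^4) $ 4 = d"
  unfolding vector_def by simp_all

lemma mat4_eq_iff:
  "(A :: 'a^4^4) = B \<longleftrightarrow>
    (A$1$1 = B$1$1 \<and> A$1$2 = B$1$2 \<and> A$1$3 = B$1$3 \<and> A$1$4 = B$1$4) \<and>
    (A$2$1 = B$2$1 \<and> A$2$2 = B$2$2 \<and> A$2$3 = B$2$3 \<and> A$2$4 = B$2$4) \<and>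
    (A$3$1 = B$3$1 \<and> A$3$2 = B$3$2 \<and> A$3$3 = B$3$3 \<and> A$3$4 = B$3$4) \<and>
    (A$4$1 = B$4$1 \<and> A$4$2 = B$4$2 \<and> A$4$3 = B$4$3 \<and> A$4$4 = B$4$4)"
  by (simp add: vec_eq_iff forall_4)

subsection \<open>The Lie algebra of the covering group\<close>

text \<open>The ten free parameters of a matrix in \<open>sp4\<close>; by
  \<open>sp4_eq_spmat\<close> every element has this shape.\<close>

definition spmat ::
  "complex \<Rightarrow> complex \<Rightarrow> complex \<Rightarrow> complex \<Rightarrow> complex \<Rightarrow> complex \<Rightarrow> complex \<Rightarrow> complex \<Rightarrow> complex
    \<Rightarrow> complex \<Rightarrow> complex^4^4" where
  "spmat a b c d e f g h k l =
     vector [vector [a, b, c, d], vector [e, f, g, c], vector [h, k, - f, - b], vector [l, h, - e,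
         - a]]"

lemma symp_mat_vector:
  "symp_mat = vector [vector [0, 0, 0, 1], vector [0, 0, 1, 0], vector [0, - 1, 0, 0],
      vector [- 1, 0, 0, 0]]"
  by (simp add: mat4_eq_iff symp_mat_def mat_unit_def)

lemma spmat_in_sp4: "spmat a b c d e f g h k l \<in> sp4"
  by (simp add: sp4_def spmat_def symp_mat_vector mat4_eq_iff matrix_mult_entry sum_4 transpose_def)

lemma sp4_eq_spmat:
  assumes "X \<in> sp4"
  shows "X = spmat (X$1$1) (X$1$2) (X$1$3) (X$1$4) (X$2$1) (X$2$2) (X$2$3) (X$3$1) (X$3$2) (X$4$1)"
proof -
  have "transpose X ** symp_mat + symp_mat ** X = 0"
    using assms by (simp add: sp4_def)
  then have e: "(transpose X ** symp_mat + symp_mat ** X) $ p $ q = 0" for p q by simp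
  note ev = symp_mat_vector matrix_mult_entry sum_4 transpose_def
  have "X$4$4 = - X$1$1" "X$3$3 = - X$2$2" "X$3$4 = - X$1$2" "X$4$3 = - X$2$1" "X$4$2 = X$3$1"
      "X$2$4 = X$1$3"
    using e[of 1 4] e[of 2 3] e[of 2 4] e[of 1 3] e[of 1 2] e[of 3 4]
    by (simp_all add: ev add_eq_0_iff)
  then show ?thesis
    by (simp add: mat4_eq_iff spmat_def)
qed

abbreviation root2 :: complex where
  "root2 \<equiv> complex_of_real (sqrt 2)"

lemma root2_square [simp]: "root2 * root2 = 2" "root2 * (root2 * x) = 2 * x"
  by (simp_all flip: of_real_mult mult.assoc)

lemma ext_basis_vector:
  "ext_basis (-2) = vector [vector [0, 1, 0, 0], vector [- 1, 0, 0, 0], vector [0, 0, 0, 0],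
      vector [0, 0, 0, 0]]"
  "ext_basis (-1) = vector [vector [0, 0, 1, 0], vector [0, 0, 0, 0], vector [- 1, 0, 0, 0],
      vector [0, 0, 0, 0]]"
  "ext_basis 0 = vector [vector [0, 0, 0, 1 / root2], vector [0, 0, - 1 / root2, 0],
      vector [0, 1 / root2, 0, 0], vector [- 1 / root2, 0, 0, 0]]"
  "ext_basis 1 = vector [vector [0, 0, 0, 0], vector [0, 0, 0, 1], vector [0, 0, 0, 0], vector [0,
      - 1, 0, 0]]"
  "ext_basis 2 = vector [vector [0, 0, 0, 0], vector [0, 0, 0, 0], vector [0, 0, 0, - 1],
      vector [0, 0, 1, 0]]"
  by (simp_all add: mat4_eq_iff ext_basis_def wedge_def mat_unit_def)
     (simp add: scaleR_conv_of_real)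

lemma ext_coord_simps:
  "ext_coord (-2) A = A $ 1 $ 2" "ext_coord (-1) A = A $ 1 $ 3"
  "ext_coord 0 A = (A $ 1 $ 4 - A $ 2 $ 3) / root2"
  "ext_coord 1 A = A $ 2 $ 4" "ext_coord 2 A = - (A $ 3 $ 4)"
  by (simp_all add: ext_coord_def)

lemma dcover_spmat:
  fixes a b c d e f g h k l
  defines "A \<equiv> dcover (spmat a b c d e f g h k l)"
  shows
  "A $ (-2) $ (-2) = a + f" "A $ (-1) $ (-2) = k" "A $ 0 $ (-2) = root2 * h" "A $ 1 $ (-2) = - l"
      "A $ 2 $ (-2) = 0"
  "A $ (-2) $ (-1) = g" "A $ (-1) $ (-1) = a - f" "A $ 0 $ (-1) = - root2 * e" "A $ 1 $ (-1) = 0"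
      "A $ 2 $ (-1) = l"
  "A $ (-2) $ 0 = root2 * c" "A $ (-1) $ 0 = - root2 * b" "A $ 0 $ 0 = 0" "A $ 1 $ 0 = root2 * e"
      "A $ 2 $ 0 = - root2 * h"
  "A $ (-2) $ 1 = - d" "A $ (-1) $ 1 = 0" "A $ 0 $ 1 = root2 * b" "A $ 1 $ 1 = f - a" "A $ 2 $ 1 = - k"
  "A $ (-2) $ 2 = 0" "A $ (-1) $ 2 = d" "A $ 0 $ 2 = - root2 * c" "A $ 1 $ 2 = - g"
      "A $ 2 $ 2 = - a - f"
  unfolding A_def dcover_def spmat_def
  by (simp_all add: ext_coord_simps ext_basis_vector matrix_mult_entry sum_4 transpose_def field_simps)

text \<open>The inverse of \<open>dcover\<close>, read off from the table
  \<open>dcover_spmat\<close>. It makes the \<open>inv_into\<close> in \<open>act_Sp4\<close>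
  explicit.\<close>

definition sp_of :: "complex^5^5 \<Rightarrow> complex^4^4" where
  "sp_of A = spmat ((A $ (-2) $ (-2) + A $ (-1) $ (-1)) / 2) (- A $ (-1) $ 0 / root2) (A $ (-2)
      $ 0 / root2)
     (- A $ (-2) $ 1) (- A $ 0 $ (-1) / root2) ((A $ (-2) $ (-2) - A $ (-1) $ (-1)) / 2) (A $ (-2)
         $ (-1))
     (A $ 0 $ (-2) / root2) (A $ (-1) $ (-2)) (- A $ 1 $ (-2))"

lemma sp_of_dcover: "X \<in> sp4 \<Longrightarrow> sp_of (dcover X) = X"
proof -
  have "sp_of (dcover (spmat a b c d e f g h k l)) = spmat a b c d e f g h k l" for a b c d e f g h k l
    unfolding sp_of_def dcover_spmat by (simp add: add_divide_distrib diff_divide_distrib)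
  then show "X \<in> sp4 \<Longrightarrow> sp_of (dcover X) = X"
    using sp4_eq_spmat[of X] by metis
qed

lemma dcover_sp_of:
  assumes "\<And>p q. A $ p $ q = - A $ (- q) $ (- p)"
  shows "dcover (sp_of A) = A"
proof -
  have z: "x = 0" if "x = - x" for x :: complex
    using that by (simp add: eq_neg_iff_add_eq_0)
  have zero: "A $ (-2) $ 2 = 0" "A $ (-1) $ 1 = 0" "A $ 0 $ 0 = 0" "A $ 1 $ (-1) = 0" "A $ 2 $ (-2) = 0"
    using assms[of "-2" 2] assms[of "-1" 1] assms[of 0 0] assms[of 1 "-1"] assms[of 2 "-2"]
    by (auto intro: z)
  have neg: "A $ 2 $ 2 = - A $ (-2) $ (-2)" "A $ 1 $ 1 = - A $ (-1) $ (-1)"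
      "A $ (-1) $ 2 = - A $ (-2) $ 1"
    "A $ 0 $ 2 = - A $ (-2) $ 0" "A $ 1 $ 2 = - A $ (-2) $ (-1)" "A $ 0 $ 1 = - A $ (-1) $ 0"
    "A $ 1 $ 0 = - A $ 0 $ (-1)" "A $ 2 $ 0 = - A $ 0 $ (-2)" "A $ 2 $ 1 = - A $ (-1) $ (-2)"
    "A $ 2 $ (-1) = - A $ 1 $ (-2)"
    using assms[of 2 2] assms[of 1 1] assms[of "-1" 2] assms[of 0 2] assms[of 1 2] assms[of 0 1]
      assms[of 1 0] assms[of 2 0] assms[of 2 1] assms[of 2 "-1"] by simp_all
  show ?thesis
    unfolding vec_eq_iff forall_5 sp_of_def dcover_spmat by (simp add: zero neg field_simps)
qed

lemma gen_F_antisym: "gen_F i j $ p $ q = - gen_F i j $ (- q) $ (- p)"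
proof -
  have "(- q = i \<and> - p = j) = (p = - j \<and> q = - i)"
    by (metis add.inverse_inverse)
  then show ?thesis by (simp add: gen_F_def mat_unit_def conj_commute)
qed

lemma gen_F_o5: "transpose (gen_F i j) ** scalar_prod_mat + scalar_prod_mat ** gen_F i j = 0"
proof -
  have e: "(A ** scalar_prod_mat) $ p $ q = A $ p $ (- q)"
      "(scalar_prod_mat ** A) $ p $ q = A $ (- p) $ q" for A p q
  proof -
    have 1: "(p = - k) = (k = - p)" for k by (metis add.inverse_inverse)
    show "(A ** scalar_prod_mat) $ p $ q = A $ p $ (- q)"
        "(scalar_prod_mat ** A) $ p $ q = A $ (- p) $ q"
      unfolding matrix_mult_entry scalar_prod_mat_def
      by (simp_all add: 1 if_distrib[of "\<lambda>x. _ * x"] if_distrib[of "\<lambda>x. x * _"] cong: if_cong)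
  qed
  have "gen_F i j $ (- q) $ p + gen_F i j $ (- p) $ q = 0" for p q
    using gen_F_antisym[of i j "- q" p] by simp
  then show ?thesis
    unfolding vec_eq_iff vector_add_component e by (simp add: transpose_def)
qed

lemma inv_dcover_gen_F: "inv_into sp4 dcover (gen_F i j) = sp_of (gen_F i j)"
proof -
  have "sp_of (gen_F i j) \<in> sp4"
    unfolding sp_of_def by (rule spmat_in_sp4)
  moreover have "inj_on dcover sp4"
    by (rule inj_on_inverseI[of _ sp_of]) (rule sp_of_dcover)
  moreover have "dcover (sp_of (gen_F i j)) = gen_F i j"
    by (rule dcover_sp_of) (rule gen_F_antisym)
  ultimately show ?thesis by (metis inv_into_f_f)
qed

subsection \<open>The symplectic group and the covering\<close>

lemma Sp4_one: "mat 1 \<in> Sp4"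
  by (simp add: Sp4_def transpose_mat)

lemma Sp4_mult:
  assumes "h \<in> Sp4" and "k \<in> Sp4"
  shows "h ** k \<in> Sp4"
proof -
  have "transpose (h ** k) ** symp_mat ** (h ** k) = transpose k ** (transpose h ** symp_mat ** h) ** k"
    by (simp add: matrix_transpose_mul matrix_mul_assoc)
  then show ?thesis using assms by (simp add: Sp4_def)
qed

lemma symp_mat_square: "symp_mat ** symp_mat = - mat 1"
  by (simp add: mat4_eq_iff symp_mat_vector matrix_mult_entry sum_4 mat_entry)

lemma matrix_mult_uminus: "(- A) ** B = - (A ** B)" "A ** (- B) = - (A ** B)" for A B :: "complex^'n^'n"
  by (simp_all add: vec_eq_iff matrix_mult_entry sum_negf)

text \<open>With J = \<open>symp_mat\<close> and J^2 = -1 the inverse is minus J times the transpose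
  of \<open>h\<close> times J. A left inverse of a square matrix is also a right inverse, and this
  turns the symplectic relations between columns into those between rows, the last clause.\<close>

lemma Sp4_inverse:
  assumes "h \<in> Sp4"
  obtains k where "k \<in> Sp4" "h ** k = mat 1" "k ** h = mat 1" "h ** symp_mat ** transpose h = symp_mat"
proof -
  let ?k = "- (symp_mat ** transpose h ** symp_mat)"
  have J: "transpose h ** symp_mat ** h = symp_mat" using assms by (simp add: Sp4_def)
  have "?k ** h = - (symp_mat ** (transpose h ** symp_mat ** h))"
    by (simp add: matrix_mult_uminus matrix_mul_assoc)
  then have kh: "?k ** h = mat 1"
    by (simp add: J symp_mat_square)
  then have hk: "h ** ?k = mat 1"
    by (simp add: matrix_left_right_inverse)
  have "h ** symp_mat ** transpose h = - (h ** symp_mat ** transpose h ** (symp_mat ** symp_mat))"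
    by (simp add: symp_mat_square matrix_mult_uminus)
  also have "\<dots> = h ** ?k ** symp_mat"
    by (simp add: matrix_mult_uminus matrix_mul_assoc)
  finally have row: "h ** symp_mat ** transpose h = symp_mat"
    by (simp add: hk)
  have tJ: "transpose symp_mat = - symp_mat"
    by (simp add: mat4_eq_iff symp_mat_vector transpose_def)
  have tneg: "transpose (- A) = - transpose A" for A :: "complex^4^4"
    by (simp add: vec_eq_iff transpose_def)
  have "transpose ?k = - (symp_mat ** h ** symp_mat)"
    by (simp add: tneg matrix_transpose_mul tJ matrix_mult_uminus matrix_mul_assoc)
  then have "transpose ?k ** symp_mat ** ?k
     = symp_mat ** h ** (symp_mat ** symp_mat) ** symp_mat ** transpose h ** symp_mat"
    by (simp add: matrix_mult_uminus matrix_mul_assoc)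
  also have "\<dots> = - (symp_mat ** (h ** symp_mat ** transpose h) ** symp_mat)"
    by (simp add: symp_mat_square matrix_mult_uminus matrix_mul_assoc)
  also have "\<dots> = symp_mat"
    by (simp add: row symp_mat_square matrix_mult_uminus)
  finally have "?k \<in> Sp4" by (simp add: Sp4_def)
  with hk kh row show ?thesis using that by blast
qed

lemma Sp4_transpose: "h \<in> Sp4 \<Longrightarrow> transpose h \<in> Sp4"
  using Sp4_inverse[of h] by (auto simp: Sp4_def)

lemma symp_form_entry:
  "(transpose h ** symp_mat ** h) $ p $ q = h$1$p * h$4$q + h$2$p * h$3$q - h$3$p * h$2$q - h$4$p
      * h$1$q"
  by (simp add: matrix_mult_entry sum_4 symp_mat_vector transpose_def)

text \<open>The form has real entries. With \<open>Sp4_transpose\<close> this keeps the adjoint of a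
  symplectic matrix in the group, as the kernel argument requires.\<close>

lemma Sp4_cnj:
  assumes "h \<in> Sp4"
  shows "map_matrix cnj h \<in> Sp4"
proof -
  have "(transpose (map_matrix cnj h) ** symp_mat ** map_matrix cnj h) $ p $ q = cnj
      (symp_mat $ p $ q)" for p q
    unfolding symp_form_entry Sp4_form[OF assms, symmetric] by (simp add: map_matrix_def)
  moreover have "cnj (symp_mat $ p $ q) = symp_mat $ p $ q" for p q
    by (simp add: symp_mat_def mat_unit_def)
  ultimately show ?thesis by (simp add: Sp4_def vec_eq_iff)
qed

lemma Sp4_row_form:
  assumes "h \<in> Sp4"
  shows "h$p$1 * h$q$4 + h$p$2 * h$q$3 - h$p$3 * h$q$2 - h$p$4 * h$q$1 = symp_mat $ p $ q"
  using Sp4_form[OF Sp4_transpose[OF assms], of p q] by (simp add: transpose_def)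

lemma cover_rows:
  "cover h $ (-2) $ (-2) = h$1$1 * h$2$2 - h$1$2 * h$2$1"
  "cover h $ (-2) $ (-1) = h$1$1 * h$2$3 - h$1$3 * h$2$1"
  "cover h $ (-2) $ 0 = ((h$1$1 * h$2$4 - h$1$4 * h$2$1) - (h$1$2 * h$2$3 - h$1$3 * h$2$2)) / root2"
  "cover h $ (-2) $ 1 = h$1$2 * h$2$4 - h$1$4 * h$2$2"
  "cover h $ (-2) $ 2 = - (h$1$3 * h$2$4 - h$1$4 * h$2$3)"
  "cover h $ (-1) $ (-2) = h$1$1 * h$3$2 - h$1$2 * h$3$1"
  "cover h $ (-1) $ (-1) = h$1$1 * h$3$3 - h$1$3 * h$3$1"
  "cover h $ (-1) $ 0 = ((h$1$1 * h$3$4 - h$1$4 * h$3$1) - (h$1$2 * h$3$3 - h$1$3 * h$3$2)) / root2"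
  "cover h $ (-1) $ 1 = h$1$2 * h$3$4 - h$1$4 * h$3$2"
  "cover h $ (-1) $ 2 = - (h$1$3 * h$3$4 - h$1$4 * h$3$3)"
  unfolding cover_def
  by (simp_all add: ext_coord_simps ext_basis_vector matrix_mult_entry sum_4 transpose_def
      add_divide_distrib diff_divide_distrib algebra_simps)

definition det3 :: "complex^4^4 \<Rightarrow> 4 \<Rightarrow> 4 \<Rightarrow> 4 \<Rightarrow> complex" where
  "det3 h a b c = h$1$a * (h$2$b * h$3$c - h$2$c * h$3$b) - h$1$b * (h$2$a * h$3$c - h$2$c * h$3$a)
     + h$1$c * (h$2$a * h$3$b - h$2$b * h$3$a)"

lemma Sp4_column_forms:
  assumes "h \<in> Sp4"
  defines "form p q \<equiv> h$1$p * h$4$q + h$2$p * h$3$q - h$3$p * h$2$q - h$4$p * h$1$q"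
  shows "form 1 2 = 0" "form 1 3 = 0" "form 1 4 = 1" "form 2 3 = 1" "form 2 4 = 0" "form 3 4 = 0"
  unfolding form_def Sp4_form[OF assms(1)] by (simp_all add: symp_mat_vector)

text \<open>Up to sign these are cofactors of the last row, that is, entries of the inverse matrix,
  and the inverse of a symplectic matrix consists of entries of \<open>h\<close> up to sign. The
  identities are obtained by eliminating the last row from the column relations.\<close>

lemma Sp4_cofactors:
  assumes "h \<in> Sp4"
  shows "det3 h 1 2 3 = h$1$1" "det3 h 1 2 4 = - h$1$2" "det3 h 2 3 4 = h$1$4"
proof -
  note e = Sp4_column_forms[OF assms(1)]
  show "det3 h 1 2 3 = h$1$1" unfolding det3_def using e(1,2,4) by algebra
  show "det3 h 1 2 4 = - h$1$2" unfolding det3_def using e(1,3,5) by algebra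
  show "det3 h 2 3 4 = h$1$4" unfolding det3_def using e(4,5,6) by algebra
qed

text \<open>Rows -2 and -1 of \<open>cover h\<close> consist of minors in rows 1, 2 and in rows 1, 3
  of \<open>h\<close>. Their common row 1 makes a minor of these two rows a combination of first-row
  entries times \<open>det3\<close>, and \<open>Sp4_cofactors\<close> turns each \<open>det3\<close>
  into a first-row entry again.\<close>

lemma minor_cover:
  assumes "h \<in> Sp4"
  shows "minor (-2) (-1) (cover h) = (h$1$1)\<^sup>2"
    and "minor (-2) 0 (cover h) = - root2 * h$1$1 * h$1$2"
    and "minor (-2) 1 (cover h) = - (h$1$2)\<^sup>2"
    and "minor (-1) 1 (cover h) = - (h$1$2 * h$1$3 - h$1$1 * h$1$4)"
proof -
  show "minor (-2) (-1) (cover h) = (h$1$1)\<^sup>2" by (rule minor_cover_eq_square[OF assms])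
  note c = Sp4_cofactors[OF assms]
  have "minor (-2) 0 (cover h) = (h$1$1 * det3 h 1 2 4 - h$1$2 * det3 h 1 2 3) / root2"
    unfolding minor_def cover_rows det3_def
    by (simp add: field_simps)
  then show "minor (-2) 0 (cover h) = - root2 * h$1$1 * h$1$2"
    by (simp only: c) (simp add: divide_eq_eq algebra_simps)
  have "minor (-2) 1 (cover h) = h$1$2 * det3 h 1 2 4"
    unfolding minor_def cover_rows det3_def by (simp add: algebra_simps)
  then show "minor (-2) 1 (cover h) = - (h$1$2)\<^sup>2"
    by (simp add: c power2_eq_square)
  have "minor (-1) 1 (cover h) = h$1$1 * det3 h 2 3 4 + h$1$3 * det3 h 1 2 4"
    unfolding minor_def cover_rows det3_def by (simp add: algebra_simps)
  then show "minor (-1) 1 (cover h) = - (h$1$2 * h$1$3 - h$1$1 * h$1$4)"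
    by (simp add: c)
qed

text \<open>For an antisymmetric matrix the last condition is the vanishing of its contraction with
  \<open>symp_mat\<close>. By \<open>primitive_expand\<close> such matrices lie in the span of
  \<open>ext_basis\<close>.\<close>

definition primitive :: "complex^4^4 \<Rightarrow> bool" where
  "primitive A \<longleftrightarrow> (\<forall>p q. A $ p $ q = - A $ q $ p) \<and> A $ 1 $ 4 + A $ 2 $ 3 = 0"

lemma primitive_expand:
  assumes "primitive A"
  shows "A = mscale (ext_coord (-2) A) (ext_basis (-2)) + mscale (ext_coord (-1) A) (ext_basis (-1))
    + mscale (ext_coord 0 A) (ext_basis 0) + mscale (ext_coord 1 A) (ext_basis 1) + mscale
        (ext_coord 2 A) (ext_basis 2)"
proof -
  have s: "A $ p $ q = - A $ q $ p" for p q using assms unfolding primitive_def by blast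
  have "x = 0" if "x = - x" for x :: complex
    using that by (simp add: eq_neg_iff_add_eq_0)
  then have z: "A $ p $ p = 0" for p using s[of p p] by blast
  have "A $ 1 $ 4 + A $ 2 $ 3 = 0" using assms unfolding primitive_def by blast
  then have t: "A $ 2 $ 3 = - A $ 1 $ 4" by (simp only: add_eq_0_iff)
  have t': "A $ 3 $ 2 = A $ 1 $ 4" using s[of 3 2] t by (metis minus_minus)
  show ?thesis
    unfolding mat4_eq_iff ext_basis_vector ext_coord_simps vector_add_component mscale_entry vector_4
      s[of 2 1] s[of 3 1] s[of 4 1] t t' s[of 4 2] s[of 4 3] z by simp
qed

lemma primitive_conj_basis:
  assumes "h \<in> Sp4"
  shows "primitive (h ** ext_basis j ** transpose h)"
proof -
  note e = Sp4_column_forms[OF assms(1)]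
  have t: "transpose (ext_basis j) = - ext_basis j"
    using exhaust_5[of j]
    by (elim disjE) (simp_all add: mat4_eq_iff ext_basis_vector transpose_def)
  have "transpose (h ** ext_basis j ** transpose h) = - (h ** ext_basis j ** transpose h)"
    by (simp add: matrix_transpose_mul t matrix_mult_uminus matrix_mul_assoc)
  then have 1: "(h ** ext_basis j ** transpose h) $ p $ q = - (h ** ext_basis j ** transpose h)
      $ q $ p" for p q
    by (metis (no_types, lifting) transpose_def vec_lambda_beta vector_uminus_component)
  have "(h ** ext_basis j ** transpose h) $ 1 $ 4 + (h ** ext_basis j ** transpose h) $ 2 $ 3 = 0"
    using exhaust_5[of j]
  proof (elim disjE)
    assume "j = 0"
    have "(h ** ext_basis 0 ** transpose h) $ 1 $ 4 + (h ** ext_basis 0 ** transpose h) $ 2 $ 3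
      = ((h$1$1 * h$4$4 + h$2$1 * h$3$4 - h$3$1 * h$2$4 - h$4$1 * h$1$4)
        - (h$1$2 * h$4$3 + h$2$2 * h$3$3 - h$3$2 * h$2$3 - h$4$2 * h$1$3)) / root2"
      by (simp add: ext_basis_vector matrix_mult_entry sum_4 transpose_def
          add_divide_distrib diff_divide_distrib algebra_simps)
    then show ?thesis by (simp only: e \<open>j = 0\<close>) simp
  qed (simp_all add: ext_basis_vector matrix_mult_entry sum_4 transpose_def, use e in
      \<open>simp_all add: algebra_simps\<close>)
  with 1 show ?thesis unfolding primitive_def by blast
qed

lemma ext_coord_add: "ext_coord i (A + B) = ext_coord i A + ext_coord i B"
  by (simp add: ext_coord_def add_divide_distrib diff_divide_distrib)

lemma ext_coord_mscale: "ext_coord i (mscale c A) = c * ext_coord i A"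
  by (simp add: ext_coord_def diff_divide_distrib right_diff_distrib)

lemma cover_entry: "cover h $ i $ j = ext_coord i (h ** ext_basis j ** transpose h)"
  by (simp add: cover_def)

lemma cover_mult:
  assumes "k \<in> Sp4"
  shows "cover (h ** k) = cover h ** cover k"
proof -
  have "cover (h ** k) $ i $ j = (cover h ** cover k) $ i $ j" for i j
  proof -
    let ?C = "k ** ext_basis j ** transpose k"
    have "h ** k ** ext_basis j ** transpose (h ** k) = h ** ?C ** transpose h"
      by (simp add: matrix_transpose_mul matrix_mul_assoc)
    also have "\<dots> = mscale (ext_coord (-2) ?C) (h ** ext_basis (-2) ** transpose h)
       + mscale (ext_coord (-1) ?C) (h ** ext_basis (-1) ** transpose h)
       + mscale (ext_coord 0 ?C) (h ** ext_basis 0 ** transpose h)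
       + mscale (ext_coord 1 ?C) (h ** ext_basis 1 ** transpose h)
       + mscale (ext_coord 2 ?C) (h ** ext_basis 2 ** transpose h)"
      by (subst primitive_expand[OF primitive_conj_basis[OF assms, of j]])
         (simp only: matrix_mult_distrib mscale_mult_left mscale_mult_right)
    finally have e: "ext_coord i (h ** k ** ext_basis j ** transpose (h ** k)) = ext_coord i \<dots>"
      by (rule arg_cong)
    show ?thesis
      unfolding matrix_mult_entry[of "cover _"] sum_5 cover_entry e ext_coord_add ext_coord_mscale
      by (simp only: mult.commute)
  qed
  then show ?thesis by (simp add: vec_eq_iff)
qed

lemma cover_one: "cover (mat 1) = mat 1"
  unfolding vec_eq_iff forall_5 cover_def
  by (simp add: transpose_mat ext_coord_simps ext_basis_vector mat_entry)

text \<open>On the primitive part the scalar product that defines \<^const>\<open>scalar_prod_mat\<close> is half of the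
  following form, whose invariance does not require \<open>det h = 1\<close>.\<close>

definition trace_form :: "complex^4^4 \<Rightarrow> complex^4^4 \<Rightarrow> complex" where
  "trace_form A B = trace (A ** symp_mat ** B ** symp_mat)"

lemma trace_form_basis: "trace_form (ext_basis i) (ext_basis j) = 2 * scalar_prod_mat $ i $ j"
proof -
  have "\<forall>i j. trace_form (ext_basis i) (ext_basis j) = 2 * scalar_prod_mat $ i $ j"
    unfolding forall_5 trace_form_def trace_def
    by (simp add: scalar_prod_mat_def ext_basis_vector symp_mat_vector matrix_mult_entry sum_4
        field_simps)
  then show ?thesis by blast
qed

lemma trace_add_mscale: "trace (A + B) = trace A + trace B"
    "trace (mscale c A) = c * trace A" for A B :: "complex^'n^'n"
  by (simp_all add: trace_def sum.distrib sum_distrib_left)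

lemma trace_form_bilinear:
  "trace_form (A + A') B = trace_form A B + trace_form A' B"
  "trace_form (mscale c A) B = c * trace_form A B"
  "trace_form A (B + B') = trace_form A B + trace_form A B'"
  "trace_form A (mscale c B) = c * trace_form A B"
  unfolding trace_form_def matrix_mult_distrib mscale_mult_left mscale_mult_right trace_add_mscale
      by simp_all

lemma trace_form_invariant:
  assumes "h \<in> Sp4"
  shows "trace_form (h ** A ** transpose h) (h ** B ** transpose h) = trace_form A B"
proof -
  have J: "transpose h ** symp_mat ** h = symp_mat" using assms by (simp add: Sp4_def)
  have "trace_form (h ** A ** transpose h) (h ** B ** transpose h)
     = trace (h ** (A ** (transpose h ** symp_mat ** h) ** B ** transpose h ** symp_mat))"
    by (simp add: trace_form_def matrix_mul_assoc)
  also have "\<dots> = trace (A ** symp_mat ** B ** (transpose h ** symp_mat ** h))"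
    unfolding J by (subst trace_mul_sym) (simp only: matrix_mul_assoc[symmetric] J[unfolded
        matrix_mul_assoc[symmetric]])
  finally show ?thesis unfolding J trace_form_def .
qed

lemma cover_preserves_form:
  assumes "h \<in> Sp4"
  shows "transpose (cover h) ** scalar_prod_mat ** cover h = scalar_prod_mat"
proof -
  have "(transpose (cover h) ** scalar_prod_mat ** cover h) $ j $ l = scalar_prod_mat $ j $ l" for j l
  proof -
    let ?B = "\<lambda>j. h ** ext_basis j ** transpose h"
    have "2 * scalar_prod_mat $ j $ l = trace_form (?B j) (?B l)"
      by (simp add: trace_form_invariant[OF assms] trace_form_basis)
    also have "\<dots> = 2 * (transpose (cover h) ** scalar_prod_mat ** cover h) $ j $ l"
      apply (subst primitive_expand[OF primitive_conj_basis[OF assms, of j]])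
      apply (subst primitive_expand[OF primitive_conj_basis[OF assms, of l]])
      unfolding trace_form_bilinear trace_form_basis
      by (simp add: matrix_mult_entry sum_5 scalar_prod_mat_def transpose_def cover_def algebra_simps)
    finally show ?thesis by simp
  qed
  then show ?thesis by (simp add: vec_eq_iff)
qed

subsection \<open>Generation by root subgroups\<close>

text \<open>One pair for each of the eight roots of the Lie algebra, the four positive ones first,
  followed by their negatives; \<open>gen_F i j\<close> and \<open>gen_F (- j) (- i)\<close> differ
  only in sign.\<close>

definition root_pairs :: "(5 \<times> 5) set" where
  "root_pairs = {(-2, -1), (-2, 0), (-2, 1), (-1, 0), (-1, -2), (0, -2), (1, -2), (0, -1)}"

definition sp_elem :: "5 \<Rightarrow> 5 \<Rightarrow> complex \<Rightarrow> complex^4^4" where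
  "sp_elem i j t = mat 1 + mscale t (sp_of (gen_F i j))"

lemma sp_of_gen_F:
  "sp_of (gen_F (-2) (-1)) = spmat 0 0 0 0 0 0 1 0 0 0"
  "sp_of (gen_F (-2) 0) = spmat 0 0 (1 / root2) 0 0 0 0 0 0 0"
  "sp_of (gen_F (-2) 1) = spmat 0 0 0 (- 1) 0 0 0 0 0 0"
  "sp_of (gen_F (-1) 0) = spmat 0 (- 1 / root2) 0 0 0 0 0 0 0 0"
  "sp_of (gen_F (-1) (-2)) = spmat 0 0 0 0 0 0 0 0 1 0"
  "sp_of (gen_F 0 (-2)) = spmat 0 0 0 0 0 0 0 (1 / root2) 0 0"
  "sp_of (gen_F 1 (-2)) = spmat 0 0 0 0 0 0 0 0 0 (- 1)"
  "sp_of (gen_F 0 (-1)) = spmat 0 0 0 0 (- 1 / root2) 0 0 0 0 0"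
  "sp_of (gen_F (-2) (-2)) = spmat (1 / 2) 0 0 0 0 (1 / 2) 0 0 0 0"
  "sp_of (gen_F (-1) (-1)) = spmat (1 / 2) 0 0 0 0 (- 1 / 2) 0 0 0 0"
  by (simp_all add: sp_of_def gen_F_def mat_unit_def)

lemma sp_of_gen_F_in_sp4: "sp_of (gen_F i j) \<in> sp4"
  unfolding sp_of_def by (rule spmat_in_sp4)

text \<open>A peculiarity of the four-dimensional representation: there every root vector has square
  zero, so root subgroups are affine in the parameter. In the five-dimensional one the short roots
  produce the quadratic terms of \<open>cover_sp_elem_columns\<close>.\<close>

lemma sp_of_root_square:
  assumes "(i, j) \<in> root_pairs"
  shows "sp_of (gen_F i j) ** sp_of (gen_F i j) = 0"
  using assms unfolding root_pairs_def
  by (auto simp: sp_of_gen_F spmat_def mat4_eq_iff matrix_mult_entry sum_4 simp del: div_0)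

lemma mat_exp_sp_of_root:
  "(i, j) \<in> root_pairs \<Longrightarrow> mat_exp (mscale t (sp_of (gen_F i j))) = sp_elem i j t"
  by (simp add: mat_exp_square_zero sp_of_root_square sp_elem_def)

lemma mat_exp_Sp4:
  assumes "X \<in> sp4"
  shows "mat_exp (mscale t X) \<in> Sp4"
  using mat_exp_preserves_form[of X symp_mat t] assms by (simp add: sp4_def Sp4_def)

lemma sp_elem_Sp4: "(i, j) \<in> root_pairs \<Longrightarrow> sp_elem i j t \<in> Sp4"
  using mat_exp_Sp4[OF sp_of_gen_F_in_sp4] mat_exp_sp_of_root by metis

lemma sp_elem_add:
  assumes "(i, j) \<in> root_pairs"
  shows "sp_elem i j s ** sp_elem i j t = sp_elem i j (s + t)"
  unfolding sp_elem_def matrix_mult_distrib mscale_mult_left mscale_mult_right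
      sp_of_root_square[OF assms]
  by (simp add: vec_eq_iff algebra_simps)

lemma sp_elem_zero: "sp_elem i j 0 = mat 1"
  by (simp add: sp_elem_def vec_eq_iff)

lemma sp_elem_columns:
  "(h ** sp_elem (-2) (-1) t) $ p $ 1 = h $ p $ 1" "(h ** sp_elem (-2) (-1) t) $ p $ 2 = h $ p $ 2"
  "(h ** sp_elem (-2) (-1) t) $ p $ 3 = h $ p $ 3 + t * h $ p $ 2"
      "(h ** sp_elem (-2) (-1) t) $ p $ 4 = h $ p $ 4"
  "(h ** sp_elem (-2) 0 t) $ p $ 1 = h $ p $ 1" "(h ** sp_elem (-2) 0 t) $ p $ 2 = h $ p $ 2"
  "(h ** sp_elem (-2) 0 t) $ p $ 3 = h $ p $ 3 + t / root2 * h $ p $ 1"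
  "(h ** sp_elem (-2) 0 t) $ p $ 4 = h $ p $ 4 + t / root2 * h $ p $ 2"
  "(h ** sp_elem (-2) 1 t) $ p $ 1 = h $ p $ 1" "(h ** sp_elem (-2) 1 t) $ p $ 2 = h $ p $ 2"
  "(h ** sp_elem (-2) 1 t) $ p $ 3 = h $ p $ 3" "(h ** sp_elem (-2) 1 t)
      $ p $ 4 = h $ p $ 4 - t * h $ p $ 1"
  "(h ** sp_elem (-1) 0 t) $ p $ 1 = h $ p $ 1"
  "(h ** sp_elem (-1) 0 t) $ p $ 2 = h $ p $ 2 - t / root2 * h $ p $ 1"
  "(h ** sp_elem (-1) 0 t) $ p $ 3 = h $ p $ 3"
  "(h ** sp_elem (-1) 0 t) $ p $ 4 = h $ p $ 4 + t / root2 * h $ p $ 3"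
  "(h ** sp_elem (-1) (-2) t) $ p $ 1 = h $ p $ 1"
  "(h ** sp_elem (-1) (-2) t) $ p $ 2 = h $ p $ 2 + t * h $ p $ 3"
  "(h ** sp_elem (-1) (-2) t) $ p $ 3 = h $ p $ 3" "(h ** sp_elem (-1) (-2) t) $ p $ 4 = h $ p $ 4"
  "(h ** sp_elem 0 (-2) t) $ p $ 1 = h $ p $ 1 + t / root2 * h $ p $ 3"
  "(h ** sp_elem 0 (-2) t) $ p $ 2 = h $ p $ 2 + t / root2 * h $ p $ 4"
  "(h ** sp_elem 0 (-2) t) $ p $ 3 = h $ p $ 3" "(h ** sp_elem 0 (-2) t) $ p $ 4 = h $ p $ 4"
  "(h ** sp_elem 1 (-2) t) $ p $ 1 = h $ p $ 1 - t * h $ p $ 4"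
      "(h ** sp_elem 1 (-2) t) $ p $ 2 = h $ p $ 2"
  "(h ** sp_elem 1 (-2) t) $ p $ 3 = h $ p $ 3" "(h ** sp_elem 1 (-2) t) $ p $ 4 = h $ p $ 4"
  "(h ** sp_elem 0 (-1) t) $ p $ 1 = h $ p $ 1 - t / root2 * h $ p $ 2"
  "(h ** sp_elem 0 (-1) t) $ p $ 2 = h $ p $ 2"
  "(h ** sp_elem 0 (-1) t) $ p $ 3 = h $ p $ 3 + t / root2 * h $ p $ 4"
  "(h ** sp_elem 0 (-1) t) $ p $ 4 = h $ p $ 4"
  by (simp_all add: sp_elem_def matrix_mult_entry sum_4 sp_of_gen_F spmat_def mat_entry ring_distribs)

inductive_set root_generated :: "(complex^4^4) set" where
  one: "mat 1 \<in> root_generated"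
| step: "g \<in> root_generated \<Longrightarrow> (i, j) \<in> root_pairs \<Longrightarrow> g ** sp_elem i j t \<in> root_generated"

lemma root_generated_back:
  assumes "h ** sp_elem i j t \<in> root_generated" and "(i, j) \<in> root_pairs"
  shows "h \<in> root_generated"
proof -
  have "h ** sp_elem i j t ** sp_elem i j (- t) \<in> root_generated"
    by (rule root_generated.step[OF assms])
  then show ?thesis
    by (simp add: matrix_mul_assoc[symmetric] sp_elem_add assms(2) sp_elem_zero)
qed

lemma root_generated_backI:
  "(i, j) \<in> root_pairs \<Longrightarrow> h ** sp_elem i j t \<in> root_generated \<Longrightarrow> h \<in> root_generated"
  by (rule root_generated_back)

lemma Sp4_sp_elem: "h \<in> Sp4 \<Longrightarrow> (i, j) \<in> root_pairs \<Longrightarrow> h ** sp_elem i j t \<in> Sp4"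
  by (intro Sp4_mult sp_elem_Sp4)

text \<open>The relations between rows leave only a block of determinant 1 in rows and columns 2, 3.
  The root elements for (-2,-1) and (-1,-2) act on it as the two kinds of elementary matrices of
  SL2.\<close>

lemma root_generated_middle_block:
  assumes h: "h \<in> Sp4" and r1: "h$1$1 = 1" "h$1$2 = 0" "h$1$3 = 0" "h$1$4 = 0"
    and r4: "h$4$1 = 0" "h$4$2 = 0" "h$4$3 = 0" "h$4$4 = 1"
  shows "h \<in> root_generated"
proof -
  define blk where "blk h \<longleftrightarrow> h \<in> Sp4 \<and> h$1$1 = 1 \<and> h$1$2 = 0 \<and> h$1$3 = 0 \<and> h$1$4 = 0 \<and>
     h$4$1 = 0 \<and> h$4$2 = 0 \<and> h$4$3 = 0 \<and> h$4$4 = 1" for h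
  have det: "h$2$2 * h$3$3 - h$2$3 * h$3$2 = 1" and zero: "h$2$4 = 0" "h$3$4 = 0" "h$2$1 = 0"
      "h$3$1 = 0" if "blk h" for h
    using that Sp4_row_form[of h 2 3] Sp4_row_form[of h 1 2] Sp4_row_form[of h 1 3]
        Sp4_row_form[of h 4 2] Sp4_row_form[of h 4 3]
    by (simp_all add: blk_def symp_mat_vector)
  have stp: "blk (h ** sp_elem (-1) (-2) t)" "blk (h ** sp_elem (-2) (-1) t)" if "blk h" for h t
    using that by (simp_all add: blk_def sp_elem_columns Sp4_sp_elem root_pairs_def)
  have 1: "h \<in> root_generated" if "blk h" "h$2$2 = 1" "h$2$3 = 0" for h
  proof -
    let ?k = "h ** sp_elem (-1) (-2) (- h$3$2)"
    have d: "h$3$3 = 1" using det[OF that(1)] that by simp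
    have "?k = mat 1"
      using that d zero[OF that(1)] by (simp add: mat4_eq_iff sp_elem_columns mat_entry blk_def)
    then have "?k \<in> root_generated" by (simp add: root_generated.one)
    then show ?thesis by (rule root_generated_back) (simp add: root_pairs_def)
  qed
  have 2: "h \<in> root_generated" if "blk h" "h$2$2 = 1" for h
  proof -
    have "h ** sp_elem (-2) (-1) (- h$2$3) \<in> root_generated"
      by (rule 1[OF stp(2)[OF that(1)]]) (simp_all add: sp_elem_columns that)
    then show ?thesis by (rule root_generated_back) (simp add: root_pairs_def)
  qed
  have 3: "h \<in> root_generated" if "blk h" "h$2$3 \<noteq> 0" for h
  proof -
    have "h ** sp_elem (-1) (-2) ((1 - h$2$2) / h$2$3) \<in> root_generated"
      by (rule 2[OF stp(1)[OF that(1)]]) (simp add: sp_elem_columns that)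
    then show ?thesis by (rule root_generated_back) (simp add: root_pairs_def)
  qed
  have b: "blk h" using assms by (simp add: blk_def)
  show ?thesis
  proof (cases "h$2$3 = 0")
    case True
    \<comment> \<open>Here \<open>h$2$2\<close> is nonzero by the determinant, and adding column 2
      to column 3 moves it into the place of \<open>h$2$3\<close>.\<close>
    have "h ** sp_elem (-2) (-1) 1 \<in> root_generated"
      by (rule 3[OF stp(2)[OF b]]) (use det[OF b] True in \<open>auto simp: sp_elem_columns\<close>)
    then show ?thesis by (rule root_generated_back) (simp add: root_pairs_def)
  qed (rule 3[OF b])
qed

lemma root_generated_first_row:
  assumes h: "h \<in> Sp4" and r1: "h$1$1 = 1" "h$1$2 = 0" "h$1$3 = 0" "h$1$4 = 0"
  shows "h \<in> root_generated"
proof -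
  define row where "row h \<longleftrightarrow> h \<in> Sp4 \<and> h$1$1 = 1 \<and> h$1$2 = 0 \<and> h$1$3 = 0 \<and> h$1$4 = 0" for h
  have c4: "h$4$4 = 1" if "row h" for h
    using that Sp4_row_form[of h 1 4] by (simp add: row_def symp_mat_vector)
  have stp: "row (h ** sp_elem 1 (-2) t)" "row (h ** sp_elem 0 (-2) t)"
      "row (h ** sp_elem 0 (-1) t)" if "row h" for h t
    using that by (simp_all add: row_def sp_elem_columns Sp4_sp_elem root_pairs_def)
  have 1: "h \<in> root_generated" if "row h" "h$4$3 = 0" "h$4$2 = 0" for h
  proof -
    have "h ** sp_elem 1 (-2) (h$4$1) \<in> root_generated"
      using stp(1)[OF that(1), of "h$4$1"] c4[OF that(1)] that
      by (intro root_generated_middle_block) (simp_all add: row_def sp_elem_columns)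
    then show ?thesis by (rule root_generated_back) (simp add: root_pairs_def)
  qed
  have 2: "h \<in> root_generated" if "row h" "h$4$3 = 0" for h
  proof -
    have "h ** sp_elem 0 (-2) (- root2 * h$4$2) \<in> root_generated"
      using c4[OF that(1)] that(2)
      by (intro 1 stp that(1)) (simp_all add: sp_elem_columns)
    then show ?thesis by (rule root_generated_back) (simp add: root_pairs_def)
  qed
  have b: "row h" using assms by (simp add: row_def)
  have "h ** sp_elem 0 (-1) (- root2 * h$4$3) \<in> root_generated"
    using c4[OF b]
    by (intro 2 stp b) (simp_all add: sp_elem_columns)
  then show ?thesis by (rule root_generated_back) (simp add: root_pairs_def)
qed

text \<open>Gaussian elimination by column operations, with its last stages stated first. The pivot
  is normalised without diagonal matrices: once \<open>h$1$4\<close> is nonzero, a multiple of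
  column 4 turns \<open>h$1$1\<close> into 1, and the remaining cases are brought to this
  one.\<close>

lemma Sp4_root_generated:
  assumes h: "h \<in> Sp4"
  shows "h \<in> root_generated"
proof -
  note B = root_generated_backI and S = sp_elem_columns Sp4_sp_elem root_pairs_def
  have 1: "h \<in> root_generated" if "h \<in> Sp4" "h$1$1 = 1" "h$1$2 = 0" "h$1$3 = 0" for h
    by (rule B[of "-2" 1 h "h$1$4"]) (use that in \<open>auto intro!: root_generated_first_row simp: S\<close>)
  have 2: "h \<in> root_generated" if "h \<in> Sp4" "h$1$1 = 1" "h$1$2 = 0" for h
    by (rule B[of "-2" 0 h "- root2 * h$1$3"]) (use that in \<open>auto intro!: 1 simp: S\<close>)
  have 3: "h \<in> root_generated" if "h \<in> Sp4" "h$1$1 = 1" for h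
    by (rule B[of "-1" 0 h "root2 * h$1$2"]) (use that in \<open>auto intro!: 2 simp: S\<close>)
  have 4: "h \<in> root_generated" if "h \<in> Sp4" "h$1$4 \<noteq> 0" for h
    by (rule B[of 1 "-2" h "(h$1$1 - 1) / h$1$4"]) (use that in \<open>auto intro!: 3 simp: S\<close>)
  have 5: "h \<in> root_generated" if "h \<in> Sp4" "h$1$1 \<noteq> 0" for h
  proof (cases "h$1$4 = 0")
    case True
    have "h ** sp_elem (-2) 1 1 \<in> root_generated"
      using that True by (intro 4) (simp_all add: sp_elem_columns Sp4_sp_elem root_pairs_def)
    then show ?thesis by (rule root_generated_back) (simp add: root_pairs_def)
  qed (rule 4[OF that(1)])
  have 6: "h \<in> root_generated" if "h \<in> Sp4" "h$1$3 \<noteq> 0" "h$1$1 = 0" for h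
    by (rule B[of 0 "-2" h 1]) (use that in \<open>auto intro!: 5 simp: S\<close>)
  have 7: "h \<in> root_generated" if "h \<in> Sp4" "h$1$2 \<noteq> 0" "h$1$1 = 0" for h
    by (rule B[of 0 "-1" h 1]) (use that in \<open>auto intro!: 5 simp: S\<close>)
  have "h$1$1 \<noteq> 0 \<or> h$1$2 \<noteq> 0 \<or> h$1$3 \<noteq> 0 \<or> h$1$4 \<noteq> 0"
    using Sp4_row_form[OF h, of 1 4] by (auto simp: symp_mat_vector)
  then show ?thesis using 4 5 6 7 h by blast
qed

subsection \<open>Irreducibility of the symplectic group\<close>

text \<open>In a factorisation of \<open>h\<close> into root elements all parameters are multiplied
  by the same \<open>s\<close>; this joins the identity at 0 to \<open>h\<close> at 1.\<close>

lemma Sp4_polynomial_curve: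
  assumes "h \<in> Sp4"
  obtains c where "c 0 = mat 1" "c 1 = h" "\<And>t. c t \<in> Sp4" "\<And>i j. \<exists>q. \<forall>t. c t $ i $ j = poly q t"
proof -
  have "h \<in> root_generated" by (rule Sp4_root_generated[OF assms])
  then have "\<exists>c. c 0 = mat 1 \<and> c 1 = h \<and> (\<forall>t. c t \<in> Sp4) \<and> (\<forall>i j. \<exists>q. \<forall>t. c t $ i $ j = poly q t)"
  proof induction
    case one
    have "\<exists>q. \<forall>t. (mat 1 :: complex^4^4) $ i $ j = poly q t" for i j
      by (rule exI[of _ "[:mat 1 $ i $ j:]"]) simp
    then show ?case by (intro exI[of _ "\<lambda>_. mat 1"]) (auto simp: Sp4_one)
  next
    case (step g i j t)
    then obtain c where c: "c 0 = mat 1" "c 1 = g" "\<And>t. c t \<in> Sp4"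
        "\<And>i j. \<exists>q. \<forall>t. c t $ i $ j = poly q t"
      by blast
    then obtain q where q: "\<And>a b t. c t $ a $ b = poly (q a b) t" by metis
    let ?X = "sp_of (gen_F i j)"
    have "(c s ** sp_elem i j (s * t)) $ a $ b
        = poly (\<Sum>k\<in>UNIV. q a k * ([:mat 1 $ k $ b:] + [:0, t * ?X $ k $ b:])) s" for s a b
      by (simp add: matrix_mult_entry q sp_elem_def poly_sum algebra_simps)
    then have "\<exists>q. \<forall>s. (c s ** sp_elem i j (s * t)) $ a $ b = poly q s" for a b by blast
    then show ?case
      using c(1,2,3) step(2)
      by (intro exI[of _ "\<lambda>s. c s ** sp_elem i j (s * t)"]) (auto simp: sp_elem_zero Sp4_sp_elem)
  qed
  then show ?thesis using that by blast
qed

lemma polynomial_fun_curve: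
  assumes "polynomial_fun P" and "\<And>i j. \<exists>q. \<forall>t. c t $ i $ j = poly q t"
  shows "\<exists>q. \<forall>t. P (c t) = poly q t"
  using assms(1)
proof induction
  case (1 k)
  show ?case by (rule exI[of _ "[:k:]"]) simp
next
  case (3 f f')
  then show ?case by (metis poly_add)
next
  case (4 f f')
  then show ?case by (metis poly_mult)
qed (rule assms(2))

text \<open>A polynomial curve in the group through a point with \<open>P h\<close> nonzero and a
  point with \<open>Q k\<close> nonzero reduces the claim to polynomials in one variable, which have
  no zero divisors. It is used to cancel \<open>h$1$1\<close>, to fix the determinant of the
  covering and to determine square roots up to sign.\<close>

lemma Sp4_irreducible:
  assumes P: "polynomial_fun P" and Q: "polynomial_fun Q" and "\<And>h. h \<in> Sp4 \<Longrightarrow> P h * Q h = 0"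
  shows "(\<forall>h\<in>Sp4. P h = 0) \<or> (\<forall>h\<in>Sp4. Q h = 0)"
proof (rule ccontr)
  assume "\<not> ?thesis"
  then obtain h k where hk: "h \<in> Sp4" "k \<in> Sp4" "P h \<noteq> 0" "Q k \<noteq> 0" by blast
  obtain h' where h': "h' \<in> Sp4" "h ** h' = mat 1" by (rule Sp4_inverse[OF hk(1)])
  obtain c where c: "c 0 = mat 1" "c 1 = h' ** k" "\<And>t. c t \<in> Sp4" "\<And>i j. \<exists>q. \<forall>t. c t $ i $ j = poly q t"
    using Sp4_polynomial_curve[OF Sp4_mult[OF h'(1) hk(2)]] by blast
  let ?c = "\<lambda>t. h ** c t"
  have pc: "\<exists>q. \<forall>t. ?c t $ i $ j = poly q t" for i j
  proof -
    obtain q where q: "\<And>a b t. c t $ a $ b = poly (q a b) t" using c(4) by metis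
    have "?c t $ i $ j = poly (\<Sum>k\<in>UNIV. [:h $ i $ k:] * q k j) t" for t
      by (simp add: matrix_mult_entry q poly_sum)
    then show ?thesis by blast
  qed
  obtain p where p: "\<And>t. P (?c t) = poly p t" using polynomial_fun_curve[OF P pc] by blast
  obtain q where q: "\<And>t. Q (?c t) = poly q t" using polynomial_fun_curve[OF Q pc] by blast
  have "poly (p * q) t = 0" for t
    using assms(3)[OF Sp4_mult[OF hk(1) c(3)], of t] by (simp flip: p q)
  then have "p * q = 0" by (metis poly_all_0_iff_0)
  then have "p = 0 \<or> q = 0" by simp
  moreover have "poly p 0 \<noteq> 0" using hk(3) by (simp flip: p add: c(1))
  moreover have "poly q 1 \<noteq> 0" using hk(4) h'(2) by (simp flip: q add: c(2) matrix_mul_assoc)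
  ultimately show False by auto
qed

lemma Sp4_cancel:
  assumes "polynomial_fun P" and "\<And>h. h \<in> Sp4 \<Longrightarrow> h$1$1 * P h = 0" and "h \<in> Sp4"
  shows "P h = 0"
proof -
  have "(mat 1 :: complex^4^4) $ 1 $ 1 \<noteq> 0" by (simp add: mat_entry)
  then show ?thesis
    using Sp4_irreducible[OF polynomial_fun.intros(2) assms(1), of 1 1] assms(2,3) Sp4_one by blast
qed

lemma polynomial_fun_cover: "polynomial_fun (\<lambda>h. cover h $ i $ j)"
proof -
  have e: "polynomial_fun (\<lambda>h. (h ** A ** transpose h) $ a $ b)" for A :: "complex^4^4" and a b
    unfolding matrix_mult_entry transpose_def vec_lambda_beta by (intro polynomial_fun_intros)
  have d: "polynomial_fun (\<lambda>h. f h / root2)" if "polynomial_fun f" for f :: "complex^4^4 \<Rightarrow> complex"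
    using polynomial_fun.intros(4)[OF polynomial_fun.intros(1)[of "1 / root2"] that] by simp
  show ?thesis
    unfolding cover_entry using exhaust_5[of i]
    by (elim disjE) (simp_all add: ext_coord_simps, intro polynomial_fun_intros e d,
        intro polynomial_fun_intros e d,
      intro polynomial_fun_intros e d, intro polynomial_fun_intros e d, intro polynomial_fun_intros e d)
qed

lemma scalar_prod_mat_square: "scalar_prod_mat ** scalar_prod_mat = mat 1"
  unfolding vec_eq_iff forall_5 by (simp add: matrix_mult_entry sum_5 scalar_prod_mat_def mat_entry)

lemma det_scalar_prod_mat: "det scalar_prod_mat \<noteq> 0"
  using arg_cong[OF scalar_prod_mat_square, of det] by (auto simp: det_mul)

text \<open>Invariance of the scalar product leaves the determinant 1 or -1; as the group is
  irreducible, one sign holds throughout, and the identity decides which.\<close>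

lemma cover_in_SO5:
  assumes "h \<in> Sp4"
  shows "cover h \<in> SO5"
proof -
  have sq: "det (cover h) * det (cover h) = 1" if "h \<in> Sp4" for h
    using arg_cong[OF cover_preserves_form[OF that], of det] det_scalar_prod_mat by (simp add: det_mul)
  have "polynomial_fun (\<lambda>h. det (cover h))"
    unfolding det_def by (intro polynomial_fun_intros polynomial_fun_cover)
  then have "(\<forall>h\<in>Sp4. det (cover h) - 1 = 0) \<or> (\<forall>h\<in>Sp4. det (cover h) + 1 = 0)"
    by (intro Sp4_irreducible polynomial_fun_intros) (auto simp: algebra_simps sq)
  moreover have "det (cover (mat 1)) + 1 \<noteq> 0" by (simp add: cover_one)
  ultimately have "det (cover h) = 1" using Sp4_one assms by auto
  then show ?thesis using cover_preserves_form[OF assms] by (simp add: SO5_def)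
qed

subsection \<open>Surjectivity of the covering\<close>

lemma conj_basis_entry:
  "(h ** ext_basis (-2) ** transpose h) $ a $ b = h$a$1 * h$b$2 - h$a$2 * h$b$1"
  "(h ** ext_basis (-1) ** transpose h) $ a $ b = h$a$1 * h$b$3 - h$a$3 * h$b$1"
  "(h ** ext_basis 0 ** transpose h) $ a $ b
     = ((h$a$1 * h$b$4 - h$a$4 * h$b$1) - (h$a$2 * h$b$3 - h$a$3 * h$b$2)) / root2"
  "(h ** ext_basis 1 ** transpose h) $ a $ b = h$a$2 * h$b$4 - h$a$4 * h$b$2"
  "(h ** ext_basis 2 ** transpose h) $ a $ b = - (h$a$3 * h$b$4 - h$a$4 * h$b$3)"
  by (simp_all add: ext_basis_vector matrix_mult_entry sum_4 transpose_def
      add_divide_distrib diff_divide_distrib algebra_simps)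

lemma cover_sp_elem_columns:
  fixes g :: "complex^5^5"
  defines "op i j t p q \<equiv> (g ** cover (sp_elem i j t)) $ p $ q"
  shows
  "op (-2) (-1) t p (-2) = g $ p $ (-2)" "op (-2) (-1) t p (-1) = g $ p $ (-1) + t * g $ p $ (-2)"
  "op (-2) (-1) t p 0 = g $ p $ 0" "op (-2) (-1) t p 1 = g $ p $ 1"
      "op (-2) (-1) t p 2 = g $ p $ 2 - t * g $ p $ 1"
  "op (-2) 1 t p (-2) = g $ p $ (-2)" "op (-2) 1 t p (-1) = g $ p $ (-1)"
  "op (-2) 1 t p 0 = g $ p $ 0" "op (-2) 1 t p 1 = g $ p $ 1 + t * g $ p $ (-2)"
      "op (-2) 1 t p 2 = g $ p $ 2 - t * g $ p $ (-1)"
  "op (-2) 0 t p (-2) = g $ p $ (-2)" "op (-2) 0 t p (-1) = g $ p $ (-1)"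
  "op (-2) 0 t p 0 = g $ p $ 0 + t * g $ p $ (-2)" "op (-2) 0 t p 1 = g $ p $ 1"
  "op (-2) 0 t p 2 = g $ p $ 2 - t * g $ p $ 0 - t\<^sup>2 / 2 * g $ p $ (-2)"
  "op 1 (-2) t p (-2) = g $ p $ (-2) + t * g $ p $ 1" "op 1 (-2) t p (-1) = g $ p $ (-1)
      - t * g $ p $ 2"
  "op 1 (-2) t p 0 = g $ p $ 0" "op 1 (-2) t p 1 = g $ p $ 1" "op 1 (-2) t p 2 = g $ p $ 2"
  "op (-1) (-2) t p (-2) = g $ p $ (-2) + t * g $ p $ (-1)" "op (-1) (-2) t p (-1) = g $ p $ (-1)"
  "op (-1) (-2) t p 0 = g $ p $ 0" "op (-1) (-2) t p 1 = g $ p $ 1 - t * g $ p $ 2"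
      "op (-1) (-2) t p 2 = g $ p $ 2"
  "op 0 (-2) t p (-2) = g $ p $ (-2) + t * g $ p $ 0 - t\<^sup>2 / 2 * g $ p $ 2"
      "op 0 (-2) t p (-1) = g $ p $ (-1)"
  "op 0 (-2) t p 0 = g $ p $ 0 - t * g $ p $ 2" "op 0 (-2) t p 1 = g $ p $ 1"
      "op 0 (-2) t p 2 = g $ p $ 2"
  "op (-1) 0 t p (-2) = g $ p $ (-2)" "op (-1) 0 t p (-1) = g $ p $ (-1)"
  "op (-1) 0 t p 0 = g $ p $ 0 + t * g $ p $ (-1)"
  "op (-1) 0 t p 1 = g $ p $ 1 - t * g $ p $ 0 - t\<^sup>2 / 2 * g $ p $ (-1)" "op (-1) 0 t p 2 = g $ p $ 2"
  "op 0 (-1) t p (-2) = g $ p $ (-2)" "op 0 (-1) t p (-1) = g $ p $ (-1)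
      + t * g $ p $ 0 - t\<^sup>2 / 2 * g $ p $ 1"
  "op 0 (-1) t p 0 = g $ p $ 0 - t * g $ p $ 1" "op 0 (-1) t p 1 = g $ p $ 1"
      "op 0 (-1) t p 2 = g $ p $ 2"
  unfolding op_def matrix_mult_entry[of g] sum_5
  by (simp_all add: cover_entry ext_coord_simps conj_basis_entry sp_elem_def sp_of_gen_F spmat_def
      mat_entry
      power2_eq_square field_simps)

definition sp_torus :: "complex \<Rightarrow> complex \<Rightarrow> complex^4^4" where
  "sp_torus z w =
     vector [vector [z, 0, 0, 0], vector [0, w, 0, 0], vector [0, 0, 1 / w, 0], vector [0, 0, 0,
         1 / z]]"

lemma cover_torus_columns:
  fixes g :: "complex^5^5" and z w :: complex
  assumes "z \<noteq> 0" "w \<noteq> 0"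
  defines "d \<equiv> sp_torus z w"
  shows "d \<in> Sp4" "(g ** cover d) $ p $ (-2) = z * w * g $ p $ (-2)"
      "(g ** cover d) $ p $ (-1) = z / w * g $ p $ (-1)"
    "(g ** cover d) $ p $ 0 = g $ p $ 0" "(g ** cover d) $ p $ 1 = w / z * g $ p $ 1"
    "(g ** cover d) $ p $ 2 = 1 / (z * w) * g $ p $ 2"
proof -
  show "d \<in> Sp4"
    using assms(1,2)
    by (simp add: Sp4_def d_def sp_torus_def mat4_eq_iff symp_mat_vector matrix_mult_entry sum_4
        transpose_def)
  show "(g ** cover d) $ p $ (-2) = z * w * g $ p $ (-2)"
      "(g ** cover d) $ p $ (-1) = z / w * g $ p $ (-1)"
    "(g ** cover d) $ p $ 0 = g $ p $ 0" "(g ** cover d) $ p $ 1 = w / z * g $ p $ 1"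
    "(g ** cover d) $ p $ 2 = 1 / (z * w) * g $ p $ 2"
    using assms(1,2) unfolding matrix_mult_entry[of g] sum_5
    by (simp_all add: cover_entry ext_coord_simps conj_basis_entry d_def sp_torus_def field_simps)
qed

lemma scalar_prod_mat_entries:
  "scalar_prod_mat $ i $ j = (if i = - j then 1 else 0)"
  by (simp add: scalar_prod_mat_def)

lemma SO5_row_form:
  assumes "g \<in> SO5"
  shows "g$p$(-2) * g$q$2 + g$p$(-1) * g$q$1 + g$p$0 * g$q$0 + g$p$1 * g$q$(-1) + g$p$2 * g$q$(-2)
    = scalar_prod_mat $ p $ q"
proof -
  have S: "transpose g ** scalar_prod_mat ** g = scalar_prod_mat" using assms by (simp add: SO5_def)
  then have "(scalar_prod_mat ** transpose g ** scalar_prod_mat) ** g = mat 1"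
    by (simp only: matrix_mul_assoc[symmetric]) (simp only: matrix_mul_assoc scalar_prod_mat_square)
  then have "g ** (scalar_prod_mat ** transpose g ** scalar_prod_mat) = mat 1"
    by (simp add: matrix_left_right_inverse)
  then have "g ** (scalar_prod_mat ** transpose g ** scalar_prod_mat)
      ** scalar_prod_mat = scalar_prod_mat"
    by simp
  then have "g ** scalar_prod_mat ** transpose g = scalar_prod_mat"
    by (simp only: matrix_mul_assoc[symmetric] scalar_prod_mat_square matrix_mul_rid)
  then have "(g ** scalar_prod_mat ** transpose g) $ p $ q = scalar_prod_mat $ p $ q" by simp
  then show ?thesis
    by (simp add: matrix_mult_entry sum_5 scalar_prod_mat_entries[of
        "- _"] scalar_prod_mat_entries[of 0] scalar_prod_mat_entries[of 1]
        scalar_prod_mat_entries[of 2] transpose_def algebra_simps)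
qed

lemma SO5_cover_mult: "g \<in> SO5 \<Longrightarrow> k \<in> Sp4 \<Longrightarrow> g ** cover k \<in> SO5"
proof -
  assume g: "g \<in> SO5" and "k \<in> Sp4"
  then have k: "cover k \<in> SO5" by (intro cover_in_SO5)
  have "transpose (g ** cover k) ** scalar_prod_mat ** (g ** cover k)
     = transpose (cover k) ** (transpose g ** scalar_prod_mat ** g) ** cover k"
    by (simp add: matrix_transpose_mul matrix_mul_assoc)
  then show ?thesis using g k by (simp add: SO5_def det_mul)
qed

lemma cover_image_back:
  assumes "g ** cover k \<in> cover ` Sp4" and "k \<in> Sp4"
  shows "g \<in> cover ` Sp4"
proof -
  obtain h where h: "h \<in> Sp4" "g ** cover k = cover h" using assms(1) by blast
  obtain k' where k': "k' \<in> Sp4" "k ** k' = mat 1" by (rule Sp4_inverse[OF assms(2)])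
  have "g = g ** (cover k ** cover k')"
    unfolding cover_mult[OF k'(1), of k, symmetric] k'(2) cover_one by simp
  also have "\<dots> = cover (h ** k')"
    using h(2) by (simp add: matrix_mul_assoc cover_mult k'(1))
  finally show ?thesis using Sp4_mult[OF h(1) k'(1)] by blast
qed

lemma cover_image_backI:
  "k \<in> Sp4 \<Longrightarrow> (g ** cover k \<in> SO5 \<Longrightarrow> g ** cover k \<in> cover ` Sp4) \<Longrightarrow> g \<in> SO5 \<Longrightarrow> g \<in> cover ` Sp4"
  using cover_image_back SO5_cover_mult by blast

lemma cover_image_backI_elem:
  "g \<in> SO5 \<Longrightarrow> (i, j) \<in> root_pairs \<Longrightarrow>
   (g ** cover (sp_elem i j t) \<in> SO5 \<Longrightarrow> g ** cover (sp_elem i j t) \<in> cover ` Sp4) \<Longrightarrow> g \<in> cover ` Sp4"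
  using cover_image_backI sp_elem_Sp4 by blast

text \<open>Column elimination inside SO5 with images of symplectic matrices, again with the last
  stages first. The row -2 is cleared, then the rows 2 and -1; each time the row relations yield the
  entries that no operation clears. Unlike in the symplectic case, diagonal matrices normalise the
  pivots.\<close>

lemma SO5_subset_cover:
  assumes "g \<in> SO5"
  shows "g \<in> cover ` Sp4"
proof -
  note S = scalar_prod_mat_entries
  note C = cover_sp_elem_columns
  note B = cover_image_backI_elem
  define row where "row g p a b c d e \<longleftrightarrow> g$p$(-2) = a \<and> g$p$(-1) = b \<and> g$p$0 = c \<and> g$p$1 = d \<and> g$p$2 = e"
    for g :: "complex^5^5" and p a b c d e
  have 1: "g \<in> cover ` Sp4" if g: "g \<in> SO5" and r: "row g (-2) 1 0 0 0 0" "row g 2 0 0 0 0 1"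
      "row g (-1) 0 1 0 0 0" "g$1$0 = 0" for g
  proof -
    note f = SO5_row_form[OF g]
    have z: "g$0$2 = 0" "g$1$2 = 0" "g$0$1 = 0" "g$1$1 = 1" "g$0$(-2) = 0" "g$1$(-2) = 0"
      using f[of 0 "-2"] f[of 1 "-2"] f[of 0 "-1"] f[of 1
          "-1"] f[of 0 2] f[of 1 2] r by (simp_all add: row_def S)
    have z1: "g$1$(-1) = 0" using f[of 1 1] z r by (simp add: row_def S)
    have z2: "g$0$(-1) = 0" using f[of 0 1] z r z1 by (simp add: row_def S)
    have "\<forall>i j. i \<noteq> j \<longrightarrow> g$i$j = 0"
      unfolding forall_5 using r z z1 z2 by (simp add: row_def)
    \<comment> \<open>Determinant 1 enters here: orthogonality alone leaves \<open>g$0$0\<close>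
      free to be -1.\<close>
    then have "det g = (\<Prod>i\<in>UNIV. g$i$i)" by (intro det_diagonal) blast
    also have "\<dots> = g$0$0"
      unfolding UNIV_5 using r z
      by (simp only: prod.insert prod.empty finite.intros insert_iff empty_iff index5_distinct
          simp_thms row_def mult_1_left mult_1_right)
    finally have "g$0$0 = 1" using g by (simp add: SO5_def)
    then have "g = mat 1"
      unfolding vec_eq_iff forall_5 using r z z1 z2 by (simp add: row_def mat_entry)
    then show ?thesis using Sp4_one cover_one by (metis image_eqI)
  qed
  have 2: "g \<in> cover ` Sp4" if g: "g \<in> SO5" and r: "row g (-2) 1 0 0 0 0" "row g 2 0 0 0 0 1"
      "row g (-1) 0 1 0 0 0" for g
  proof -
    have z: "g$1$1 = 1" using SO5_row_form[OF g, of 1 "-1"] r by (simp add: row_def S)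
    show ?thesis
      by (rule B[OF g, of 0 "-1" "g$1$0"], simp add: root_pairs_def, rule 1)
         (use r z in \<open>simp_all add: row_def C\<close>)
  qed
  have 3: "g \<in> cover ` Sp4" if g: "g \<in> SO5" and r: "row g (-2) 1 0 0 0 0" "row g 2 0 0 0 0 1"
      "g$(-1)$(-1) = 1"
      "g$(-1)$(-2) = 0" "g$(-1)$2 = 0" "g$(-1)$0 = 0" for g
  proof -
    have "g$(-1)$1 = 0" using SO5_row_form[OF g, of "-1" "-1"] r by (simp add: row_def S)
    then show ?thesis by (intro 2) (use g r in \<open>simp_all add: row_def\<close>)
  qed
  have off: "g$(-1)$(-2) = 0" "g$(-1)$2 = 0" if g: "g \<in> SO5" and r: "row g (-2) 1 0 0 0 0"
      "row g 2 0 0 0 0 1" for g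
    using SO5_row_form[OF g, of "-1" "-2"] SO5_row_form[OF g, of "-1" 2] r by (simp_all add: row_def S)
  have 4: "g \<in> cover ` Sp4" if g: "g \<in> SO5" and r: "row g (-2) 1 0 0 0 0" "row g 2 0 0 0 0 1"
      "g$(-1)$(-1) = 1" for g
    by (rule B[OF g, of "-1" 0 "- g$(-1)$0"], simp add: root_pairs_def, rule 3)
       (use r off[OF g r(1,2)] in \<open>simp_all add: row_def C\<close>)
  have 5: "g \<in> cover ` Sp4" if g: "g \<in> SO5" and r: "row g (-2) 1 0 0 0 0" "row g 2 0 0 0 0 1"
      "g$(-1)$(-1) \<noteq> 0" for g
  proof -
    \<comment> \<open>The matrix \<open>sp_torus z (1 / z)\<close> fixes the columns -2, 0, 2 and
      multiplies column -1 by z^2. A square root of the inverse pivot is therefore required, and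
      over the complex numbers it exists.\<close>
    define z where "z = csqrt (1 / g$(-1)$(-1))"
    have z: "z * z = 1 / g$(-1)$(-1)" "z \<noteq> 0" "1 / z \<noteq> 0"
      using r(3) by (auto simp: z_def simp flip: power2_eq_square)
    note T = cover_torus_columns[OF z(2,3)]
    show ?thesis
      by (rule cover_image_backI[OF T(1) _ g], rule 4) (use r z in \<open>simp_all add: row_def T(2-)\<close>)
  qed
  have 6: "g \<in> cover ` Sp4" if g: "g \<in> SO5" and r: "row g (-2) 1 0 0 0 0" "row g 2 0 0 0 0 1" for g
  proof (cases "g$(-1)$(-1) = 0")
    case True
    have z: "g$(-1)$0 = 0" using SO5_row_form[OF g, of "-1" "-1"] True off[OF g r] by (simp add: S)
    have z1: "g$(-1)$1 \<noteq> 0" using SO5_row_form[OF g, of "-1" 1] True off[OF g r] z by (auto simp: S)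
    \<comment> \<open>The quadratic term of the short root element adds a multiple of column 1 to
      column -1 and thus produces a nonzero pivot.\<close>
    show ?thesis
      by (rule B[OF g, of 0 "-1" 1], simp add: root_pairs_def, rule 5)
         (use r z z1 True in \<open>simp_all add: row_def C\<close>)
  qed (rule 5[OF g r])
  have w: "g$2$2 = 1" if g: "g \<in> SO5" and r: "row g (-2) 1 0 0 0 0" for g
    using SO5_row_form[OF g, of 2 "-2"] r by (simp add: row_def S)
  have 7: "g \<in> cover ` Sp4" if g: "g \<in> SO5" and r: "row g (-2) 1 0 0 0 0" "g$2$(-1) = 0"
      "g$2$1 = 0" "g$2$0 = 0" for g
  proof -
    have "g$2$(-2) = 0" using SO5_row_form[OF g, of 2 2] r w[OF g r(1)] by (simp add: row_def S)
    then show ?thesis by (intro 6) (use g r w[OF g r(1)] in \<open>simp_all add: row_def\<close>)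
  qed
  have 8: "g \<in> cover ` Sp4" if g: "g \<in> SO5" and r: "row g (-2) 1 0 0 0 0" "g$2$(-1) = 0"
      "g$2$1 = 0" for g
    by (rule B[OF g, of 0 "-2" "g$2$0"], simp add: root_pairs_def, rule 7)
       (use r w[OF g r(1)] in \<open>simp_all add: row_def C\<close>)
  have 9: "g \<in> cover ` Sp4" if g: "g \<in> SO5" and r: "row g (-2) 1 0 0 0 0" "g$2$(-1) = 0" for g
    by (rule B[OF g, of "-1" "-2" "g$2$1"], simp add: root_pairs_def, rule 8)
       (use r w[OF g r(1)] in \<open>simp_all add: row_def C\<close>)
  have 10: "g \<in> cover ` Sp4" if g: "g \<in> SO5" and r: "row g (-2) 1 0 0 0 0" for g
    by (rule B[OF g, of 1 "-2" "g$2$(-1)"], simp add: root_pairs_def, rule 9)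
       (use r w[OF g r(1)] in \<open>simp_all add: row_def C\<close>)
  have 11: "g \<in> cover ` Sp4" if g: "g \<in> SO5" and r: "g$(-2)$(-2) = 1" "g$(-2)$(-1) = 0"
      "g$(-2)$1 = 0" "g$(-2)$0 = 0" for g
  proof -
    have "g$(-2)$2 = 0" using SO5_row_form[OF g, of "-2" "-2"] r by (simp add: S)
    then show ?thesis by (intro 10) (use g r in \<open>simp_all add: row_def\<close>)
  qed
  have 12: "g \<in> cover ` Sp4" if g: "g \<in> SO5" and r: "g$(-2)$(-2) = 1" "g$(-2)$(-1) = 0"
      "g$(-2)$1 = 0" for g
    by (rule B[OF g, of "-2" 0 "- g$(-2)$0"], simp add: root_pairs_def, rule 11) (use r in
        \<open>simp_all add: C\<close>)
  have 13: "g \<in> cover ` Sp4" if g: "g \<in> SO5" and r: "g$(-2)$(-2) = 1" "g$(-2)$(-1) = 0" for g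
    by (rule B[OF g, of "-2" 1 "- g$(-2)$1"], simp add: root_pairs_def, rule 12) (use r in
        \<open>simp_all add: C\<close>)
  have 14: "g \<in> cover ` Sp4" if g: "g \<in> SO5" and r: "g$(-2)$(-2) = 1" for g
    by (rule B[OF g, of "-2" "-1" "- g$(-2)$(-1)"], simp add: root_pairs_def, rule 13) (use r in
        \<open>simp_all add: C\<close>)
  have 15: "g \<in> cover ` Sp4" if g: "g \<in> SO5" and r: "g$(-2)$(-2) \<noteq> 0" for g
  proof -
    define z where "z = csqrt (1 / g$(-2)$(-2))"
    have z: "z * z = 1 / g$(-2)$(-2)" "z \<noteq> 0"
      using r by (auto simp: z_def simp flip: power2_eq_square)
    note T = cover_torus_columns[OF z(2,2)]
    show ?thesis
      by (rule cover_image_backI[OF T(1) _ g], rule 14) (use r z in \<open>simp_all add: T(2-)\<close>)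
  qed
  have 16: "g \<in> cover ` Sp4" if g: "g \<in> SO5" and r: "g$(-2)$(-2) = 0" "g$(-2)$1 \<noteq> 0" for g
    by (rule B[OF g, of 1 "-2" 1], simp add: root_pairs_def, rule 15) (use r in \<open>simp_all add: C\<close>)
  have 17: "g \<in> cover ` Sp4" if g: "g \<in> SO5" and r: "g$(-2)$(-2) = 0" "g$(-2)$(-1) \<noteq> 0" for g
    by (rule B[OF g, of "-1" "-2" 1], simp add: root_pairs_def, rule 15) (use r in \<open>simp_all add: C\<close>)
  have 18: "g \<in> cover ` Sp4" if g: "g \<in> SO5" and r: "g$(-2)$(-2) = 0" "g$(-2)$0 = 0"
      "g$(-2)$2 \<noteq> 0" for g
    by (rule B[OF g, of 0 "-2" 1], simp add: root_pairs_def, rule 15) (use r in \<open>simp_all add: C\<close>)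
  show ?thesis
  proof (cases "g$(-2)$(-2) = 0 \<and> g$(-2)$1 = 0 \<and> g$(-2)$(-1) = 0")
    case True
    then have "g$(-2)$0 = 0" using SO5_row_form[OF assms, of "-2" "-2"] by (simp add: S)
    moreover have "g$(-2)$2 \<noteq> 0" using SO5_row_form[OF assms, of
        "-2" 2] True calculation by (auto simp: S)
    ultimately show ?thesis using 18[OF assms] True by blast
  qed (use 15 16 17 assms in blast)
qed

lemma cover_image: "cover ` Sp4 = SO5"
  using SO5_subset_cover cover_in_SO5 by blast

subsection \<open>Regular functions on the symplectic group\<close>

abbreviation (input) res :: "(complex^4^4 \<Rightarrow> complex) \<Rightarrow> complex^4^4 \<Rightarrow> complex" where
  "res \<equiv> on_group Sp4"

abbreviation (input) regular :: "(complex^4^4 \<Rightarrow> complex) \<Rightarrow> bool" where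
  "regular \<equiv> regular_on Sp4"

lemmas res_regular = on_group_regular[where G = Sp4]

lemmas res_simps = on_group_simps[where G = Sp4]

lemma act_Sp4_res: "act_Sp4 i j (res P) = res (poly_shift (sp_of (gen_F i j)) P)"
  unfolding act_Sp4_def inv_dcover_gen_F
  by (rule lie_shift_on_group) (intro Sp4_mult mat_exp_Sp4 sp_of_gen_F_in_sp4)

lemma shift_action_Sp4: "shift_action Sp4 act_Sp4"
  unfolding shift_action_def by (intro exI[of _ "\<lambda>i j. sp_of (gen_F i j)"]) (simp add: act_Sp4_res)

lemmas act_Sp4_zero = act_zero[OF shift_action_Sp4]
  and act_Sp4_add = act_add[OF shift_action_Sp4]
  and act_Sp4_mult = act_mult[OF shift_action_Sp4]
  and act_Sp4_scale = act_scale[OF shift_action_Sp4]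

lemma poly_shift_diff:
  "polynomial_fun f \<Longrightarrow> polynomial_fun f' \<Longrightarrow>
    poly_shift X (\<lambda>g. f g - f' g) = (\<lambda>g. poly_shift X f g - poly_shift X f' g)"
  by (rule ext, rule poly_shift_eqI) (auto intro!: derivative_intros poly_shift_deriv)

lemma res_one_mult: "res (\<lambda>h. 1) * res f = res f" "res f * res (\<lambda>h. 1) = res f"
  by (simp_all add: res_simps)

lemma sum_fun_apply: "(\<Sum>a\<in>A. F a) x = (\<Sum>a\<in>A. F a x)"
  by (induction A rule: infinite_finite_induct) simp_all

definition set_mult :: "('a \<Rightarrow> complex) set \<Rightarrow> ('a \<Rightarrow> complex) set \<Rightarrow> ('a \<Rightarrow> complex) set" where
  "set_mult S T = {f * g | f g. f \<in> S \<and> g \<in> T}"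

lemma span_mult:
  assumes "f \<in> fun_vs.span S" and "g \<in> fun_vs.span T"
  shows "f * g \<in> fun_vs.span (set_mult S T)"
proof -
  have sub: "fun_vs.subspace {f. f * g \<in> fun_vs.span (set_mult S T)}" for g
    by (rule fun_vs.subspaceI)
       (simp_all add: ring_distribs fscale_mult fun_vs.span_add fun_vs.span_scale fun_vs.span_zero)
  have "T \<subseteq> {g. g * a \<in> fun_vs.span (set_mult S T)}" if "a \<in> S" for a
  proof
    fix b assume "b \<in> T"
    then have "a * b \<in> set_mult S T" using that by (auto simp: set_mult_def)
    then show "b \<in> {g. g * a \<in> fun_vs.span (set_mult S T)}" by (simp add: mult.commute fun_vs.span_base)
  qed
  then have "g * a \<in> fun_vs.span (set_mult S T)" if "a \<in> S" for a
    using fun_vs.span_minimal[OF _ sub] assms(2) that by blast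
  then have "S \<subseteq> {f. f * g \<in> fun_vs.span (set_mult S T)}"
    by (auto simp only: mem_Collect_eq subset_iff mult.commute)
  then show ?thesis
    using fun_vs.span_minimal[OF _ sub] assms(1) by blast
qed

definition stable :: "(complex^4^4 \<Rightarrow> complex) set \<Rightarrow> bool" where
  "stable S \<longleftrightarrow> S \<subseteq> {f. regular f} \<and> (\<forall>i j. \<forall>f\<in>S. act_Sp4 i j f \<in> fun_vs.span S)"

lemma stable_span:
  assumes "stable S" and "f \<in> fun_vs.span S"
  shows "act_Sp4 i j f \<in> fun_vs.span S"
proof -
  have r: "regular f" if "f \<in> fun_vs.span S" for f
    using regular_span[OF _ that] assms(1) by (simp add: stable_def)
  have "fun_vs.subspace {f. f \<in> fun_vs.span S \<and> act_Sp4 i j f \<in> fun_vs.span S}"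
    by (rule fun_vs.subspaceI)
       (simp_all add: r act_Sp4_zero act_Sp4_add act_Sp4_scale fun_vs.span_add fun_vs.span_scale
           fun_vs.span_zero)
  moreover have "S \<subseteq> {f. f \<in> fun_vs.span S \<and> act_Sp4 i j f \<in> fun_vs.span S}"
    using assms(1) by (auto simp: stable_def fun_vs.span_base)
  ultimately show ?thesis
    using fun_vs.span_minimal assms(2) by blast
qed

lemma stable_mult:
  assumes "stable S" and "stable T"
  shows "stable (set_mult S T)"
  unfolding stable_def
proof (intro conjI allI ballI)
  show "set_mult S T \<subseteq> {f. regular f}"
    using assms by (auto simp: set_mult_def stable_def intro!: regular_mult)
  fix i j f
  assume "f \<in> set_mult S T"
  then obtain a b where ab: "f = a * b" "a \<in> S" "b \<in> T" by (auto simp: set_mult_def)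
  have r: "regular a" "regular b" using ab assms by (auto simp: stable_def)
  have "act_Sp4 i j a * b \<in> fun_vs.span (set_mult S T)" "a * act_Sp4 i j b \<in> fun_vs.span (set_mult S T)"
    by (rule span_mult; use ab assms in \<open>simp add: stable_def fun_vs.span_base\<close>)+
  then show "act_Sp4 i j f \<in> fun_vs.span (set_mult S T)"
    by (simp add: ab act_Sp4_mult r fun_vs.span_add)
qed

subsection \<open>The space of products of coordinates\<close>

definition xf :: "4 \<Rightarrow> complex^4^4 \<Rightarrow> complex" where
  "xf i = res (\<lambda>h. h$1$i)"

definition pf :: "4 \<Rightarrow> 4 \<Rightarrow> complex^4^4 \<Rightarrow> complex" where
  "pf i j = res (\<lambda>h. h$1$i * h$2$j - h$1$j * h$2$i)"

lemma regular_xf: "regular (xf i)"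
  unfolding xf_def by (intro regularI polynomial_fun_intros)

lemma regular_pf: "regular (pf i j)"
  unfolding pf_def by (intro regularI polynomial_fun_intros)

lemma act_xf:
  fixes a b defines "X \<equiv> sp_of (gen_F a b)"
  shows "act_Sp4 a b (xf i) = fscale (X$1$i) (xf 1) + fscale (X$2$i) (xf 2) + fscale (X$3$i)
      (xf 3) + fscale (X$4$i) (xf 4)"
  unfolding xf_def act_Sp4_res res_simps poly_shift_entry sum_4 X_def by (simp add: mult.commute)

lemma act_pf:
  fixes a b defines "X \<equiv> sp_of (gen_F a b)"
  shows "act_Sp4 a b (pf i j)
    = fscale (X$1$i) (pf 1 j) + fscale (X$2$i) (pf 2 j) + fscale (X$3$i) (pf 3 j) + fscale (X$4$i)
        (pf 4 j)
    + (fscale (X$1$j) (pf i 1) + fscale (X$2$j) (pf i 2) + fscale (X$3$j) (pf i 3) + fscale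
        (X$4$j) (pf i 4))"
proof -
  have "poly_shift X (\<lambda>h. h$1$i * h$2$j - h$1$j * h$2$i)
     = (\<lambda>h. (\<Sum>k\<in>UNIV. h$1$k * X$k$i) * h$2$j + h$1$i * (\<Sum>k\<in>UNIV. h$2$k * X$k$j)
         - ((\<Sum>k\<in>UNIV. h$1$k * X$k$j) * h$2$i + h$1$j * (\<Sum>k\<in>UNIV. h$2$k * X$k$i)))"
    by (simp add: poly_shift_diff poly_shift_mult poly_shift_entry polynomial_fun.intros(2,4))
  then show ?thesis
    unfolding pf_def act_Sp4_res res_simps X_def[symmetric] sum_4 on_group_eq_iff
    by (simp add: algebra_simps)
qed

text \<open>Lists rather than sets, because equal products must be counted with multiplicity: only
  then is the kernel of a list of products the product of the kernels, as \<open>kern_prodl\<close>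
  states.\<close>

definition prodl :: "('a \<Rightarrow> complex) list \<Rightarrow> ('a \<Rightarrow> complex) list \<Rightarrow> ('a \<Rightarrow> complex) list" where
  "prodl as bs = concat (map (\<lambda>a. map ((*) a) bs) as)"

primrec powl :: "(complex^4^4 \<Rightarrow> complex) list \<Rightarrow> nat \<Rightarrow> (complex^4^4 \<Rightarrow> complex) list" where
  "powl as 0 = [res (\<lambda>h. 1)]"
| "powl as (Suc n) = prodl as (powl as n)"

lemma set_prodl: "set (prodl as bs) = set_mult (set as) (set bs)"
  by (auto simp: prodl_def set_mult_def)

definition x_list :: "(complex^4^4 \<Rightarrow> complex) list" where
  "x_list = [xf 1, xf 2, xf 3, xf 4]"

definition p_list :: "(complex^4^4 \<Rightarrow> complex) list" where
  "p_list = [pf 1 2, pf 1 3, pf 1 4, pf 2 3, pf 2 4, pf 3 4]"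

definition prod_list_NM :: "nat \<Rightarrow> nat \<Rightarrow> (complex^4^4 \<Rightarrow> complex) list" where
  "prod_list_NM N M = prodl (powl x_list N) (powl p_list M)"

definition W :: "nat \<Rightarrow> nat \<Rightarrow> (complex^4^4 \<Rightarrow> complex) set" where
  "W N M = fun_vs.span (set (prod_list_NM N M))"

lemma xf_span: "xf i \<in> fun_vs.span (set x_list)"
  using exhaust_4[of i] by (auto simp: x_list_def intro!: fun_vs.span_base)

lemma pf_span: "pf i j \<in> fun_vs.span (set p_list)"
proof -
  have neg: "pf i j = fscale (- 1) (pf j i)" for i j
    by (auto simp: pf_def res_simps on_group_eq_iff)
  have zero: "pf i i = 0" for i
    by (simp add: pf_def res_simps)
  have "\<forall>i j. pf i j \<in> fun_vs.span (set p_list)"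
    unfolding forall_4 zero neg[of 2 1] neg[of 3 1] neg[of 4 1] neg[of 3 2] neg[of 4 2] neg[of 4 3]
    by (intro conjI fun_vs.span_zero fun_vs.span_scale fun_vs.span_base) (simp_all add: p_list_def)
  then show ?thesis by blast
qed

lemma stable_x_list: "stable (set x_list)"
proof -
  have "set x_list \<subseteq> range xf" by (auto simp: x_list_def)
  then show ?thesis
    by (auto simp: stable_def regular_xf act_xf intro!: fun_vs.span_add fun_vs.span_scale xf_span)
qed

lemma stable_p_list: "stable (set p_list)"
proof -
  have "set p_list \<subseteq> {pf i j | i j. True}" by (auto simp: p_list_def)
  then show ?thesis
    by (auto simp: stable_def regular_pf act_pf intro!: fun_vs.span_add fun_vs.span_scale pf_span)
qed

lemma stable_powl: "stable (set as) \<Longrightarrow> stable (set (powl as n))"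
proof (induction n)
  case 0
  have "act_Sp4 i j (res (\<lambda>h. 1)) = 0" for i j
    unfolding act_Sp4_res poly_shift_const by (rule res_simps(4))
  then show ?case
    by (auto simp: stable_def fun_vs.span_zero intro!: regularI polynomial_fun.intros)
qed (simp add: set_prodl stable_mult)

lemma stable_W: "stable (set (prod_list_NM N M))"
  unfolding prod_list_NM_def set_prodl by (intro stable_mult stable_powl stable_x_list stable_p_list)

lemma W_act: "f \<in> W N M \<Longrightarrow> act_Sp4 i j f \<in> W N M"
  unfolding W_def by (rule stable_span[OF stable_W])

lemma W_subspace: "fun_vs.subspace (W N M)"
  unfolding W_def by (rule fun_vs.subspace_span)

lemma W_regular: "f \<in> W N M \<Longrightarrow> regular f"
  unfolding W_def using stable_W regular_span by (metis stable_def)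

lemma span_set_mult_mono:
  assumes "f \<in> fun_vs.span S" and "\<And>s. s \<in> S \<Longrightarrow> s \<in> fun_vs.span T"
  shows "f \<in> fun_vs.span T"
  using assms by (meson fun_vs.span_minimal fun_vs.subspace_span subsetD subsetI)

lemma powl_mult:
  assumes "f \<in> set (powl as m)" and "g \<in> set (powl as n)" and "\<And>f. f \<in> set as \<Longrightarrow> res f = f"
  shows "f * g \<in> set (powl as (m + n))"
  using assms(1)
proof (induction m arbitrary: f)
  case 0
  have r: "res g = g" using assms(2)
  proof (induction n arbitrary: g)
    case (Suc n)
    then obtain a b where "g = a * b" "a \<in> set as" "b \<in> set (powl as n)"
      by (auto simp: set_prodl set_mult_def)
    with Suc.IH[of b] assms(3)[of a] show ?case by (metis res_simps(2,5))
  qed (simp add: res_simps)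
  have "f * g = g" using 0 res_one_mult(1)[of g] r by simp
  then show "f * g \<in> set (powl as (0 + n))" using assms(2) by simp
next
  case (Suc m)
  then obtain a b where ab: "f = a * b" "a \<in> set as" "b \<in> set (powl as m)"
    by (auto simp: set_prodl set_mult_def)
  have "b * g \<in> set (powl as (m + n))" using Suc.IH[OF ab(3)] .
  moreover have "f * g = a * (b * g)" by (simp only: ab mult.assoc)
  ultimately show "f * g \<in> set (powl as (Suc m + n))" using ab(2)
    unfolding add_Suc powl.simps set_prodl set_mult_def by blast
qed

lemma W_mult:
  assumes "f \<in> W N M" and "g \<in> W N' M'"
  shows "f * g \<in> W (N + N') (M + M')"
  unfolding W_def
proof (rule span_set_mult_mono[OF span_mult[OF assms[unfolded W_def]]])
  fix s
  assume "s \<in> set_mult (set (prod_list_NM N M)) (set (prod_list_NM N' M'))"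
  then obtain a b a' b' where s: "s = a * b * (a' * b')" "a \<in> set (powl x_list N)"
      "b \<in> set (powl p_list M)"
    "a' \<in> set (powl x_list N')" "b' \<in> set (powl p_list M')"
    by (auto simp: set_mult_def prod_list_NM_def set_prodl)
  have r: "f \<in> set x_list \<Longrightarrow> res f = f" "f \<in> set p_list \<Longrightarrow> res f = f" for f
    using stable_x_list stable_p_list res_regular by (auto simp: stable_def)
  have "a * a' \<in> set (powl x_list (N + N'))" "b * b' \<in> set (powl p_list (M + M'))"
    using s r by (auto intro!: powl_mult)
  moreover have "s = a * a' * (b * b')" by (simp add: s mult_ac)
  ultimately show "s \<in> fun_vs.span (set (prod_list_NM (N + N') (M + M')))"
    by (auto simp: prod_list_NM_def set_prodl set_mult_def intro!: fun_vs.span_base)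
qed

lemma W_one: "res (\<lambda>h. 1) \<in> W 0 0"
proof -
  have "res (\<lambda>h. 1) * res (\<lambda>h. 1) \<in> set (prod_list_NM 0 0)"
    by (simp add: prod_list_NM_def set_prodl set_mult_def)
  then show ?thesis unfolding W_def res_simps by (simp add: fun_vs.span_base)
qed

lemma W_xf: "xf i \<in> W 1 0"
proof -
  have 1: "f * res (\<lambda>h. 1) = f" if "regular f" for f
    using that by (auto elim!: regularE simp: res_simps)
  have "xf i * res (\<lambda>h. 1) * res (\<lambda>h. 1) \<in> fun_vs.span (set_mult (set_mult (set x_list) {res
      (\<lambda>h. 1)}) {res (\<lambda>h. 1)})"
    by (intro span_mult xf_span fun_vs.span_base) auto
  then show ?thesis by (simp add: W_def prod_list_NM_def set_prodl 1 regular_xf)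
qed

lemma W_pf: "pf i j \<in> W 0 1"
proof -
  have 1: "f * res (\<lambda>h. 1) = f" "res (\<lambda>h. 1) * f = f" if "regular f" for f
    using that by (auto elim!: regularE simp: res_simps)
  have "res (\<lambda>h. 1) * (pf i j * res (\<lambda>h. 1)) \<in> fun_vs.span (set_mult {res (\<lambda>h. 1)} (set_mult
      (set p_list) {res (\<lambda>h. 1)}))"
    by (intro span_mult pf_span fun_vs.span_base) auto
  then show ?thesis by (simp add: W_def prod_list_NM_def set_prodl 1 regular_pf)
qed

lemma W_power: "res f \<in> W N M \<Longrightarrow> res (\<lambda>h. f h ^ n) \<in> W (n * N) (n * M)"
proof (induction n)
  case 0
  then show ?case using W_one by simp
next
  case (Suc n)
  then have "res f * res (\<lambda>h. f h ^ n) \<in> W (N + n * N) (M + n * M)"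
    by (intro W_mult) auto
  then show ?case by (simp add: res_simps)
qed

subsection \<open>The generated representation\<close>

definition act_closed :: "(complex^4^4 \<Rightarrow> complex) set \<Rightarrow> bool" where
  "act_closed U \<longleftrightarrow> fun_vs.subspace U \<and> (\<forall>i j. \<forall>u\<in>U. act_Sp4 i j u \<in> U) \<and> (\<forall>u\<in>U. regular u)"

text \<open>The degree bound has to be uniform in \<open>h\<close>, so that the coefficients of the
  powers of \<open>t\<close> form one finite family of functions on the group.\<close>

lemma polynomial_fun_sp_elem_poly:
  assumes "polynomial_fun P"
  shows "\<exists>N p. \<forall>h. degree (p h) \<le> N \<and> (\<forall>t. P (h ** sp_elem i j t) = poly (p h) t)"
  using assms
proof induction
  case (1 c)
  show ?case by (intro exI[of _ 0] exI[of _ "\<lambda>h. [:c:]"]) simp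
next
  case (2 a b)
  show ?case
    by (intro exI[of _ 1] exI[of _ "\<lambda>h. [:h $ a $ b, (h ** sp_of (gen_F i j)) $ a $ b:]"])
       (simp add: sp_elem_def matrix_mult_distrib mscale_mult_right)
next
  case (3 f f')
  then obtain N p N' p' where
    "\<And>h. degree (p h) \<le> N \<and> (\<forall>t. f (h ** sp_elem i j t) = poly (p h) t)"
    "\<And>h. degree (p' h) \<le> N' \<and> (\<forall>t. f' (h ** sp_elem i j t) = poly (p' h) t)" by blast
  then show ?case
    by (intro exI[of _ "max N N'"] exI[of _ "\<lambda>h. p h + p' h"])
        (auto intro!: degree_add_le simp: max.coboundedI1 max.coboundedI2)
next
  case (4 f f')
  then obtain N p N' p' where
    p: "\<And>h. degree (p h) \<le> N \<and> (\<forall>t. f (h ** sp_elem i j t) = poly (p h) t)" and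
    p': "\<And>h. degree (p' h) \<le> N' \<and> (\<forall>t. f' (h ** sp_elem i j t) = poly (p' h) t)" by blast
  have "degree (p h * p' h) \<le> N + N'" for h
    using degree_mult_le[of "p h" "p' h"] p[of h] p'[of h] by linarith
  with p p' show ?case
    by (intro exI[of _ "N + N'"] exI[of _ "\<lambda>h. p h * p' h"]) auto
qed

lemma polynomial_fun_sp_elem_expand:
  assumes "polynomial_fun P"
  obtains N q where "\<And>n h. n \<ge> N \<Longrightarrow> q n h = 0"
    "\<And>h t. P (h ** sp_elem i j t) = (\<Sum>n<N. q n h * t ^ n)"
proof -
  obtain N p where p: "\<And>h. degree (p h) \<le> N" "\<And>h t. P (h ** sp_elem i j t) = poly (p h) t"
    using polynomial_fun_sp_elem_poly[OF assms] by blast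
  have "poly (p h) t = (\<Sum>n<Suc N. coeff (p h) n * t ^ n)" for h t
    unfolding poly_altdef using p(1)[of h]
    by (intro sum.mono_neutral_left) (auto simp: coeff_eq_0)
  moreover have "coeff (p h) n = 0" if "n \<ge> Suc N" for n h
    using p(1)[of h] that by (intro coeff_eq_0) simp
  ultimately show ?thesis
    using that[of "Suc N" "\<lambda>n h. coeff (p h) n"] p(2) by auto
qed

text \<open>The coefficient of t^k is the k-fold action on \<open>f\<close> divided by k!. Acting
  once differentiates the expansion in \<open>t\<close>, which replaces \<open>q n\<close> by
  \<open>Suc n\<close> times \<open>q (Suc n)\<close>; the induction then applies to
  \<open>act_Sp4 i j f\<close>.\<close>

lemma act_closed_coefficient:
  assumes U: "act_closed U" and ij: "(i, j) \<in> root_pairs"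
    and "f \<in> U" and "\<And>n h. n \<ge> N \<Longrightarrow> q n h = 0"
    and "\<And>h t. h \<in> Sp4 \<Longrightarrow> f (h ** sp_elem i j t) = (\<Sum>n<N. q n h * t ^ n)"
  shows "res (q k) \<in> U"
  using assms(3-)
proof (induction k arbitrary: f q N)
  case 0
  have "q 0 h = f h" if "h \<in> Sp4" for h
    using 0(3)[OF that, of 0] 0(2)[of 0 h] by (cases N) (auto simp: sp_elem_zero
        lessThan_Suc_eq_insert_0 sum.reindex)
  then have "res (q 0) = res f" by (simp add: on_group_eq_iff)
  then show ?case using U 0 res_regular by (simp add: act_closed_def)
next
  case (Suc k)
  let ?X = "sp_of (gen_F i j)"
  obtain P where P: "polynomial_fun P" "f = res P"
    using U Suc(2) regularE[of Sp4 f] by (metis act_closed_def)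
  define q' where "q' = (\<lambda>n h. of_nat (Suc n) * q (Suc n) h)"
  have 1: "act_Sp4 i j f (h ** sp_elem i j t) = (\<Sum>n<N. q' n h * t ^ n)" if h: "h \<in> Sp4" for h t
  proof -
    have hs: "h ** sp_elem i j t \<in> Sp4" by (rule Sp4_sp_elem[OF h ij])
    have "P (h ** sp_elem i j t ** mat_exp (mscale s ?X)) = (\<Sum>n<N. q n h * (t + s) ^ n)" for s
    proof -
      have "h ** sp_elem i j t ** mat_exp (mscale s ?X) = h ** sp_elem i j (t + s)"
        by (simp add: mat_exp_sp_of_root[OF ij] matrix_mul_assoc[symmetric] sp_elem_add[OF ij])
      moreover have "P (h ** sp_elem i j (t + s)) = f (h ** sp_elem i j (t + s))"
        using Sp4_sp_elem[OF h ij] by (simp add: P on_group_def)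
      ultimately show ?thesis using Suc(4)[OF h] by simp
    qed
    then have "act_Sp4 i j f (h ** sp_elem i j t) = deriv (\<lambda>s. \<Sum>n<N. q n h * (t + s) ^ n) 0"
      unfolding P(2) act_Sp4_res using hs by (simp add: poly_shift_def on_group_def)
    also have "\<dots> = (\<Sum>n<N. q n h * (of_nat n * t ^ (n - 1)))"
      by (rule DERIV_imp_deriv) (auto intro!: derivative_eq_intros simp: mult_ac)
    also have "\<dots> = (\<Sum>n<Suc N. q n h * (of_nat n * t ^ (n - 1)))"
      using Suc(3)[of N h] by simp
    also have "\<dots> = (\<Sum>n<N. q' n h * t ^ n)"
      by (subst sum.lessThan_Suc_shift) (simp add: q'_def mult_ac)
    finally show ?thesis .
  qed
  have "res (q' k) \<in> U"
    by (rule Suc.IH[of "act_Sp4 i j f" N q'])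
       (use U Suc(2,3) 1 in \<open>auto simp: act_closed_def q'_def\<close>)
  then have "fscale (1 / of_nat (Suc k)) (res (q' k)) \<in> U"
    using U by (auto simp: act_closed_def intro: fun_vs.subspace_scale)
  then show ?case by (simp add: res_simps q'_def del: of_nat_Suc)
qed

lemma act_closed_translate_elem:
  assumes U: "act_closed U" and ij: "(i, j) \<in> root_pairs" and f: "f \<in> U"
  shows "res (\<lambda>h. f (h ** sp_elem i j t)) \<in> U"
proof -
  obtain P where P: "polynomial_fun P" "f = res P"
    using U f regularE[of Sp4 f] by (metis act_closed_def)
  obtain N q where q: "\<And>n h. n \<ge> N \<Longrightarrow> q n h = 0" "\<And>h t. P (h ** sp_elem i j t) = (\<Sum>n<N. q n h * t ^ n)"
    using polynomial_fun_sp_elem_expand[OF P(1), of i j] by blast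
  have e: "f (h ** sp_elem i j t) = (\<Sum>n<N. q n h * t ^ n)" if "h \<in> Sp4" for h t
    using Sp4_sp_elem[OF that ij] by (simp add: P q on_group_def)
  have "(\<Sum>n<N. fscale (t ^ n) (res (q n))) \<in> U"
    using U act_closed_coefficient[OF U ij f q(1) e]
    by (auto simp: act_closed_def intro!: fun_vs.subspace_sum fun_vs.subspace_scale)
  moreover have "(\<Sum>n<N. fscale (t ^ n) (res (q n))) = res (\<lambda>h. f (h ** sp_elem i j t))"
    by (auto simp: fun_eq_iff sum_fun_apply on_group_def fscale_def e mult.commute)
  ultimately show ?thesis by simp
qed

text \<open>A translate by one root element is a finite combination of the coefficient functions,
  and root elements generate the group. No limits are involved in passing from the Lie algebra to
  the group.\<close>

lemma act_closed_translate:
  assumes U: "act_closed U" and "k \<in> Sp4" and "f \<in> U"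
  shows "res (\<lambda>h. f (h ** k)) \<in> U"
  using Sp4_root_generated[OF assms(2)] assms(3)
proof (induction arbitrary: f)
  case one
  then show ?case using U res_regular by (auto simp: act_closed_def)
next
  case (step g i j t)
  have g: "g \<in> Sp4" using step(1)
    by (induction) (auto intro: Sp4_one Sp4_sp_elem)
  let ?f = "res (\<lambda>h. f (h ** sp_elem i j t))"
  have "res (\<lambda>h. ?f (h ** g)) \<in> U"
    by (rule step.IH) (rule act_closed_translate_elem[OF U step(2) step(4)])
  moreover have "res (\<lambda>h. ?f (h ** g)) = res (\<lambda>h. f (h ** (g ** sp_elem i j t)))"
    unfolding on_group_eq_iff using g by (auto simp: on_group_def Sp4_mult matrix_mul_assoc)
  ultimately show ?case by simp
qed

section \<open>Functionals and the positivity of the kernel\<close>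

lemma separating_functional:
  assumes "fun_vs.subspace S" and "x \<notin> S"
  obtains \<psi> :: "('a \<Rightarrow> complex) \<Rightarrow> complex" where
    "\<And>f g. \<psi> (f + g) = \<psi> f + \<psi> g" "\<And>c f. \<psi> (fscale c f) = c * \<psi> f" "\<And>f. f \<in> S \<Longrightarrow> \<psi> f = 0" "\<psi> x = 1"
proof -
  interpret vector_space_pair fscale "(*) :: complex \<Rightarrow> complex \<Rightarrow> complex"
    by unfold_locales (simp_all add: ring_distribs)
  obtain B where B: "B \<subseteq> S" "fun_vs.independent B" "S \<subseteq> fun_vs.span B"
    by (rule fun_vs.basis_exists[of S])
  have sB: "fun_vs.span B = S" using B assms(1) by (intro subset_antisym fun_vs.span_minimal)
  have "fun_vs.independent (insert x B)"
    by (rule fun_vs.independent_insertI) (use B(2) assms(2) sB in simp_all)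
  from linear_independent_extend[OF this, of "\<lambda>b. if b = x then 1 else 0"]
  obtain \<psi> where \<psi>: "Vector_Spaces.linear fscale (*) \<psi>"
    "\<And>b. b \<in> insert x B \<Longrightarrow> \<psi> b = (if b = x then 1 else 0)"
    by blast
  have "\<psi> f = 0" if "f \<in> S" for f
  proof (rule linear_eq_0_on_span[OF \<psi>(1)])
    show "f \<in> fun_vs.span B" using that sB by simp
    fix b assume "b \<in> B"
    then show "\<psi> b = 0" using \<psi>(2)[of b] B(1) assms(2) by (metis insertI2 subsetD)
  qed
  moreover have "\<psi> (f + g) = \<psi> f + \<psi> g" "\<psi> (fscale c f) = c * \<psi> f" for f g c
    by (rule linear_add[OF \<psi>(1)], rule linear_scale[OF \<psi>(1)])
  moreover have "\<psi> x = 1" using \<psi>(2)[of x] by simp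
  ultimately show ?thesis by (intro that)
qed

lemma sum_list_hom:
  fixes \<psi> :: "'b::monoid_add \<Rightarrow> 'c::monoid_add"
  assumes "\<And>f g. \<psi> (f + g) = \<psi> f + \<psi> g" "\<psi> 0 = 0"
  shows "\<psi> (sum_list xs) = sum_list (map \<psi> xs)"
  by (induction xs) (simp_all add: assms)

text \<open>If a functional \<open>\<psi>\<close> kills \<open>S\<close>, then conjugating \<open>\<psi> (K g) = 0\<close> shows that the function
  \<open>\<Sum>m. cnj (\<psi> m) m\<close> vanishes; applying \<open>\<psi>\<close> to it gives \<open>\<Sum>m. \<bar>\<psi> m\<bar>\<^sup>2 = 0\<close>.\<close>

lemma kernel_functions_span:
  fixes ms :: "('a \<Rightarrow> complex) list"
  assumes S: "fun_vs.subspace S"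
    and zero: "\<And>m g. m \<in> set ms \<Longrightarrow> g \<notin> G \<Longrightarrow> m g = 0"
    and K: "\<And>g. g \<in> G \<Longrightarrow> (\<Sum>m\<leftarrow>ms. fscale (cnj (m g)) m) \<in> S"
  shows "set ms \<subseteq> S"
proof
  fix x assume x: "x \<in> set ms"
  show "x \<in> S"
  proof (rule ccontr)
    assume "x \<notin> S"
    then obtain \<psi> where \<psi>: "\<And>f g. \<psi> (f + g) = \<psi> f + \<psi> g" "\<And>c f. \<psi> (fscale c f) = c * \<psi> f"
      "\<And>f. f \<in> S \<Longrightarrow> \<psi> f = 0" "\<psi> x = 1"
      using separating_functional[OF S] by metis
    have \<psi>0: "\<psi> 0 = 0" using \<psi>(2)[of 0 0] by (simp add: fscale_def zero_fun_def)
    have \<psi>_sum: "\<psi> (\<Sum>m\<leftarrow>ms. fscale (c m) m) = (\<Sum>m\<leftarrow>ms. c m * \<psi> m)" for c and ms :: "('a \<Rightarrow> complex) list"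
      using sum_list_hom[of \<psi>, OF \<psi>(1) \<psi>0, of "map (\<lambda>m. fscale (c m) m) ms"] by (simp add: o_def \<psi>(2))
    have "(\<Sum>m\<leftarrow>ms. cnj (m g) * \<psi> m) = 0" for g
    proof (cases "g \<in> G")
      case True
      then show ?thesis using \<psi>(3)[OF K[OF True]] by (simp add: \<psi>_sum)
    next
      case False
      then have "map (\<lambda>m. cnj (m g) * \<psi> m) ms = map (\<lambda>m. 0) ms" using zero by simp
      then show ?thesis by (simp only:) simp
    qed
    then have c: "cnj (\<Sum>m\<leftarrow>ms. cnj (m g) * \<psi> m) = 0" for g by simp
    have cs: "cnj (\<Sum>m\<leftarrow>ms. cnj (m g) * \<psi> m) = (\<Sum>m\<leftarrow>ms. fscale (cnj (\<psi> m)) m) g" for g and ms ::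
        "('a \<Rightarrow> complex) list"
      by (induction ms) (simp_all add: fscale_def)
    have "(\<Sum>m\<leftarrow>ms. fscale (cnj (\<psi> m)) m) = 0"
      using c unfolding cs by (simp add: fun_eq_iff)
    then have "(\<Sum>m\<leftarrow>ms. cnj (\<psi> m) * \<psi> m) = 0" using \<psi>_sum[of "\<lambda>m. cnj (\<psi> m)" ms] \<psi>0 by simp
    moreover have "Re (\<Sum>m\<leftarrow>ms. cnj (\<psi> m) * \<psi> m) = (\<Sum>m\<leftarrow>ms. (norm (\<psi> m))\<^sup>2)" for ms ::
        "('a \<Rightarrow> complex) list"
      by (induction ms) (simp_all add: cmod_power2, simp add: power2_eq_square)
    ultimately have "(\<Sum>m\<leftarrow>ms. (norm (\<psi> m))\<^sup>2) = 0" by (metis zero_complex.sel(1))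
    moreover have "(norm (\<psi> x))\<^sup>2 \<le> (\<Sum>m\<leftarrow>ms. (norm (\<psi> m))\<^sup>2)"
      using x by (intro member_le_sum_list) auto
    ultimately show False using \<psi>(4) by simp
  qed
qed

definition kern :: "(complex^4^4 \<Rightarrow> complex) list \<Rightarrow> complex^4^4 \<Rightarrow> complex^4^4 \<Rightarrow> complex" where
  "kern ms h g = (\<Sum>m\<leftarrow>ms. m h * cnj (m g))"

lemma kern_prodl: "kern (prodl as bs) h g = kern as h g * kern bs h g"
proof -
  have "(\<Sum>m\<leftarrow>map ((*) a) bs. m h * cnj (m g)) = a h * cnj (a g) * kern bs h g" for a
    unfolding kern_def by (induction bs) (simp_all add: algebra_simps)
  then show ?thesis
    unfolding prodl_def kern_def[of "concat _"] kern_def[of as]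
    by (induction as) (simp_all add: algebra_simps)
qed

lemma kern_powl: "h \<in> Sp4 \<Longrightarrow> g \<in> Sp4 \<Longrightarrow> kern (powl as n) h g = kern as h g ^ n"
  by (induction n) (simp_all add: kern_prodl, simp add: kern_def on_group_def)

section \<open>The highest vector and its translates\<close>

definition highest :: "nat \<Rightarrow> nat \<Rightarrow> complex^4^4 \<Rightarrow> complex" where
  "highest N M = res (\<lambda>h. h$1$1 ^ N * (h$1$1 * h$2$2 - h$1$2 * h$2$1) ^ M)"

lemma highest_W: "highest N M \<in> W N M"
proof -
  have "res (\<lambda>h. h$1$1 ^ N) \<in> W N 0" "res (\<lambda>h. (h$1$1 * h$2$2 - h$1$2 * h$2$1) ^ M) \<in> W 0 M"
    using W_power[OF W_xf[of 1, unfolded xf_def], of N] W_power[OF W_pf[of 1 2, unfolded pf_def],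
        of M] by simp_all
  from W_mult[OF this] show ?thesis by (simp add: highest_def res_simps)
qed

text \<open>Entry (1,1) of \<open>h\<close> times the adjoint of \<open>g\<close> is the Hermitian
  product of the two first rows. By Cauchy-Binet its upper left minor of order 2 is the Hermitian
  product of the vectors of minors in the first two rows. The powers \<open>N\<close> and
  \<open>M\<close> become products of kernels.\<close>

lemma highest_translate:
  assumes "h \<in> Sp4" and "g \<in> Sp4"
  shows "highest N M (h ** transpose (map_matrix cnj g)) = kern (prod_list_NM N M) h g"
proof -
  let ?k = "transpose (map_matrix cnj g)"
  have k: "?k \<in> Sp4" by (intro Sp4_transpose Sp4_cnj assms(2))
  have 1: "(h ** ?k) $ a $ b = h$a$1 * cnj (g$b$1) + h$a$2 * cnj (g$b$2) + h$a$3 * cnj (g$b$3)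
      + h$a$4 * cnj (g$b$4)" for a b
    by (simp add: matrix_mult_entry sum_4 transpose_def map_matrix_def)
  have x: "kern x_list h g = (h ** ?k)$1$1"
    using assms by (simp add: 1 kern_def x_list_def xf_def on_group_def)
  have p: "kern p_list h g = (h ** ?k)$1$1 * (h ** ?k)$2$2 - (h ** ?k)$1$2 * (h ** ?k)$2$1"
    using assms by (simp add: 1 kern_def p_list_def pf_def on_group_def algebra_simps)
  show ?thesis
    using assms Sp4_mult[OF assms(1) k]
    by (simp add: prod_list_NM_def kern_prodl kern_powl x p highest_def on_group_def)
qed

lemma generated_subrep_Sp4: "generated_subrep act_Sp4 (highest N M) = W N M"
proof
  show "generated_subrep act_Sp4 (highest N M) \<subseteq> W N M"
    unfolding generated_subrep_def using W_subspace highest_W W_act by (intro Inter_lower) auto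
  have "W N M \<subseteq> U" if U: "fun_vs.subspace U" "highest N M \<in> U" "\<forall>i j. \<forall>u\<in>U. act_Sp4 i j u \<in> U" for U
  proof -
    \<comment> \<open>The subspace \<open>U\<close> may contain functions that are not regular; the
      intersection with \<open>W N M\<close> is closed under the action and consists of regular
      functions.\<close>
    let ?U = "U \<inter> W N M"
    have sub: "fun_vs.subspace ?U" using U(1) W_subspace by (rule fun_vs.subspace_inter)
    have cl: "act_closed ?U"
      using sub U(3) W_act W_regular by (auto simp: act_closed_def)
    have "set (prod_list_NM N M) \<subseteq> ?U"
    proof (rule kernel_functions_span[OF sub, where G = Sp4])
      fix m g assume m: "m \<in> set (prod_list_NM N M)" "g \<notin> Sp4"
      then have "regular m" using stable_W by (auto simp: stable_def)
      then have "m = res m" by (simp add: res_regular)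
      then show "m g = 0" using m(2) by (metis on_group_def)
    next
      fix g assume g: "g \<in> Sp4"
      let ?k = "transpose (map_matrix cnj g)"
      have k: "?k \<in> Sp4" by (intro Sp4_transpose Sp4_cnj g)
      have "res (\<lambda>h. highest N M (h ** ?k)) \<in> ?U"
        by (rule act_closed_translate[OF cl k]) (use U(2) highest_W in blast)
      moreover have "res (\<lambda>h. highest N M (h ** ?k)) = res (\<Sum>m\<leftarrow>prod_list_NM N M. fscale (cnj (m g)) m)"
      proof -
        have "kern ms h g = (\<Sum>m\<leftarrow>ms. fscale (cnj (m g)) m) h" for h ms
          unfolding kern_def by (induction ms) (simp_all add: fscale_def mult.commute)
        then show ?thesis unfolding on_group_eq_iff using highest_translate[OF _ g] by simp
      qed
      moreover have reg: "regular (\<Sum>m\<leftarrow>ms. fscale (c m) m)" if "\<forall>m\<in>set ms. regular m" for ms c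
        using that by (induction ms) (auto intro!: regular_zero regular_add regular_scale)
      have "regular (\<Sum>m\<leftarrow>prod_list_NM N M. fscale (cnj (m g)) m)"
        by (rule reg) (use stable_W[of N M] in \<open>auto simp: stable_def\<close>)
      ultimately show "(\<Sum>m\<leftarrow>prod_list_NM N M. fscale (cnj (m g)) m) \<in> ?U"
        by (simp add: res_regular)
    qed
    then have "W N M \<subseteq> ?U" using fun_vs.span_minimal[OF _ sub] by (simp add: W_def)
    then show ?thesis by blast
  qed
  then show "W N M \<subseteq> generated_subrep act_Sp4 (highest N M)"
    unfolding generated_subrep_def by blast
qed

subsection \<open>Monomials in the invariants of the unipotent subgroup\<close>

text \<open>On the covering group the functions \<open>a\<close> with subscripts \<open>-2\<close>, \<open>-1\<close>, \<open>1\<close> are \<open>pl h 1 2\<close>,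
  \<open>pl h 1 3\<close>, \<open>pl h 2 4\<close>, and those with subscripts \<open>(-2,-1)\<close>, \<open>(-2,0)\<close>, \<open>(-2,1)\<close>, \<open>(-1,1)\<close> are
  \<open>(h$1$1)\<^sup>2\<close>, \<open>- sqrt 2 * h$1$1 * h$1$2\<close>, \<open>- (h$1$2)\<^sup>2\<close>, \<open>- yv h\<close>.\<close>

definition pl :: "complex^4^4 \<Rightarrow> 4 \<Rightarrow> 4 \<Rightarrow> complex" where
  "pl h i j = h$1$i * h$2$j - h$1$j * h$2$i"

definition yv :: "complex^4^4 \<Rightarrow> complex" where
  "yv h = h$1$2 * h$1$3 - h$1$1 * h$1$4"

definition mval :: "nat \<Rightarrow> nat \<Rightarrow> nat \<Rightarrow> nat \<Rightarrow> nat \<Rightarrow> nat \<Rightarrow> complex^4^4 \<Rightarrow> complex" where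
  "mval j e k a b q h = h$1$1 ^ j * (h$1$2 ^ e * yv h ^ k * pl h 1 2 ^ a * pl h 1 3 ^ b * pl h 2 4 ^ q)"

definition mon :: "nat \<Rightarrow> nat \<Rightarrow> nat \<Rightarrow> nat \<Rightarrow> nat \<Rightarrow> nat \<Rightarrow> complex^4^4 \<Rightarrow> complex" where
  "mon j e k a b q = res (mval j e k a b q)"

lemma polynomial_fun_pl: "polynomial_fun (\<lambda>h. pl h i j)"
  unfolding pl_def by (intro polynomial_fun_intros)

lemma polynomial_fun_yv: "polynomial_fun yv"
  unfolding yv_def by (intro polynomial_fun_intros)

lemma polynomial_fun_mval: "polynomial_fun (mval j e k a b q)"
  unfolding mval_def by (intro polynomial_fun_intros polynomial_fun_pl polynomial_fun_yv)

lemma regular_mon: "regular (mon j e k a b q)"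
  unfolding mon_def by (intro regularI polynomial_fun_mval)

lemma mon_factor:
  "mon j e k a b q = res (\<lambda>h. h$1$1 ^ j) * (res (\<lambda>h. h$1$2 ^ e) * res (\<lambda>h. yv h ^ k) *
     res (\<lambda>h. pl h 1 2 ^ a) * res (\<lambda>h. pl h 1 3 ^ b) * res (\<lambda>h. pl h 2 4 ^ q))"
  unfolding mon_def mval_def res_simps ..

lemma mon_mult: "mon j e k a b q * mon j' e' k' a' b' q' = mon (j + j') (e + e') (k + k') (a + a')
    (b + b') (q + q')"
  unfolding mon_def res_simps on_group_eq_iff by (simp add: mval_def power_add)

lemma pf_eq: "pf i j = res (\<lambda>h. pl h i j)"
  by (simp add: pf_def pl_def)

lemma yv_eq: "res yv = xf 2 * xf 3 + fscale (- 1) (xf 1 * xf 4)"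
  unfolding xf_def res_simps on_group_eq_iff by (simp add: yv_def)

lemma mon_W: "mon j e k a b q \<in> W (j + e + 2 * k) (a + b + q)"
proof -
  have "fscale (- 1) (xf 1 * xf 4) \<in> W 2 0" "xf 2 * xf 3 \<in> W 2 0"
    by (rule fun_vs.subspace_scale[OF W_subspace]; use W_mult[OF W_xf W_xf] in
        \<open>simp add: numeral_2_eq_2\<close>)
       (use W_mult[OF W_xf W_xf] in \<open>simp add: numeral_2_eq_2\<close>)
  then have y: "res yv \<in> W 2 0"
    unfolding yv_eq using W_subspace by (intro fun_vs.subspace_add)
  note x = W_xf[unfolded xf_def] and p = W_pf[unfolded pf_eq]
  have "mon j e k a b q \<in> W (j * 1 + (e * 1 + k * 2 + a * 0 + b * 0 + q * 0)) (j * 0 +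
      (e * 0 + k * 0 + a * 1 + b * 1 + q * 1))"
    unfolding mon_factor by (intro W_mult W_power x y p)
  then show ?thesis by (simp add: mult.commute add.assoc)
qed

definition eig :: "5 \<Rightarrow> 5 \<Rightarrow> complex \<Rightarrow> (complex^4^4 \<Rightarrow> complex) \<Rightarrow> bool" where
  "eig i j w f \<longleftrightarrow> regular f \<and> act_Sp4 i j f = fscale w f"

lemma eig_mult: "eig i j w f \<Longrightarrow> eig i j w' f' \<Longrightarrow> eig i j (w + w') (f * f')"
  by (simp add: eig_def regular_mult act_Sp4_mult fscale_mult fscale_simps)

lemma eig_add: "eig i j w f \<Longrightarrow> eig i j w f' \<Longrightarrow> eig i j w (f + f')"
  by (simp add: eig_def regular_add act_Sp4_add fscale_simps)

lemma eig_scale: "eig i j w f \<Longrightarrow> eig i j w (fscale c f)"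
  by (simp add: eig_def regular_scale act_Sp4_scale fscale_simps mult.commute)

lemma eig_zero: "eig i j w 0"
  by (simp add: eig_def regular_zero act_Sp4_zero fscale_simps)

lemma eig_power: "eig i j w (res f) \<Longrightarrow> eig i j (of_nat n * w) (res (\<lambda>h. f h ^ n))"
proof (induction n)
  case 0
  have "act_Sp4 i j (res (\<lambda>h. 1)) = 0"
    unfolding act_Sp4_res poly_shift_const by (rule res_simps(4))
  then show ?case
    by (simp add: eig_def fscale_simps regularI polynomial_fun.intros(1))
next
  case (Suc n)
  then have "eig i j (w + of_nat n * w) (res f * res (\<lambda>h. f h ^ n))" by (intro eig_mult)
  then show ?case by (simp add: res_simps ring_distribs)
qed

lemma eig_sum: "(\<And>x. x \<in> A \<Longrightarrow> eig i j w (F x)) \<Longrightarrow> eig i j w (\<Sum>x\<in>A. F x)"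
proof (induction A rule: infinite_finite_induct)
  case (insert x A)
  show ?case unfolding sum.insert[OF insert(1,2)]
    by (intro eig_add insert.IH insert.prems) auto
qed (simp_all add: eig_zero)

lemma eig_yv:
  assumes "eig i j w1 (xf 1)" "eig i j w4 (xf 4)" "eig i j w2 (xf 2)"
      "act_Sp4 i j (xf 3) = fscale w3 (xf 3)"
    "w2 + w3 = w1 + w4"
  shows "eig i j (w1 + w4) (res yv)"
  unfolding yv_eq using assms eig_mult[OF assms(1,2)] eig_mult[of i j w2 "xf 2" w3 "xf 3"]
  by (intro eig_add eig_scale) (auto simp: eig_def regular_xf)

lemma eig_mon:
  assumes "eig i j w1 (xf 1)" "eig i j w2 (xf 2)" "eig i j wy (res yv)" "eig i j w12 (pf 1 2)"
      "eig i j w13 (pf 1 3)"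
    "eig i j w24 (pf 2 4)"
  shows "eig i j (of_nat n * w1 + (of_nat e * w2 + of_nat k * wy + of_nat a * w12 + of_nat b * w13
      + of_nat q * w24)) (mon n e k a b q)"
  unfolding mon_factor using assms[unfolded xf_def pf_eq] by (intro eig_mult eig_power)

lemma spmat_entries:
  "spmat a b c d e f g h k l $ 1 = vector [a, b, c, d]" "spmat a b c d e f g h k l $ 2 = vector
      [e, f, g, c]"
  "spmat a b c d e f g h k l $ 3 = vector [h, k, - f, - b]"
      "spmat a b c d e f g h k l $ 4 = vector [l, h, - e, - a]"
  by (simp_all add: spmat_def)

lemma pf_same: "pf i i = 0"
  by (simp add: pf_def res_simps)

text \<open>The operator kills x1 and x2 and sends x3, x4 to the same multiple of x1, x2, so the two
  contributions to y cancel. In p13 and p24 it only produces minors with a repeated column.\<close>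

lemma eig_mon_annihilated: "eig (-2) 0 0 (mon j e k a b q)"
proof -
  note ev = eig_def regular_xf regular_pf act_xf act_pf sp_of_gen_F spmat_entries fscale_simps
  have "eig (-2) 0 0 (xf 1)" "eig (-2) 0 0 (xf 2)"
    "act_Sp4 (-2) 0 (xf 3) = fscale (1 / root2) (xf 1)" "act_Sp4 (-2) 0 (xf 4) = fscale
        (1 / root2) (xf 2)"
    "eig (-2) 0 0 (pf 1 2)"
    by (simp_all add: ev)
  moreover have "eig (-2) 0 0 (pf 1 3)"
    by (simp add: ev pf_same)
  moreover have "eig (-2) 0 0 (pf 2 4)"
    by (simp add: ev pf_same)
  moreover have "eig (-2) 0 0 (res yv)"
  proof -
    have "act_Sp4 (-2) 0 (res yv) = 0"
      using calculation unfolding yv_eq eig_def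
      by (simp only: act_Sp4_add act_Sp4_mult act_Sp4_scale regular_xf regular_mult regular_scale
          fscale_simps)
         (simp add: fscale_def fun_eq_iff)
    then show ?thesis by (simp add: eig_def fscale_simps regularI polynomial_fun_yv)
  qed
  ultimately show ?thesis
    using eig_mon[of "-2" 0 0 0 0 0 0 0 j e k a b q] by simp
qed

lemma eig_mon_minus2:
  "eig (-2) (-2) ((of_nat j + of_nat e) / 2 + of_nat a) (mon j e k a b q)"
proof -
  note ev = eig_def regular_xf regular_pf act_xf act_pf sp_of_gen_F spmat_entries fscale_simps
  have 1: "eig (-2) (-2) (1 / 2) (xf 1)" "eig (-2) (-2) (1 / 2) (xf 2)"
    "eig (-2) (-2) (- 1 / 2) (xf 4)" "act_Sp4 (-2) (-2) (xf 3) = fscale (- 1 / 2) (xf 3)"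
    by (simp_all add: ev)
  have 2: "eig (-2) (-2) 1 (pf 1 2)" "eig (-2) (-2) 0 (pf 1 3)" "eig (-2) (-2) 0 (pf 2 4)"
    unfolding eig_def act_pf sp_of_gen_F spmat_entries
    by (simp_all add: regular_pf) (simp_all add: fscale_def fun_eq_iff)
  have "eig (-2) (-2) 0 (res yv)"
    using eig_yv[OF 1(1,3,2,4)] by simp
  then show ?thesis
    using eig_mon[of "-2" "-2" "1/2" "1/2" 0 1 0 0 j e k a b q] 1 2 by
        (simp add: add_divide_distrib add.assoc)
qed

lemma eig_mon_minus1:
  "eig (-1) (-1) ((of_nat j - of_nat e) / 2 + of_nat b - of_nat q) (mon j e k a b q)"
proof -
  note ev = eig_def regular_xf regular_pf act_xf act_pf sp_of_gen_F spmat_entries fscale_simps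
  have 1: "eig (-1) (-1) (1 / 2) (xf 1)" "eig (-1) (-1) (- 1 / 2) (xf 2)"
    "eig (-1) (-1) (- 1 / 2) (xf 4)" "act_Sp4 (-1) (-1) (xf 3) = fscale (1 / 2) (xf 3)"
    by (simp_all add: ev)
  have 2: "eig (-1) (-1) 0 (pf 1 2)" "eig (-1) (-1) 1 (pf 1 3)" "eig (-1) (-1) (- 1) (pf 2 4)"
    unfolding eig_def act_pf sp_of_gen_F spmat_entries
    by (simp_all add: regular_pf) (simp_all add: fscale_def fun_eq_iff)
  have "eig (-1) (-1) 0 (res yv)"
    using eig_yv[OF 1(1,3,2,4)] by simp
  then show ?thesis
    using eig_mon[of "-1" "-1" "1/2" "-1/2" 0 0 1 "-1" j e k a b q] 1 2 by
        (simp add: diff_divide_distrib algebra_simps)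
qed

text \<open>The first relation is the symplectic orthogonality of rows 1 and 2. The next two expand
  determinants of order 3 in which row 1 occurs twice. Expanding x3 p12 and x4 p12 in the same way
  gives the last one, where p14 + p23 = 0 removes the mixed terms.\<close>

lemma Sp4_pl_relations:
  assumes "h \<in> Sp4"
  shows "pl h 1 4 = - pl h 2 3"
    and "h$1$1 * pl h 2 3 = h$1$2 * pl h 1 3 - h$1$3 * pl h 1 2"
    and "h$1$1 * pl h 3 4 = h$1$3 * pl h 1 4 - h$1$4 * pl h 1 3"
    and "pl h 1 2 * yv h = pl h 1 3 * h$1$2 ^ 2 + pl h 2 4 * h$1$1 ^ 2"
proof -
  have r: "h$1$1 * h$2$4 + h$1$2 * h$2$3 - h$1$3 * h$2$2 - h$1$4 * h$2$1 = 0"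
    using Sp4_row_form[OF assms, of 1 2] by (simp add: symp_mat_vector)
  show "pl h 1 4 = - pl h 2 3" unfolding pl_def using r by algebra
  show "h$1$1 * pl h 2 3 = h$1$2 * pl h 1 3 - h$1$3 * pl h 1 2" unfolding pl_def by algebra
  show "h$1$1 * pl h 3 4 = h$1$3 * pl h 1 4 - h$1$4 * pl h 1 3" unfolding pl_def by algebra
  show "pl h 1 2 * yv h = pl h 1 3 * h$1$2 ^ 2 + pl h 2 4 * h$1$1 ^ 2"
      unfolding pl_def yv_def using r by algebra
qed

lemma mon_relation:
  "mon j (e + 2) k a (b + 1) q = mon j e (k + 1) (a + 1) b q + fscale (- 1) (mon (j + 2) e k a b
      (q + 1))"
  unfolding mon_def res_simps on_group_eq_iff
proof
  fix h assume "h \<in> Sp4"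
  then have *: "pl h 1 3 * h$1$2 ^ 2 = pl h 1 2 * yv h - pl h 2 4 * h$1$1 ^ 2" by
      (simp add: Sp4_pl_relations)
  have "mval j (e + 2) k a (b + 1) q h = mval j e k a b q h * (pl h 1 3 * h$1$2 ^ 2)"
    by (simp add: mval_def power_add power2_eq_square)
  also have "\<dots> = mval j e (k + 1) (a + 1) b q h + - 1 * mval (j + 2) e k a b (q + 1) h"
    unfolding * by (simp add: mval_def power_add power2_eq_square algebra_simps)
  finally show "mval j (e + 2) k a (b + 1) q h = mval j e (k + 1) (a + 1) b q h + - 1 * mval
      (j + 2) e k a b (q + 1) h" .
qed

subsection \<open>The slice\<close>

definition Mon :: "nat \<Rightarrow> nat \<Rightarrow> (complex^4^4 \<Rightarrow> complex) set" where
  "Mon A B = {mon j e k a b q | j e k a b q. j + e + 2 * k = A \<and> a + b + q = B}"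

lemma MonI: "j + e + 2 * k = A \<Longrightarrow> a + b + q = B \<Longrightarrow> mon j e k a b q \<in> Mon A B"
  unfolding Mon_def by blast

lemma span_Mon_mult:
  assumes "f \<in> fun_vs.span (Mon A B)" "g \<in> fun_vs.span (Mon A' B')"
  shows "f * g \<in> fun_vs.span (Mon (A + A') (B + B'))"
proof -
  have "set_mult (Mon A B) (Mon A' B') \<subseteq> Mon (A + A') (B + B')"
  proof
    fix s assume "s \<in> set_mult (Mon A B) (Mon A' B')"
    then obtain u v where uv: "s = u * v" "u \<in> Mon A B" "v \<in> Mon A' B'"
      by (auto simp: set_mult_def)
    obtain j e k a b q where u: "u = mon j e k a b q" "j + e + 2 * k = A" "a + b + q = B"
      using uv(2) unfolding Mon_def by blast
    obtain j' e' k' a' b' q' where v: "v = mon j' e' k' a' b' q'" "j' + e' + 2 * k' = A'"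
        "a' + b' + q' = B'"
      using uv(3) unfolding Mon_def by blast
    show "s \<in> Mon (A + A') (B + B')"
      unfolding uv(1) u(1) v(1) mon_mult by (rule MonI) (use u(2,3) v(2,3) in simp_all)
  qed
  then show ?thesis by (rule subsetD[OF fun_vs.span_mono span_mult[OF assms]])
qed

text \<open>The parameter makes \<open>slice_pt h $ 1 $ 3 = 0\<close> wherever \<open>h$1$1 \<noteq> 0\<close>.\<close>

definition slice_pt :: "complex^4^4 \<Rightarrow> complex^4^4" where
  "slice_pt h = h ** sp_elem (-2) 0 (- root2 * h$1$3 / h$1$1)"

text \<open>The exponent \<open>n\<close> bounds the pole along x1 = 0 that restriction to the slice
  creates; \<open>A\<close> and \<open>B\<close> are the degrees in the first row and in the minors
  after clearing it.\<close>

definition sliced :: "nat \<Rightarrow> nat \<Rightarrow> nat \<Rightarrow> (complex^4^4 \<Rightarrow> complex) \<Rightarrow> bool" where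
  "sliced n A B f \<longleftrightarrow> (\<exists>g\<in>fun_vs.span (Mon A B). \<forall>h\<in>Sp4. h$1$1 \<noteq> 0 \<longrightarrow> h$1$1 ^ n * f (slice_pt h) = g h)"

lemma sliced_mult:
  assumes "sliced n A B f" and "sliced n' A' B' f'"
  shows "sliced (n + n') (A + A') (B + B') (f * f')"
proof -
  obtain g g' where g: "g \<in> fun_vs.span (Mon A B)" "\<And>h. h \<in> Sp4 \<Longrightarrow> h$1$1 \<noteq> 0 \<Longrightarrow> h$1$1 ^ n * f
      (slice_pt h) = g h"
    "g' \<in> fun_vs.span (Mon A' B')" "\<And>h. h \<in> Sp4 \<Longrightarrow> h$1$1 \<noteq> 0 \<Longrightarrow> h$1$1 ^ n' * f' (slice_pt h) = g' h"
    using assms unfolding sliced_def by blast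
  then show ?thesis
    unfolding sliced_def
  proof (intro bexI[of _ "g * g'"] span_Mon_mult ballI impI)
    fix h :: "complex^4^4" assume h: "h \<in> Sp4" "h$1$1 \<noteq> 0"
    have "h$1$1 ^ (n + n') * (f * f') (slice_pt h) = (h$1$1 ^ n * f (slice_pt h)) *
        (h$1$1 ^ n' * f' (slice_pt h))"
      by (simp add: power_add)
    then show "h$1$1 ^ (n + n') * (f * f') (slice_pt h) = (g * g') h"
      unfolding g(2)[OF h] g(4)[OF h] by simp
  qed (use g in auto)
qed

lemma sliced_subspace: "fun_vs.subspace {f. sliced n A B f}"
proof (rule fun_vs.subspaceI)
  show "0 \<in> {f. sliced n A B f}"
    by (auto simp: sliced_def intro!: bexI[of _ 0] fun_vs.span_zero)
next
  fix f f' assume "f \<in> {f. sliced n A B f}" "f' \<in> {f. sliced n A B f}"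
  then obtain g g' where "g \<in> fun_vs.span (Mon A B)" "\<And>h. h \<in> Sp4 \<Longrightarrow> h$1$1 \<noteq> 0 \<Longrightarrow> h$1$1 ^ n * f
      (slice_pt h) = g h"
    "g' \<in> fun_vs.span (Mon A B)" "\<And>h. h \<in> Sp4 \<Longrightarrow> h$1$1 \<noteq> 0 \<Longrightarrow> h$1$1 ^ n * f' (slice_pt h) = g' h"
    unfolding sliced_def by blast
  then show "f + f' \<in> {f. sliced n A B f}"
    unfolding sliced_def by (intro CollectI bexI[of _ "g + g'"] fun_vs.span_add)
        (auto simp: ring_distribs)
next
  fix c f assume "f \<in> {f. sliced n A B f}"
  then obtain g where "g \<in> fun_vs.span (Mon A B)" "\<And>h. h \<in> Sp4 \<Longrightarrow> h$1$1 \<noteq> 0 \<Longrightarrow> h$1$1 ^ n * f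
      (slice_pt h) = g h"
    unfolding sliced_def by blast
  then show "fscale c f \<in> {f. sliced n A B f}"
    unfolding sliced_def
    by (intro CollectI bexI[of _ "fscale c g"] fun_vs.span_scale)
        (auto simp: fscale_def mult.left_commute)
qed

lemma slice_pt_Sp4: "h \<in> Sp4 \<Longrightarrow> slice_pt h \<in> Sp4"
  unfolding slice_pt_def by (rule Sp4_sp_elem) (simp_all add: root_pairs_def)

lemma slice_pt_coords:
  assumes "h \<in> Sp4" "h$1$1 \<noteq> 0"
  shows "slice_pt h $ 1 $ 1 = h$1$1" "slice_pt h $ 1 $ 2 = h$1$2" "slice_pt h $ 1 $ 3 = 0"
    "h$1$1 * slice_pt h $ 1 $ 4 = - yv h"
    "pl (slice_pt h) 1 2 = pl h 1 2" "pl (slice_pt h) 1 3 = pl h 1 3" "pl (slice_pt h) 2 4 = pl h 2 4"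
    "h$1$1 * pl (slice_pt h) 2 3 = h$1$2 * pl h 1 3"
    "h$1$1 * pl (slice_pt h) 1 4 = - (h$1$2 * pl h 1 3)"
    "h$1$1 ^ 2 * pl (slice_pt h) 3 4 = yv h * pl h 1 3"
proof -
  let ?k = "slice_pt h"
  show x: "?k $ 1 $ 1 = h$1$1" "?k $ 1 $ 2 = h$1$2" "?k $ 1 $ 3 = 0" and 4:
      "h$1$1 * ?k $ 1 $ 4 = - yv h"
    using assms(2) by (simp_all add: slice_pt_def sp_elem_columns yv_def field_simps)
  show p: "pl ?k 1 2 = pl h 1 2" "pl ?k 1 3 = pl h 1 3" "pl ?k 2 4 = pl h 2 4"
    by (simp_all add: pl_def slice_pt_def sp_elem_columns algebra_simps)
  note r = Sp4_pl_relations[OF slice_pt_Sp4[OF assms(1)], unfolded x p]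
  show 23: "h$1$1 * pl ?k 2 3 = h$1$2 * pl h 1 3" using r(2) by simp
  show "h$1$1 * pl ?k 1 4 = - (h$1$2 * pl h 1 3)" using r(1) 23 by simp
  have "h$1$1 ^ 2 * pl ?k 3 4 = h$1$1 * (h$1$1 * pl ?k 3 4)" by (simp add: power2_eq_square)
  also have "\<dots> = - (h$1$1 * ?k $ 1 $ 4) * pl h 1 3" unfolding r(3) by simp
  finally show "h$1$1 ^ 2 * pl ?k 3 4 = yv h * pl h 1 3" unfolding 4 by simp
qed

lemma slicedI:
  assumes "j + e + 2 * k = A" "a + b + q = B"
    and "\<And>h. h \<in> Sp4 \<Longrightarrow> h$1$1 \<noteq> 0 \<Longrightarrow> h$1$1 ^ n * f (slice_pt h) = c * mval j e k a b q h"
  shows "sliced n A B f"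
  unfolding sliced_def
proof (intro bexI[of _ "fscale c (mon j e k a b q)"] ballI impI)
  show "fscale c (mon j e k a b q) \<in> fun_vs.span (Mon A B)"
    by (intro fun_vs.span_scale fun_vs.span_base) (rule MonI[OF assms(1,2)])
qed (use assms(3) in \<open>simp add: fscale_def mon_def on_group_def\<close>)

text \<open>On the slice x4 becomes -y/x1, so one factor x1 is enough and the degree rises to
  2.\<close>

lemma sliced_x_list: "f \<in> set x_list \<Longrightarrow> sliced 1 2 0 f"
proof -
  have e: "xf i (slice_pt h) = slice_pt h $ 1 $ i" if "h \<in> Sp4" for i h
    using slice_pt_Sp4[OF that] by (simp add: xf_def on_group_def)
  note s = e mval_def power2_eq_square slice_pt_coords
  have "sliced 1 2 0 (xf 1)" by (rule slicedI[of 2 0 0 _ 0 0 0 _ _ _ 1]) (simp_all add: s)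
  moreover have "sliced 1 2 0 (xf 2)" by (rule slicedI[of 1 1 0 _ 0 0 0 _ _ _ 1]) (simp_all add: s)
  \<comment> \<open>This coordinate vanishes on the slice; with coefficient 0 any monomial of the
    right degrees serves.\<close>
  moreover have "sliced 1 2 0 (xf 3)" by (rule slicedI[of 1 1 0 _ 0 0 0 _ _ _ 0]) (simp_all add: s)
  moreover have "sliced 1 2 0 (xf 4)" by (rule slicedI[of 0 0 1 _ 0 0 0 _ _ _ "-1"]) (simp_all add: s)
  ultimately show "f \<in> set x_list \<Longrightarrow> sliced 1 2 0 f" by (auto simp: x_list_def)
qed

text \<open>The worst case is p34, which becomes y p13 / x1^2 on the slice; hence two factors
  x1.\<close>

lemma sliced_p_list: "f \<in> set p_list \<Longrightarrow> sliced 2 2 1 f"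
proof -
  have e: "pf i j (slice_pt h) = pl (slice_pt h) i j" if "h \<in> Sp4" for i j h
    using slice_pt_Sp4[OF that] by (simp add: pf_eq on_group_def)
  note s = e mval_def power2_eq_square slice_pt_coords[unfolded power2_eq_square] mult.assoc
  have "sliced 2 2 1 (pf 1 2)" by (rule slicedI[of 2 0 0 _ 1 0 0 _ _ _ 1]) (simp_all add: s)
  moreover have "sliced 2 2 1 (pf 1 3)" by (rule slicedI[of 2 0 0 _ 0 1 0 _ _ _ 1]) (simp_all add: s)
  moreover have "sliced 2 2 1 (pf 1 4)" by (rule slicedI[of 1 1 0 _ 0 1 0 _ _ _ "-1"]) (simp_all add: s)
  moreover have "sliced 2 2 1 (pf 2 3)" by (rule slicedI[of 1 1 0 _ 0 1 0 _ _ _ 1]) (simp_all add: s)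
  moreover have "sliced 2 2 1 (pf 2 4)" by (rule slicedI[of 2 0 0 _ 0 0 1 _ _ _ 1]) (simp_all add: s)
  moreover have "sliced 2 2 1 (pf 3 4)" by (rule slicedI[of 0 0 1 _ 0 1 0 _ _ _ 1])
      (simp_all add: e mval_def slice_pt_coords)
  ultimately show "f \<in> set p_list \<Longrightarrow> sliced 2 2 1 f" by (auto simp: p_list_def)
qed

lemma sliced_powl:
  assumes "\<And>f. f \<in> set as \<Longrightarrow> sliced n A B f" and "f \<in> set (powl as m)"
  shows "sliced (m * n) (m * A) (m * B) f"
  using assms(2)
proof (induction m arbitrary: f)
  case 0
  then have f: "f = res (\<lambda>h. 1)" by simp
  show ?case unfolding f
    by (rule slicedI[of 0 0 0 _ 0 0 0 _ _ _ 1]) (simp_all add: mval_def slice_pt_Sp4 on_group_def)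
next
  case (Suc m)
  then obtain a b where ab: "f = a * b" "a \<in> set as" "b \<in> set (powl as m)"
    by (auto simp: set_prodl set_mult_def)
  show ?case
    unfolding ab(1) mult_Suc by (rule sliced_mult[OF assms(1)[OF ab(2)] Suc.IH[OF ab(3)]])
qed

lemma sliced_W:
  assumes "f \<in> W N M"
  shows "sliced (N + 2 * M) (2 * N + 2 * M) M f"
proof -
  have "set (prod_list_NM N M) \<subseteq> {f. sliced (N + 2 * M) (2 * N + 2 * M) M f}"
  proof
    fix f assume "f \<in> set (prod_list_NM N M)"
    then obtain a b where "f = a * b" "a \<in> set (powl x_list N)" "b \<in> set (powl p_list M)"
      by (auto simp: prod_list_NM_def set_prodl set_mult_def)
    then show "f \<in> {f. sliced (N + 2 * M) (2 * N + 2 * M) M f}"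
      using sliced_mult[OF sliced_powl[OF sliced_x_list] sliced_powl[OF sliced_p_list]]
      by (simp add: mult.commute)
  qed
  then show ?thesis
    using assms fun_vs.span_minimal[OF _ sliced_subspace] unfolding W_def by blast
qed

text \<open>The derivative of the left side at any \<open>t\<close> is the action on
  \<open>f\<close> evaluated at the translated point, hence zero.\<close>

lemma annihilated_invariant:
  assumes f: "regular f" "act_Sp4 (-2) 0 f = 0" and h: "h \<in> Sp4"
  shows "f (h ** sp_elem (-2) 0 t) = f h"
proof -
  have r: "(-2, 0) \<in> root_pairs" by (simp add: root_pairs_def)
  obtain P where P: "polynomial_fun P" "f = res P" using f(1) by (rule regularE)
  let ?F = "\<lambda>t. P (h ** sp_elem (-2) 0 t)"
  have "(?F has_field_derivative 0) (at t)" for t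
  proof -
    let ?k = "h ** sp_elem (-2) 0 t"
    have k: "?k \<in> Sp4" by (rule Sp4_sp_elem[OF h r])
    have "poly_shift (sp_of (gen_F (-2) 0)) P ?k = act_Sp4 (-2) 0 f ?k"
      using k unfolding P(2) act_Sp4_res by (simp add: on_group_def)
    then have "((\<lambda>s. P (?k ** mat_exp (mscale s (sp_of (gen_F (-2) 0))))) has_field_derivative 0)
        (at 0)"
      using poly_shift_deriv[OF P(1), of ?k "sp_of (gen_F (-2) 0)"] f(2) by simp
    then have "((\<lambda>s. ?F (s + t)) has_field_derivative 0) (at 0)"
      by (simp add: mat_exp_sp_of_root[OF r] matrix_mul_assoc[symmetric] sp_elem_add[OF r] add.commute)
    then show ?thesis using DERIV_shift[of ?F 0 0 t] by simp
  qed
  then obtain c where "\<And>t. ?F t = c"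
    using has_field_derivative_zero_constant[of UNIV ?F] by auto
  from this[of t] this[of 0] show ?thesis
    using h Sp4_sp_elem[OF h r] by (simp add: P on_group_def sp_elem_zero)
qed

lemma Sp4_cancel_power:
  assumes "polynomial_fun P" and "\<And>h. h \<in> Sp4 \<Longrightarrow> h$1$1 ^ n * P h = 0" and "h \<in> Sp4"
  shows "P h = 0"
  using assms(2,3)
proof (induction n arbitrary: h)
  case (Suc n)
  have "h$1$1 ^ n * P h = 0" if "h \<in> Sp4" for h
  proof (rule Sp4_cancel[where P = "\<lambda>h. h$1$1 ^ n * P h"])
    show "polynomial_fun (\<lambda>h. h$1$1 ^ n * P h)" by (intro polynomial_fun_intros assms(1))
    show "h$1$1 * (h$1$1 ^ n * P h) = 0" if "h \<in> Sp4" for h using Suc.prems(1)[OF that] by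
        (simp add: mult.assoc)
  qed (rule that)
  then show ?case using Suc.IH Suc.prems(2) by blast
qed simp

lemma regular_cancel_power:
  assumes "regular f" and "\<And>h. h \<in> Sp4 \<Longrightarrow> h$1$1 ^ n * f h = 0"
  shows "f = 0"
proof -
  obtain P where P: "polynomial_fun P" "f = res P" using assms(1) by (rule regularE)
  have "P h = 0" if "h \<in> Sp4" for h
    by (rule Sp4_cancel_power[OF P(1) _ that]) (use assms(2) in \<open>simp add: P on_group_def\<close>)
  then show ?thesis unfolding P(2) by (simp add: fun_eq_iff on_group_def)
qed

lemma regular_span_Mon: "g \<in> fun_vs.span (Mon A B) \<Longrightarrow> regular g"
  by (rule regular_span) (auto simp: Mon_def regular_mon)

text \<open>By invariance \<open>f\<close> takes the same value at \<open>h\<close> and at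
  \<open>slice_pt h\<close>, so the expansion found on the slice holds wherever \<open>h$1$1\<close>
  is nonzero.\<close>

lemma annihilated_span_Mon:
  assumes "f \<in> W N M" and "act_Sp4 (-2) 0 f = 0"
  shows "res (\<lambda>h. h$1$1 ^ (N + 2 * M)) * f \<in> fun_vs.span (Mon (2 * N + 2 * M) M)"
proof -
  obtain g where g: "g \<in> fun_vs.span (Mon (2 * N + 2 * M) M)"
    "\<And>h. h \<in> Sp4 \<Longrightarrow> h$1$1 \<noteq> 0 \<Longrightarrow> h$1$1 ^ (N + 2 * M) * f (slice_pt h) = g h"
    using sliced_W[OF assms(1)] unfolding sliced_def by blast
  have rf: "regular f" by (rule W_regular[OF assms(1)])
  have eq: "h$1$1 ^ (N + 2 * M) * f h = g h" if "h \<in> Sp4" "h$1$1 \<noteq> 0" for h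
    using g(2)[OF that] annihilated_invariant[OF rf assms(2) that(1)] by (simp add: slice_pt_def)
  have rx: "regular (res (\<lambda>h. h$1$1 ^ (N + 2 * M)))" by (intro regularI polynomial_fun_intros)
  have rd: "regular (res (\<lambda>h. h$1$1 ^ (N + 2 * M)) * f + fscale (- 1) g)"
    by (intro regular_add regular_mult regular_scale rx rf regular_span_Mon[OF g(1)])
  have "res (\<lambda>h. h$1$1 ^ (N + 2 * M)) * f + fscale (- 1) g = 0"
  \<comment> \<open>One more factor \<open>h$1$1\<close> makes the identity trivial where
    \<open>h$1$1 = 0\<close>, the only points that the slice does not reach.\<close>
  proof (rule regular_cancel_power[OF rd, of 1])
    fix h assume h: "h \<in> Sp4"
    then show "h$1$1 ^ 1 * (res (\<lambda>h. h$1$1 ^ (N + 2 * M)) * f + fscale (- 1) g) h = 0"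
      using eq[OF h] by (cases "h$1$1 = 0") (simp_all add: on_group_def fscale_def)
  qed
  then have "res (\<lambda>h. h$1$1 ^ (N + 2 * M)) * f = g"
    by (simp add: fscale_def fun_eq_iff)
  then show ?thesis using g(1) by simp
qed

subsection \<open>Decomposition into weight vectors\<close>

lemma eig_subspace: "fun_vs.subspace {f. eig i j w f}"
  by (rule fun_vs.subspaceI) (simp_all add: eig_zero eig_add eig_scale)

text \<open>Applying the operator minus \<mu> maps the span for
  \<open>insert \<mu> \<Lambda>\<close> into the span for \<open>\<Lambda>\<close>, and it
  multiplies \<open>b\<close> by the nonzero number \<open>w - \<mu>\<close>. Eigenvalues can thus
  be removed one at a time.\<close>

lemma eig_in_span_other:
  assumes F: "\<And>x. x \<in> I \<Longrightarrow> eig i j (wt x) (F x)" and "finite \<Lambda>" "w \<notin> \<Lambda>"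
    and "b \<in> fun_vs.span (F ` {x \<in> I. wt x \<in> \<Lambda>})" "eig i j w b"
  shows "b = 0"
  using assms(2-)
proof (induction \<Lambda>)
  case empty
  then show ?case by simp
next
  case (insert \<mu> \<Lambda>)
  let ?T = "fun_vs.span (F ` {x \<in> I. wt x \<in> \<Lambda>})"
  let ?S = "{g. regular g \<and> act_Sp4 i j g + fscale (- \<mu>) g \<in> ?T}"
  have sub: "fun_vs.subspace ?S"
  proof (rule fun_vs.subspaceI)
    show "0 \<in> ?S"
      by (simp add: regular_zero act_Sp4_zero fun_vs.span_zero)
  next
    fix f g assume fg: "f \<in> ?S"
      "g \<in> ?S"
    have "act_Sp4 i j (f + g) + fscale (- \<mu>) (f + g)
      = (act_Sp4 i j f + fscale (- \<mu>) f) + (act_Sp4 i j g + fscale (- \<mu>) g)"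
      using fg act_Sp4_add[of f g i j] by (simp add: fun_eq_iff fscale_def algebra_simps)
    then show "f + g \<in> ?S"
      using fg by (simp only: mem_Collect_eq regular_add fun_vs.span_add simp_thms)
  next
    fix c f assume f: "f \<in> ?S"
    have "act_Sp4 i j (fscale c f) + fscale (- \<mu>) (fscale c f) = fscale c (act_Sp4 i j f + fscale
        (- \<mu>) f)"
      using f act_Sp4_scale[of f i j c] by (simp add: fun_eq_iff fscale_def algebra_simps)
    then show "fscale c f \<in> ?S"
      using f by (simp only: mem_Collect_eq regular_scale fun_vs.span_scale simp_thms)
  qed
  have "F ` {x \<in> I. wt x \<in> insert \<mu> \<Lambda>} \<subseteq> ?S"
  proof
    fix g assume "g \<in> F ` {x \<in> I. wt x \<in> insert \<mu> \<Lambda>}"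
    then obtain x where x: "g = F x" "x \<in> I" "wt x = \<mu> \<or> wt x \<in> \<Lambda>" by blast
    have e: "regular g" "act_Sp4 i j g = fscale (wt x) g" using F[OF x(2)] x(1) by
        (simp_all add: eig_def)
    have "act_Sp4 i j g + fscale (- \<mu>) g = fscale (wt x - \<mu>) g"
      unfolding e(2) by (simp add: fun_eq_iff fscale_def algebra_simps)
    moreover have "fscale (wt x - \<mu>) g \<in> ?T"
    proof (cases "wt x = \<mu>")
      case True
      then show ?thesis by (simp add: fscale_simps fun_vs.span_zero)
    next
      case False
      then have "g \<in> F ` {x \<in> I. wt x \<in> \<Lambda>}" using x by blast
      then show ?thesis by (intro fun_vs.span_scale fun_vs.span_base)
    qed
    ultimately show "g \<in> ?S" using e(1) by simp
  qed
  then have "act_Sp4 i j b + fscale (- \<mu>) b \<in> ?T"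
    using fun_vs.span_minimal[OF _ sub] insert.prems(2) by blast
  moreover have "act_Sp4 i j b + fscale (- \<mu>) b = fscale (w - \<mu>) b"
    using insert.prems(3) by (simp add: eig_def fun_eq_iff fscale_def algebra_simps)
  ultimately have "fscale (w - \<mu>) b \<in> ?T" by simp
  then have "fscale (1 / (w - \<mu>)) (fscale (w - \<mu>) b) \<in> ?T" by (rule fun_vs.span_scale)
  moreover have "w - \<mu> \<noteq> 0" using insert.prems(1) by auto
  ultimately have "b \<in> ?T" by (simp add: fscale_simps)
  then show ?case using insert by blast
qed

lemma eig_span_project:
  assumes F: "\<And>x. x \<in> I \<Longrightarrow> eig i j (wt x) (F x)" and fin: "finite (wt ` I)"
    and x: "x \<in> fun_vs.span (F ` I)" "eig i j w x"
  shows "x \<in> fun_vs.span (F ` {y \<in> I. wt y = w})"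
proof -
  let ?\<Lambda> = "wt ` I - {w}"
  have "F ` I = F ` {y \<in> I. wt y = w} \<union> F ` {y \<in> I. wt y \<in> ?\<Lambda>}" by auto
  then obtain a b where ab: "x = a + b" "a \<in> fun_vs.span (F ` {y \<in> I. wt y = w})"
      "b \<in> fun_vs.span (F ` {y \<in> I. wt y \<in> ?\<Lambda>})"
    using x(1) fun_vs.span_Un[of "F ` {y \<in> I. wt y = w}" "F ` {y \<in> I. wt y \<in> ?\<Lambda>}"] by auto
  have "F ` {y \<in> I. wt y = w} \<subseteq> {f. eig i j w f}" using F by auto
  then have "eig i j w a" using fun_vs.span_minimal[OF _ eig_subspace] ab(2) by blast
  then have "eig i j w (x + fscale (- 1) a)" using x(2) by (intro eig_add eig_scale)
  moreover have "x + fscale (- 1) a = b" by (simp add: ab(1) fscale_def fun_eq_iff)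
  ultimately have "eig i j w b" by simp
  then have "b = 0"
    using eig_in_span_other[of I i j wt F ?\<Lambda> w b] F fin ab(3) by auto
  then show ?thesis using ab by simp
qed

subsection \<open>A basis of the highest vectors\<close>

text \<open>The monomials \<open>mon j e k a b q\<close> of degrees \<open>j + e + 2 * k = A\<close> and \<open>a + b + q = B\<close> and of weight
  \<open>A / 2 + \<delta>\<close> are determined by \<open>j\<close>, \<open>q\<close> and \<open>k \<in> KK A B \<delta> j q\<close>. Modulo larger \<open>j\<close> the choice of \<open>k\<close>
  does not matter, by the relation in \<open>mon_relation\<close>. The pair \<open>(j, q)\<close> stands for the diagram with
  \<open>k1 = (j + \<sigma>) / 2\<close> and \<open>k2 = m2 - q\<close>.\<close>

definition KK :: "nat \<Rightarrow> nat \<Rightarrow> int \<Rightarrow> nat \<Rightarrow> nat \<Rightarrow> nat set" where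
  "KK A B \<delta> j q = {k. j + 2 * k \<le> A \<and> 0 \<le> \<delta> + int k \<and> int q + \<delta> + int k \<le> int B}"

definition JJ :: "nat \<Rightarrow> nat \<Rightarrow> int \<Rightarrow> (nat \<times> nat) set" where
  "JJ A B \<delta> = {(j, q). KK A B \<delta> j q \<noteq> {}}"

definition cm :: "nat \<Rightarrow> nat \<Rightarrow> int \<Rightarrow> nat \<Rightarrow> nat \<Rightarrow> nat \<Rightarrow> complex^4^4 \<Rightarrow> complex" where
  "cm A B \<delta> j q k = mon j (A - j - 2 * k) k (nat (\<delta> + int k)) (nat (int B - int q - \<delta> - int k)) q"

definition Vf :: "nat \<Rightarrow> nat \<Rightarrow> int \<Rightarrow> (nat \<Rightarrow> nat \<Rightarrow> nat \<Rightarrow> complex) \<Rightarrow> nat \<times> nat \<Rightarrow> complex^4^4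
    \<Rightarrow> complex" where
  "Vf A B \<delta> cf = (\<lambda>(j, q). \<Sum>k\<in>KK A B \<delta> j q. fscale (cf j q k) (cm A B \<delta> j q k))"

text \<open>Modulo larger \<open>j\<close> all \<open>cm A B \<delta> j q k\<close> with the same
  \<open>j\<close> and \<open>q\<close> coincide, so \<open>Vf\<close> is congruent to this sum of
  coefficients times any of them.\<close>

definition good :: "nat \<Rightarrow> nat \<Rightarrow> int \<Rightarrow> (nat \<Rightarrow> nat \<Rightarrow> nat \<Rightarrow> complex) \<Rightarrow> bool" where
  "good A B \<delta> cf \<longleftrightarrow> (\<forall>j q. KK A B \<delta> j q \<noteq> {} \<longrightarrow> (\<Sum>k\<in>KK A B \<delta> j q. cf j q k) \<noteq> 0)"

lemma finite_KK: "finite (KK A B \<delta> j q)"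
  by (rule finite_subset[of _ "{..A}"]) (auto simp: KK_def)

lemma JJ_bounds: "(j, q) \<in> JJ A B \<delta> \<Longrightarrow> j \<le> A \<and> q \<le> B"
  by (auto simp: JJ_def KK_def)

lemma finite_JJ: "finite (JJ A B \<delta>)"
  by (rule finite_subset[of _ "{..A} \<times> {..B}"]) (auto dest: JJ_bounds)

lemma mon_eq_cm:
  assumes "j + e + 2 * k = A" "a + b + q = B" "int a = \<delta> + int k"
  shows "mon j e k a b q = cm A B \<delta> j q k" "k \<in> KK A B \<delta> j q"
proof -
  have "A - j - 2 * k = e" "nat (\<delta> + int k) = a" "nat (int B - int q - \<delta> - int k) = b"
    using assms by linarith+
  then show "mon j e k a b q = cm A B \<delta> j q k" by (simp add: cm_def)
  show "k \<in> KK A B \<delta> j q" using assms by (auto simp: KK_def)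
qed

lemma cm_exponents:
  assumes "k \<in> KK A B \<delta> j q"
  obtains e a b where "cm A B \<delta> j q k = mon j e k a b q" "j + e + 2 * k = A" "a + b + q = B"
      "int a = \<delta> + int k"
proof (rule that)
  show "cm A B \<delta> j q k = mon j (A - j - 2 * k) k (nat (\<delta> + int k)) (nat (int B - int q - \<delta> - int k)) q"
    by (simp add: cm_def)
qed (use assms in \<open>auto simp: KK_def\<close>)

lemma cm_step:
  assumes "k \<in> KK A B \<delta> j q" "Suc k \<in> KK A B \<delta> j q"
  shows "k \<in> KK A B \<delta> (j + 2) (q + 1)"
    "cm A B \<delta> j q k = cm A B \<delta> j q (Suc k) + fscale (- 1) (cm A B \<delta> (j + 2) (q + 1) k)"
proof -
  define e a b where "e = A - j - 2 * k - 2" and "a = nat (\<delta> + int k)" and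
      "b = nat (int B - int q - \<delta> - int k - 1)"
  have s: "j + (e + 2) + 2 * k = A" "a + (b + 1) + q = B" "int a = \<delta> + int k"
    using assms by (auto simp: KK_def e_def a_def b_def)
  have "mon j (e + 2) k a (b + 1) q = cm A B \<delta> j q k"
    by (rule mon_eq_cm) (use s in auto)
  moreover have "mon j e (k + 1) (a + 1) b q = cm A B \<delta> j q (k + 1)"
    by (rule mon_eq_cm) (use s in auto)
  moreover have "mon (j + 2) e k a b (q + 1) = cm A B \<delta> (j + 2) (q + 1) k"
    by (rule mon_eq_cm) (use s in auto)
  ultimately show "cm A B \<delta> j q k = cm A B \<delta> j q (Suc k) + fscale (- 1) (cm A B \<delta> (j + 2) (q + 1) k)"
    using mon_relation[of j e k a b q] by simp
  show "k \<in> KK A B \<delta> (j + 2) (q + 1)"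
    by (rule mon_eq_cm(2)[of _ e _ _ a b]) (use s in auto)
qed

text \<open>Induction from large \<open>j\<close> downwards. Two monomials with the same
  \<open>j\<close> and \<open>q\<close> differ by a telescoping sum of monomials with exponents
  \<open>j + 2\<close> and \<open>q + 1\<close>, already in the span; hence \<open>Vf\<close> minus
  such differences is a nonzero multiple of the given monomial.\<close>

lemma cm_in_span:
  assumes good: "good A B \<delta> cf" and "k \<in> KK A B \<delta> j q"
  shows "cm A B \<delta> j q k \<in> fun_vs.span (Vf A B \<delta> cf ` JJ A B \<delta>)"
  using assms(2)
proof (induction "A - j" arbitrary: j q k rule: less_induct)
  case less
  let ?T = "fun_vs.span (Vf A B \<delta> cf ` JJ A B \<delta>)"
  let ?m = "cm A B \<delta> j q" and ?K = "KK A B \<delta> j q"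
  have step: "?m n + fscale (- 1) (?m (Suc n)) \<in> ?T" if "n \<in> ?K" "Suc n \<in> ?K" for n
  proof -
    note s = cm_step[OF that]
    have "A - (j + 2) < A - j" using that(2) by (auto simp: KK_def)
    then have "cm A B \<delta> (j + 2) (q + 1) n \<in> ?T" by (rule less.hyps[OF _ s(1)])
    then have "fscale (- 1) (cm A B \<delta> (j + 2) (q + 1) n) \<in> ?T" by (rule fun_vs.span_scale)
    moreover have "?m n + fscale (- 1) (?m (Suc n)) = fscale (- 1) (cm A B \<delta> (j + 2) (q + 1) n)"
      unfolding s(2) by (simp add: fscale_def fun_eq_iff)
    ultimately show ?thesis by simp
  qed
  have up: "?m n + fscale (- 1) (?m n') \<in> ?T" if "n \<le> n'" "n \<in> ?K" "n' \<in> ?K" for n n'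
    using that
  proof (induction n' rule: dec_induct)
    case base
    have "?m n + fscale (- 1) (?m n) = 0" by (simp add: fscale_def fun_eq_iff)
    then show "?m n + fscale (- 1) (?m n) \<in> ?T" by (metis fun_vs.span_zero)
  next
    case (step r)
    \<comment> \<open>The set \<open>KK A B \<delta> j q\<close> is an interval.\<close>
    have r: "r \<in> ?K" using step by (auto simp: KK_def)
    have "?m n + fscale (- 1) (?m r) \<in> ?T" "?m r + fscale (- 1) (?m (Suc r)) \<in> ?T"
      using step.IH[OF step.prems(1) r] \<open>\<And>n. n \<in> ?K \<Longrightarrow> Suc n \<in> ?K \<Longrightarrow> _ \<in> ?T\<close>[OF r step.prems(2)] .
    then have "(?m n + fscale (- 1) (?m r)) + (?m r + fscale (- 1) (?m (Suc r))) \<in> ?T" by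
        (rule fun_vs.span_add)
    moreover have "(?m n + fscale (- 1) (?m r)) + (?m r + fscale (- 1) (?m (Suc r)))
        = ?m n + fscale (- 1) (?m (Suc r))"
      by (simp add: fscale_def fun_eq_iff)
    ultimately show "?m n + fscale (- 1) (?m (Suc r)) \<in> ?T" by (simp only:)
  qed
  have diff: "?m n + fscale (- 1) (?m k) \<in> ?T" if "n \<in> ?K" for n
  proof (cases "n \<le> k")
    case True
    then show ?thesis by (rule up[OF _ that less.prems])
  next
    case False
    then have "fscale (- 1) (?m k + fscale (- 1) (?m n)) \<in> ?T"
      by (intro fun_vs.span_scale up less.prems that) simp
    moreover have "fscale (- 1) (?m k + fscale (- 1) (?m n)) = ?m n + fscale (- 1) (?m k)"
      by (simp add: fscale_def fun_eq_iff)
    ultimately show ?thesis by (simp only:)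
  qed
  let ?c = "\<Sum>n\<in>?K. cf j q n"
  have "Vf A B \<delta> cf (j, q) \<in> ?T"
    using less.prems by (intro fun_vs.span_base imageI) (auto simp: JJ_def)
  moreover have "(\<Sum>n\<in>?K. fscale (- cf j q n) (?m n + fscale (- 1) (?m k))) \<in> ?T"
    by (intro fun_vs.span_sum fun_vs.span_scale diff)
  ultimately have "Vf A B \<delta> cf (j, q) + (\<Sum>n\<in>?K. fscale (- cf j q n) (?m n + fscale (- 1) (?m k))) \<in> ?T"
    by (rule fun_vs.span_add)
  moreover have "Vf A B \<delta> cf (j, q) + (\<Sum>n\<in>?K. fscale (- cf j q n) (?m n + fscale (- 1) (?m k)))
      = fscale ?c (?m k)"
    by (simp add: Vf_def fun_eq_iff sum_fun_apply fscale_def sum_distrib_right flip: sum.distrib)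
       (simp add: algebra_simps)
  ultimately have "fscale ?c (?m k) \<in> ?T" by simp
  then have "fscale (1 / ?c) (fscale ?c (?m k)) \<in> ?T" by (rule fun_vs.span_scale)
  moreover have "?c \<noteq> 0" using good less.prems by (auto simp: good_def)
  ultimately show "?m k \<in> ?T" by (simp add: fscale_simps)
qed

text \<open>Points with \<open>h$1$1 = 0\<close> at which the other invariants take the value 1, except for
  \<open>pl h 2 4 = z\<close>.\<close>

definition hd_pt :: "complex \<Rightarrow> complex^4^4" where
  "hd_pt z = vector [vector [0, 1, 1, 0], vector [- 1, 0, 0, z], vector [0, 0, 0, - 1], vector [0,
      0, 1, 0]]"

lemma hd_pt_Sp4: "hd_pt z \<in> Sp4"
  by (simp add: Sp4_def hd_pt_def mat4_eq_iff symp_mat_vector matrix_mult_entry sum_4 transpose_def)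

lemma mval_hd_pt: "mval 0 e k a b q (hd_pt z) = z ^ q"
  by (simp add: mval_def hd_pt_def yv_def pl_def)

lemma Vf_factor:
  assumes "h \<in> Sp4"
  shows "Vf A B \<delta> cf (j, q) h = h$1$1 ^ j * (\<Sum>k\<in>KK A B \<delta> j q. cf j q k *
     mval 0 (A - j - 2 * k) k (nat (\<delta> + int k)) (nat (int B - int q - \<delta> - int k)) q h)"
  using assms
  by (simp add: Vf_def sum_fun_apply cm_def mon_def on_group_def fscale_def sum_distrib_left)
     (intro sum.cong refl, simp add: mval_def mult_ac)

text \<open>Once the terms below \<open>j\<close> are known to vanish, \<open>h$1$1 ^ j\<close> can be cancelled; at \<open>hd_pt z\<close> the
  identity then becomes the vanishing of a polynomial in \<open>z\<close> whose coefficients are the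
  \<open>c (j, q)\<close> times nonzero constants.\<close>

lemma leading_coefficients_vanish:
  assumes good: "good A B \<delta> cf" and f: "regular f"
    and eq: "\<And>h. h \<in> Sp4 \<Longrightarrow> h$1$1 ^ L * f h = (\<Sum>i\<in>JJ A B \<delta>. c i * Vf A B \<delta> cf i h)"
    and jq: "(j, q) \<in> JJ A B \<delta>" "j < L"
  shows "c (j, q) = 0"
  using jq
proof (induction j arbitrary: q rule: less_induct)
  case (less j)
  let ?J = "JJ A B \<delta>"
  obtain Q where Q: "polynomial_fun Q" "f = res Q" using f by (rule regularE)
  define U where "U = (\<lambda>j q h. \<Sum>k\<in>KK A B \<delta> j q. cf j q k *
     mval 0 (A - j - 2 * k) k (nat (\<delta> + int k)) (nat (int B - int q - \<delta> - int k)) q h)"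
  have U: "Vf A B \<delta> cf (j, q) h = h$1$1 ^ j * U j q h" if "h \<in> Sp4" for j q h
    using Vf_factor[OF that] by (simp add: U_def)
  \<comment> \<open>The identity divided by \<open>h$1$1 ^ j\<close>. The case distinction drops the
    terms below \<open>j\<close>, where the truncated difference of exponents would be
    wrong.\<close>
  define P where "P = (\<lambda>h :: complex^4^4. h$1$1 ^ (L - j) * Q h
     - (\<Sum>i\<in>?J. if fst i < j then 0 else c i * (h$1$1 ^ (fst i - j) * U (fst i) (snd i) h)))"
  have pU: "polynomial_fun (U j q)" for j q
    unfolding U_def by (intro polynomial_fun_intros polynomial_fun_mval)
  have pif: "polynomial_fun (\<lambda>h. if b then 0 else F h)" if "polynomial_fun F" for b and F ::
      "complex^4^4 \<Rightarrow> complex"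
    using that by (cases b) (auto intro: polynomial_fun.intros)
  have pP: "polynomial_fun P"
    unfolding P_def by (intro polynomial_fun_diff polynomial_fun_intros(4)
        polynomial_fun_sum pif polynomial_fun_power
        polynomial_fun.intros(1,2) Q(1) pU)
  have P0: "P h = 0" if h: "h \<in> Sp4" for h
  proof (rule Sp4_cancel_power[OF pP _ h, of j])
    fix h :: "complex^4^4" assume h: "h \<in> Sp4"
    have "h$1$1 ^ j * (if fst i < j then 0 else c i * (h$1$1 ^ (fst i - j) * U (fst i) (snd i) h))
        = c i * Vf A B \<delta> cf i h"
      if "i \<in> ?J" for i
    proof (cases "fst i < j")
      case True
      then have "c i = 0" using less.IH[of "fst i" "snd i"] less.prems that by simp
      then show ?thesis using True by simp
    next
      case False
      have "Vf A B \<delta> cf i h = h$1$1 ^ fst i * U (fst i) (snd i) h" using U[OF h, of "fst i"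
          "snd i"] by simp
      moreover have "h$1$1 ^ fst i = h$1$1 ^ j * h$1$1 ^ (fst i - j)" using False by
          (simp flip: power_add)
      ultimately show ?thesis using False by simp
    qed
    then have "h$1$1 ^ j * (\<Sum>i\<in>?J. if fst i < j then 0 else c i * (h$1$1 ^ (fst i - j) * U (fst i)
        (snd i) h))
      = h$1$1 ^ L * f h"
      unfolding eq[OF h] sum_distrib_left by (intro sum.cong) auto
    moreover have "h$1$1 ^ j * (h$1$1 ^ (L - j) * Q h) = h$1$1 ^ L * f h"
      using less.prems(2) h by (simp add: Q(2) on_group_def flip: power_add mult.assoc)
    ultimately show "h$1$1 ^ j * P h = 0" unfolding P_def by (simp add: right_diff_distrib)
  qed
  define C where "C = (\<lambda>j q. \<Sum>k\<in>KK A B \<delta> j q. cf j q k)"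
  have UC: "U j q (hd_pt z) = C j q * z ^ q" for j q z
    by (simp add: U_def mval_hd_pt C_def sum_distrib_right)
  have z: "hd_pt z $ 1 $ 1 = 0" for z by (simp add: hd_pt_def)
  define p where "p = (\<Sum>i\<in>?J. if fst i = j then monom (c i * C (fst i) (snd i)) (snd i) else 0)"
  have "poly p z = 0" for z
  proof -
    have "(if fst i < j then 0 else c i * (hd_pt z $ 1 $ 1 ^ (fst i - j) * U (fst i) (snd i) (hd_pt z)))
      = poly (if fst i = j then monom (c i * C (fst i) (snd i)) (snd i) else 0) z" for i
      by (auto simp: z UC poly_monom power_0_left)
    \<comment> \<open>Since \<open>j < L\<close>, the term with \<open>Q\<close> still contains a
      factor \<open>h$1$1\<close> and vanishes at these points.\<close>
    then have "P (hd_pt z) = - poly p z"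
      using less.prems(2) by (simp add: P_def p_def poly_sum z)
    then show ?thesis using P0[OF hd_pt_Sp4, of z] by simp
  qed
  then have "p = 0" by (simp add: poly_all_0_iff_0[symmetric])
  then have "coeff p q = 0" by simp
  moreover have "coeff p q = (\<Sum>i\<in>?J. if i = (j, q) then c (j, q) * C j q else 0)"
    unfolding p_def coeff_sum by (intro sum.cong refl) (auto simp: prod_eq_iff)
  moreover have "\<dots> = c (j, q) * C j q"
    using less.prems(1) finite_JJ[of A B \<delta>] by simp
  moreover have "C j q \<noteq> 0"
    using good less.prems(1) by (auto simp: C_def good_def JJ_def)
  ultimately show ?case by simp
qed

lemma span_image_coefficients:
  assumes "finite I" "x \<in> fun_vs.span (F ` I)"
  obtains c where "x = (\<Sum>i\<in>I. fscale (c i) (F i))"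
proof -
  let ?S = "{x. \<exists>c. x = (\<Sum>i\<in>I. fscale (c i) (F i))}"
  have "fun_vs.subspace ?S"
  proof (rule fun_vs.subspaceI)
    show "0 \<in> ?S"
      by (intro CollectI exI[of _ "\<lambda>_. 0"]) (simp add: fscale_simps)
  next
    fix x y assume "x \<in> ?S" "y \<in> ?S"
    then obtain c d where "x = (\<Sum>i\<in>I. fscale (c i) (F i))" "y = (\<Sum>i\<in>I. fscale (d i) (F i))" by blast
    then show "x + y \<in> ?S"
      by (intro CollectI exI[of _ "\<lambda>i. c i + d i"]) (simp only: fscale_simps(5) sum.distrib)
  next
    fix a x assume "x \<in> ?S"
    then obtain c where "x = (\<Sum>i\<in>I. fscale (c i) (F i))" by blast
    then show "fscale a x \<in> ?S"
      by (intro CollectI exI[of _ "\<lambda>i. a * c i"]) (simp only: fun_vs.scale_sum_right fscale_simps(2))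
  qed
  moreover have "F ` I \<subseteq> ?S"
  proof
    fix x assume "x \<in> F ` I"
    then obtain i where i: "i \<in> I" "x = F i" by blast
    have "(\<Sum>l\<in>I. fscale (if l = i then 1 else 0) (F l)) = (\<Sum>l\<in>I. if l = i then F i else 0)"
      by (intro sum.cong refl) (simp add: fscale_simps)
    also have "\<dots> = x" using i assms(1) by simp
    finally show "x \<in> ?S" by (intro CollectI exI[of _ "\<lambda>l. if l = i then 1 else 0"]) simp
  qed
  ultimately have "x \<in> ?S"
    using fun_vs.span_minimal assms(2) by blast
  then show ?thesis using that by blast
qed

lemma regular_Vf: "regular (Vf A B \<delta> cf i)"
proof -
  have "Vf A B \<delta> cf i \<in> {f. regular f}"
    unfolding Vf_def cm_def split_beta
    by (intro fun_vs.subspace_sum[OF subspace_regular]) (simp add: regular_scale regular_mon)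
  then show ?thesis by simp
qed

lemma Vf_independent:
  assumes "good A B \<delta> cf" "(\<Sum>i\<in>JJ A B \<delta>. fscale (c i) (Vf A B \<delta> cf i)) = 0" "i \<in> JJ A B \<delta>"
  shows "c i = 0"
proof -
  obtain j q where i: "i = (j, q)" by (cases i)
  have "(\<Sum>i\<in>JJ A B \<delta>. c i * Vf A B \<delta> cf i h) = 0" for h
    using fun_cong[OF assms(2), of h] by (simp add: sum_fun_apply fscale_def)
  then show ?thesis
    unfolding i
    \<comment> \<open>With zero on the left, any exponent above \<open>j\<close> will do.\<close>
    by (intro leading_coefficients_vanish[OF assms(1) regular_zero, of
        "Suc j"]) (use assms(3) i in simp_all)
qed

section \<open>Expansion of the highest vectors of a given weight\<close>

definition Mon_weight :: "nat \<Rightarrow> nat \<Rightarrow> complex \<Rightarrow> (complex^4^4 \<Rightarrow> complex) set" where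
  "Mon_weight A B w = {mon j e k a b q | j e k a b q.
     j + e + 2 * k = A \<and> a + b + q = B \<and> (of_nat j + of_nat e) / 2 + of_nat a = w}"

lemma monomials_of_weight:
  assumes "x \<in> fun_vs.span (Mon A B)" "eig (-2) (-2) w x"
  shows "x \<in> fun_vs.span (Mon_weight A B w)"
proof -
  define I where "I = {(j, e, k, a, b, q). j + e + 2 * k = A \<and> a + b + q = B}"
  define F where "F = (\<lambda>(j, e, k, a, b, q). mon j e k a b q)"
  define wt :: "nat \<times> nat \<times> nat \<times> nat \<times> nat \<times> nat \<Rightarrow> complex" where
    "wt = (\<lambda>(j, e, k, a, b, q). (of_nat j + of_nat e) / 2 + of_nat a)"
  have "I \<subseteq> {..A} \<times> {..A} \<times> {..A} \<times> {..B} \<times> {..B} \<times> {..B}" by (auto simp: I_def)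
  then have "finite I" by (rule finite_subset) auto
  moreover have "x \<in> fun_vs.span (F ` I)"
  proof (rule subsetD[OF fun_vs.span_mono assms(1)], rule subsetI)
    fix s assume "s \<in> Mon A B"
    then obtain j e k a b q where "s = mon j e k a b q" "j + e + 2 * k = A" "a + b + q = B"
      unfolding Mon_def by blast
    then show "s \<in> F ` I" by (intro image_eqI[of _ _ "(j, e, k, a, b, q)"]) (simp_all add: F_def I_def)
  qed
  moreover have "eig (-2) (-2) (wt y) (F y)" for y
    by (cases y) (simp add: wt_def F_def eig_mon_minus2)
  ultimately have "x \<in> fun_vs.span (F ` {y \<in> I. wt y = w})"
    using assms(2) by (intro eig_span_project) auto
  moreover have "F ` {y \<in> I. wt y = w} \<subseteq> Mon_weight A B w"
  proof
    fix s assume "s \<in> F ` {y \<in> I. wt y = w}"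
    then obtain y where y: "s = F y" "y \<in> I" "wt y = w" by blast
    obtain j e k a b q where "y = (j, e, k, a, b, q)" by (cases y)
    then have "s = mon j e k a b q" "j + e + 2 * k = A" "a + b + q = B"
        "(of_nat j + of_nat e) / 2 + of_nat a = w"
      using y by (simp_all add: F_def I_def wt_def)
    then show "s \<in> Mon_weight A B w" unfolding Mon_weight_def by blast
  qed
  ultimately show ?thesis using fun_vs.span_mono by blast
qed

lemma highest_monomials:
  assumes f: "f \<in> W N M" "act_Sp4 (-2) 0 f = 0" "act_Sp4 (-2) (-2) f = fscale w f"
  shows "res (\<lambda>h. h$1$1 ^ (N + 2 * M)) * f \<in> fun_vs.span (Mon_weight (2 * N + 2 * M) M (of_nat
      (N + 2 * M) / 2 + w))"
proof (rule monomials_of_weight[OF annihilated_span_Mon[OF f(1,2)]])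
  have "eig (-2) (-2) (of_nat (N + 2 * M) / 2) (res (\<lambda>h. h$1$1 ^ (N + 2 * M)))"
    using eig_mon_minus2[of "N + 2 * M" 0 0 0 0 0] unfolding mon_def mval_def by simp
  then show "eig (-2) (-2) (of_nat (N + 2 * M) / 2 + w) (res (\<lambda>h. h$1$1 ^ (N + 2 * M)) * f)"
    by (rule eig_mult) (use f W_regular in \<open>simp add: eig_def\<close>)
qed

text \<open>Here \<open>j + e\<close> has been replaced by 2N + 2M - 2k. Up to the shift N/2 the
  weight is then the difference of the exponents of p12 and y, an integer.\<close>

lemma weight_arith:
  fixes n m k a w :: complex
  assumes "(2 * n + 2 * m - 2 * k) / 2 + a = (n + 2 * m) / 2 + w"
  shows "w - n / 2 = a - k"
proof -
  have w: "w = (2 * n + 2 * m - 2 * k) / 2 + a - (n + 2 * m) / 2" using assms by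
      (simp add: algebra_simps)
  show ?thesis unfolding w by (simp add: field_simps)
qed

text \<open>Since the weight \<open>s\<close> is an arbitrary real number, the weights of the wrong
  type have to be excluded; for them no monomial is left in the expansion.\<close>

lemma highest_weight_integral:
  assumes f: "f \<in> W N M" "act_Sp4 (-2) 0 f = 0" "act_Sp4 (-2) (-2) f = fscale w f"
    and w: "w - of_nat N / 2 \<notin> \<int>"
  shows "f = 0"
proof -
  have empty: "Mon_weight (2 * N + 2 * M) M (of_nat (N + 2 * M) / 2 + w) = {}"
  proof -
    have False if "j + e + 2 * k = 2 * N + 2 * M" "(of_nat j + of_nat e) / 2 + of_nat a = of_nat
        (N + 2 * M) / 2 + w" for j e k a
    proof -
      have "(of_nat (j + e + 2 * k) :: complex) = of_nat (2 * N + 2 * M)" by (simp only: that(1))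
      then have "of_nat j + of_nat e = (2 * of_nat N + 2 * of_nat M - 2 * of_nat k :: complex)"
        by (simp add: eq_diff_eq add.assoc)
      from weight_arith[OF that(2)[unfolded this of_nat_add of_nat_mult of_nat_numeral]]
      have "w - of_nat N / 2 = of_int (int a - int k)" by simp
      then show False using w by (metis Ints_of_int)
    qed
    then show ?thesis unfolding Mon_weight_def by blast
  qed
  then have e: "res (\<lambda>h. h$1$1 ^ (N + 2 * M)) * f = 0"
    using highest_monomials[OF f] unfolding empty fun_vs.span_empty by blast
  have "h$1$1 ^ (N + 2 * M) * f h = 0" if "h \<in> Sp4" for h
  proof -
    have "(res (\<lambda>h. h$1$1 ^ (N + 2 * M)) * f) h = 0" by (simp only: e zero_fun_apply)
    then show ?thesis using that by (simp add: on_group_def)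
  qed
  then show ?thesis by (rule regular_cancel_power[OF W_regular[OF f(1)]])
qed

text \<open>Multiplied by x1^L, the vector expands in the functions
  \<open>Vf A M \<delta> cf'\<close> of the larger degree \<open>A = N + L\<close>. Divisibility by
  x1^L kills the coefficients with \<open>j < L\<close>; the other functions are x1^L times those of
  degree \<open>N\<close>, so the power can be cancelled.\<close>

lemma highest_span_Vf:
  assumes good: "good N M \<delta> cf"
    and f: "f \<in> W N M" "act_Sp4 (-2) 0 f = 0" "act_Sp4 (-2) (-2) f = fscale (of_nat N / 2 + of_int \<delta>) f"
  shows "f \<in> fun_vs.span (Vf N M \<delta> cf ` JJ N M \<delta>)"
proof -
  define L where "L = N + 2 * M"
  define A where "A = 2 * N + 2 * M"
  have AL: "A = N + L" by (simp add: A_def L_def)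
  \<comment> \<open>Below \<open>L\<close> any coefficients with nonzero sums would serve. From
    \<open>L\<close> on they are the shifted \<open>cf\<close>, because the admissible
    \<open>k\<close> depend on \<open>A\<close> and \<open>j\<close> only through their
    difference.\<close>
  define cf' where "cf' = (\<lambda>j q k. if j < L then 1 else cf (j - L) q k)"
  have KK': "KK A M \<delta> (j + L) q = KK N M \<delta> j q" for j q
    by (auto simp: KK_def AL)
  have good': "good A M \<delta> cf'"
    unfolding good_def
  proof (intro allI impI)
    fix j q assume ne: "KK A M \<delta> j q \<noteq> {}"
    show "(\<Sum>k\<in>KK A M \<delta> j q. cf' j q k) \<noteq> 0"
    proof (cases "j < L")
      case True
      then show ?thesis using ne finite_KK by (simp add: cf'_def)
    next
      case False
      then obtain i where i: "j = i + L" by (metis le_add_diff_inverse2 not_less)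
      then show ?thesis using good ne by (simp add: KK' cf'_def good_def)
    qed
  qed
  have V': "Vf A M \<delta> cf' (j + L, q) h = h$1$1 ^ L * Vf N M \<delta> cf (j, q) h" if "h \<in> Sp4" for j q h
    unfolding Vf_factor[OF that] KK' by (simp add: cf'_def AL power_add mult_ac)
  have "res (\<lambda>h. h$1$1 ^ L) * f \<in> fun_vs.span (Vf A M \<delta> cf' ` JJ A M \<delta>)"
  proof (rule span_set_mult_mono)
    show "res (\<lambda>h. h$1$1 ^ L) * f \<in> fun_vs.span (Mon_weight (2 * N + 2 * M) M (of_nat (N + 2 * M)
        / 2 + (of_nat N / 2 + complex_of_int \<delta>)))"
      unfolding L_def by (rule highest_monomials[OF f])
    fix s assume "s \<in> Mon_weight (2 * N + 2 * M) M (of_nat (N + 2 * M) / 2 +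
        (of_nat N / 2 + complex_of_int \<delta>))"
    then obtain j e k a b q where s: "s = mon j e k a b q" "j + e + 2 * k = A" "a + b + q = M"
      "(of_nat j + of_nat e) / 2 + of_nat a = of_nat (N + 2 * M) / 2 +
          (of_nat N / 2 + complex_of_int \<delta>)"
      unfolding A_def Mon_weight_def by blast
    have "(of_nat (j + e + 2 * k) :: complex) = of_nat A" by (simp only: s(2))
    then have "of_nat j + of_nat e = (2 * of_nat N + 2 * of_nat M - 2 * of_nat k :: complex)"
      by (simp add: A_def eq_diff_eq add.assoc)
    from weight_arith[OF s(4)[unfolded this of_nat_add of_nat_mult of_nat_numeral]]
    have "(of_int (int a) :: complex) = of_int (\<delta> + int k)" by simp
    then have "int a = \<delta> + int k" by (simp only: of_int_eq_iff)
    note m = mon_eq_cm[OF s(2,3) this]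
    show "s \<in> fun_vs.span (Vf A M \<delta> cf' ` JJ A M \<delta>)"
      unfolding s(1) m(1) by (rule cm_in_span[OF good' m(2)])
  qed
  then obtain c where c: "res (\<lambda>h. h$1$1 ^ L) * f = (\<Sum>i\<in>JJ A M \<delta>. fscale (c i) (Vf A M \<delta> cf' i))"
    by (rule span_image_coefficients[OF finite_JJ])
  have eq: "h$1$1 ^ L * f h = (\<Sum>i\<in>JJ A M \<delta>. c i * Vf A M \<delta> cf' i h)" if "h \<in> Sp4" for h
    using fun_cong[OF c, of h] that by (simp add: sum_fun_apply fscale_def on_group_def)
  have c0: "c i = 0" if "i \<in> JJ A M \<delta>" "fst i < L" for i
    using leading_coefficients_vanish[OF good' W_regular[OF f(1)] eq, of "fst i" "snd i"] that by simp
  let ?g = "\<Sum>i\<in>JJ N M \<delta>. fscale (c (fst i + L, snd i)) (Vf N M \<delta> cf i)"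
  have "f + fscale (- 1) ?g = 0"
  proof (rule regular_cancel_power[of _ L])
    show "regular (f + fscale (- 1) ?g)"
      by (intro regular_add regular_scale W_regular[OF f(1)] fun_vs.subspace_sum[OF
          subspace_regular, simplified] regular_Vf)
    fix h :: "complex^4^4" assume h: "h \<in> Sp4"
    have "h$1$1 ^ L * f h = (\<Sum>i\<in>{i \<in> JJ A M \<delta>. L \<le> fst i}. c i * Vf A M \<delta> cf' i h)"
      unfolding eq[OF h]
    proof (rule sum.mono_neutral_right[OF finite_JJ])
      show "\<forall>i\<in>JJ A M \<delta> - {i \<in> JJ A M \<delta>. L \<le> fst i}. c i * Vf A M \<delta> cf' i h = 0"
        using c0 by (metis (mono_tags, lifting) DiffE mem_Collect_eq mult_zero_left not_le)
    qed auto
    also have "\<dots> = (\<Sum>i\<in>JJ N M \<delta>. c (fst i + L, snd i) * Vf A M \<delta> cf' (fst i + L, snd i) h)"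
    proof (rule sum.reindex_bij_witness[of _ "\<lambda>i. (fst i + L, snd i)" "\<lambda>i. (fst i - L, snd i)"])
      fix i assume i: "i \<in> {i \<in> JJ A M \<delta>. L \<le> fst i}"
      then obtain j where "fst i = j + L" by (metis (mono_tags, lifting)
          le_add_diff_inverse2 mem_Collect_eq)
      then show "(fst i - L, snd i) \<in> JJ N M \<delta>" "(fst (fst i - L, snd i) + L, snd (fst i - L,
          snd i)) = i"
        using i KK'[of j "snd i"] by (auto simp: JJ_def prod_eq_iff)
      then show "c (fst (fst i - L, snd i) + L, snd (fst i - L, snd i)) * Vf A M \<delta> cf' (fst
          (fst i - L, snd i) + L, snd (fst i - L, snd i)) h
          = c i * Vf A M \<delta> cf' i h" by simp
    next
      fix i assume "i \<in> JJ N M \<delta>"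
      then show "(fst (fst i + L, snd i) - L, snd (fst i + L, snd i)) = i"
          "(fst i + L, snd i) \<in> {i \<in> JJ A M \<delta>. L \<le> fst i}"
        using KK'[of "fst i" "snd i"] by (auto simp: JJ_def)
    qed
    also have "\<dots> = h$1$1 ^ L * ?g h"
      by (simp add: V'[OF h] sum_fun_apply fscale_def sum_distrib_left mult_ac)
    finally show "h$1$1 ^ L * (f + fscale (- 1) ?g) h = 0"
      by (simp add: fscale_def ring_distribs)
  qed
  then have "f = ?g" by (simp add: fun_eq_iff fscale_def)
  moreover have "?g \<in> fun_vs.span (Vf N M \<delta> cf ` JJ N M \<delta>)"
    by (intro fun_vs.span_sum fun_vs.span_scale fun_vs.span_base imageI)
  ultimately show ?thesis by simp
qed

section \<open>The functions as highest vectors, and their weights\<close>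

lemma Vf_W: "Vf N M \<delta> cf i \<in> W N M"
proof -
  obtain j q where i: "i = (j, q)" by (cases i)
  have "cm N M \<delta> j q k \<in> W N M" if k: "k \<in> KK N M \<delta> j q" for k
  proof -
    obtain e a b where "cm N M \<delta> j q k = mon j e k a b q" "j + e + 2 * k = N" "a + b + q = M"
      by (rule cm_exponents[OF k])
    then show ?thesis using mon_W[of j e k a b q] by simp
  qed
  then show ?thesis
    unfolding i Vf_def split by (intro fun_vs.subspace_sum[OF W_subspace] fun_vs.subspace_scale[OF
        W_subspace])
qed

lemma Vf_annihilated: "act_Sp4 (-2) 0 (Vf N M \<delta> cf i) = 0"
proof -
  obtain j q where i: "i = (j, q)" by (cases i)
  have "eig (-2) 0 0 (Vf N M \<delta> cf i)"
    unfolding i Vf_def split by (intro eig_sum eig_scale) (simp add: cm_def eig_mon_annihilated)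
  then show ?thesis by (simp add: eig_def fscale_simps)
qed

lemma Vf_weight_minus2: "act_Sp4 (-2) (-2) (Vf N M \<delta> cf i) = fscale (of_nat N / 2 + of_int \<delta>)
    (Vf N M \<delta> cf i)"
proof -
  obtain j q where i: "i = (j, q)" by (cases i)
  have "eig (-2) (-2) (of_nat N / 2 + of_int \<delta>) (cm N M \<delta> j q k)" if k: "k \<in> KK N M \<delta> j q" for k
  proof -
    obtain e a b where m: "cm N M \<delta> j q k = mon j e k a b q" "j + e + 2 * k = N" "int a = \<delta> + int k"
      by (rule cm_exponents[OF k])
    have w: "(of_nat j + of_nat e) / 2 + of_nat a = (of_nat N / 2 + of_int \<delta> :: complex)"
    proof -
      have d: "of_int \<delta> = (of_nat a - of_nat k :: complex)"
        using arg_cong[OF m(3), of "of_int :: int \<Rightarrow> complex"] by simp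
      show ?thesis unfolding d m(2)[symmetric] by (simp add: field_simps)
    qed
    show ?thesis unfolding m(1) w[symmetric] by (rule eig_mon_minus2)
  qed
  then have "eig (-2) (-2) (of_nat N / 2 + of_int \<delta>) (Vf N M \<delta> cf i)"
    unfolding i Vf_def split by (intro eig_sum eig_scale)
  then show ?thesis by (simp add: eig_def)
qed

lemma Vf_weight_minus1:
  "act_Sp4 (-1) (-1) (Vf N M \<delta> cf (j, q))
    = fscale (of_nat j - of_nat N / 2 + of_nat M - of_int \<delta> - 2 * of_nat q) (Vf N M \<delta> cf (j, q))"
proof -
  have "eig (-1) (-1) (of_nat j - of_nat N / 2 + of_nat M - of_int \<delta> - 2 * of_nat q) (cm N M \<delta> j q k)"
    if k: "k \<in> KK N M \<delta> j q" for k
  proof -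
    obtain e a b where m: "cm N M \<delta> j q k = mon j e k a b q" "j + e + 2 * k = N" "a + b + q = M"
        "int a = \<delta> + int k"
      by (rule cm_exponents[OF k])
    have w: "(of_nat j - of_nat e) / 2 + of_nat b - of_nat q
      = (of_nat j - of_nat N / 2 + of_nat M - of_int \<delta> - 2 * of_nat q :: complex)"
    proof -
      have d: "of_int \<delta> = (of_nat a - of_nat k :: complex)"
        using arg_cong[OF m(4), of "of_int :: int \<Rightarrow> complex"] by simp
      show ?thesis unfolding d m(2,3)[symmetric] by (simp add: field_simps)
    qed
    show ?thesis unfolding m(1) w[symmetric] by (rule eig_mon_minus1)
  qed
  then have "eig (-1) (-1) (of_nat j - of_nat N / 2 + of_nat M - of_int \<delta> - 2 * of_nat q)
      (Vf N M \<delta> cf (j, q))"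
    unfolding Vf_def split by (intro eig_sum eig_scale)
  then show ?thesis by (simp add: eig_def)
qed

subsection \<open>The Gamma-series as a finite sum\<close>

lemma exists_4: "(\<exists>i::4. P i) \<longleftrightarrow> P 1 \<or> P 2 \<or> P 3 \<or> P 4"
  using forall_4[of "\<lambda>i. \<not> P i"] by blast

lemma prod_4: "(\<Prod>i\<in>(UNIV :: 4 set). f i) = f 1 * f 2 * f 3 * f 4" for f :: "4 \<Rightarrow> 'a::comm_monoid_mult"
  unfolding UNIV_4
  by (simp only: prod.insert prod.empty finite.intros insert_iff empty_iff index4_distinct simp_thms
      mult.assoc mult_1_right)

lemma Gamma_of_int_fact: "n \<ge> 0 \<Longrightarrow> Gamma (of_int (n + 1) :: complex) = fact (nat n)"
  using Gamma_fact[of "nat n", where 'a = complex] by (simp add: add.commute)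

text \<open>The fourth component of the shifted lattice vector is \<open>k\<close> itself, so only
  natural \<open>k\<close> contribute, and the second component bounds them by
  \<open>g2\<close>.\<close>

lemma Gamma_hyp_series_B1:
  fixes g1 g2 g3 :: int and z1 z2 z3 z4 :: complex
  defines "K \<equiv> {k::nat. 0 \<le> g1 + int k \<and> int k \<le> g2 \<and> int k \<le> g3}"
  shows "Gamma_hyp_series (vector [g1, g2, g3, 0]) (vector [z1, z2, z3, z4]) lattice_B1
    = (\<Sum>k\<in>K. z1 ^ nat (g1 + int k) * z2 ^ nat (g2 - int k) * z3 ^ nat (g3 - int k) * z4 ^ k /
        (fact (nat (g1 + int k)) * fact (nat (g2 - int k)) * fact (nat (g3 - int k)) * fact k))"
proof -
  define v :: "int \<Rightarrow> int^4" where "v = (\<lambda>k. k *s vector [1, -1, -1, 1])"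
  define t where "t = (\<lambda>u :: int^4. if \<exists>i. u $ i + vector [g1, g2, g3, 0] $ i < 0 then 0
     else (\<Prod>i\<in>UNIV. vector [z1, z2, z3, z4] $ i powi (u $ i + vector [g1, g2, g3, 0] $ i)) /
       (\<Prod>i\<in>UNIV. Gamma (of_int (u $ i + vector [g1, g2, g3, 0] $ i + 1) :: complex)))"
  have fin: "finite K" by (rule finite_subset[of _ "{..nat g2}"]) (auto simp: K_def)
  have inj: "inj v"
  proof (rule injI)
    fix x y assume "v x = v y"
    then have "v x $ 1 = v y $ 1" by simp
    then show "x = y" by (simp add: v_def)
  qed
  have t0: "t (v k) = 0" if "k \<notin> int ` K" for k
  proof -
    have "k < 0 \<or> g1 + k < 0 \<or> k > g2 \<or> k > g3"
    proof (rule ccontr)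
      assume "\<not> ?thesis"
      then have "nat k \<in> K" "k = int (nat k)" by (auto simp: K_def)
      then show False using that by blast
    qed
    then show ?thesis unfolding t_def exists_4 v_def by auto
  qed
  have t1: "t (v (int k)) = z1 ^ nat (g1 + int k) * z2 ^ nat (g2 - int k) * z3 ^ nat (g3 - int k)
      * z4 ^ k /
        (fact (nat (g1 + int k)) * fact (nat (g2 - int k)) * fact (nat (g3 - int k)) * fact k)"
    if "k \<in> K" for k
  proof -
    have p: "0 \<le> int k + g1" "0 \<le> g2 - int k" "0 \<le> g3 - int k" using that by (auto simp: K_def)
    have c: "v (int k) $ 1 + (vector [g1, g2, g3, 0] :: int^4) $ 1 = int k + g1"
      "v (int k) $ 2 + (vector [g1, g2, g3, 0] :: int^4) $ 2 = g2 - int k"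
      "v (int k) $ 3 + (vector [g1, g2, g3, 0] :: int^4) $ 3 = g3 - int k"
      "v (int k) $ 4 + (vector [g1, g2, g3, 0] :: int^4) $ 4 = int k"
      by (simp_all add: v_def)
    have ne: "\<not> (\<exists>i. v (int k) $ i + vector [g1, g2, g3, 0] $ i < 0)"
      unfolding exists_4 c using p by simp
    have "t (v (int k)) = (z1 powi (int k + g1) * z2 powi (g2 - int k) * z3 powi (g3 - int k)
        * z4 powi int k) /
      (Gamma (of_int (int k + g1 + 1)) * Gamma (of_int (g2 - int k + 1)) * Gamma (of_int
          (g3 - int k + 1)) * Gamma (of_int (int k + 1)))"
      unfolding t_def prod_4 c using ne by simp
    then show ?thesis
      using p by (simp only: Gamma_of_int_fact of_nat_0_le_iff nat_int power_int_def if_True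
          add.commute[of g1])
  qed
  have "Gamma_hyp_series (vector [g1, g2, g3, 0]) (vector [z1, z2, z3, z4]) lattice_B1 = infsum t
      (range v)"
    unfolding Gamma_hyp_series_def lattice_B1_def t_def v_def ..
  also have "\<dots> = infsum (t \<circ> v) UNIV"
    by (rule infsum_reindex[OF inj])
  also have "\<dots> = infsum (t \<circ> v) (int ` K)"
    by (rule infsum_cong_neutral) (auto simp: t0)
  also have "\<dots> = (\<Sum>k\<in>K. t (v (int k)))"
    using fin by (simp add: sum.reindex)
  finally show ?thesis using t1 by simp
qed

subsection \<open>Diagrams and pairs of exponents\<close>

text \<open>The factorial denominators of the \<Gamma>-series without its signs. The number
  \<open>(N - j) div 2\<close> is m1 - k1, the third entry of \<gamma>.\<close>

definition coefG :: "nat \<Rightarrow> nat \<Rightarrow> int \<Rightarrow> nat \<Rightarrow> nat \<Rightarrow> nat \<Rightarrow> complex" where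
  "coefG N M \<delta> j q k = 1 / (fact (nat (\<delta> + int k)) * fact (nat (int M - int q - \<delta> - int k)) *
     fact ((N - j) div 2 - k) * fact k)"

lemma good_coefG: "good N M \<delta> (coefG N M \<delta>)"
  unfolding good_def
proof (intro allI impI)
  fix j q assume "KK N M \<delta> j q \<noteq> {}"
  define c where "c = (\<lambda>k. 1 / (fact (nat (\<delta> + int k)) * fact (nat (int M - int q - \<delta> - int k)) *
     fact ((N - j) div 2 - k) * fact k) :: real)"
  have "(\<Sum>k\<in>KK N M \<delta> j q. c k) > 0"
    using \<open>KK N M \<delta> j q \<noteq> {}\<close> finite_KK by (intro sum_pos) (auto simp: c_def)
  moreover have "(\<Sum>k\<in>KK N M \<delta> j q. coefG N M \<delta> j q k) = of_real (\<Sum>k\<in>KK N M \<delta> j q. c k)"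
    unfolding of_real_sum by (intro sum.cong refl) (simp add: coefG_def c_def)
  ultimately show "(\<Sum>k\<in>KK N M \<delta> j q. coefG N M \<delta> j q k) \<noteq> 0"
    by (metis of_real_eq_0_iff less_irrefl)
qed

definition exps :: "real \<Rightarrow> nat \<times> real \<times> real \<Rightarrow> nat \<times> nat" where
  "exps m2 = (\<lambda>(\<sigma>, k2, k1). (nat \<lfloor>2 * k1 - real \<sigma>\<rfloor>, nat \<lfloor>m2 - k2\<rfloor>))"

text \<open>Both types of highest weight at once: \<open>T\<close> is the coset of the integers that
  contains \<open>m1\<close>, and the type is the parity of \<open>N\<close>.\<close>

locale diagram_setup =
  fixes T :: "real set" and m2 m1 s :: real and N M :: nat and \<delta> :: int
  assumes N: "real N = 2 * m1" and M: "real M = m2 - m1" and s: "s = m1 + of_int \<delta>"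
    and T: "\<And>x. x \<in> T \<longleftrightarrow> x - m1 \<in> \<int>" and TZ: "T = \<int> \<longleftrightarrow> even N"
begin

abbreviation "I \<equiv> diagram_indices T m2 m1 s"

lemma index_numbers:
  assumes "(\<sigma>, k2, k1) \<in> I"
  obtains j q n where "exps m2 (\<sigma>, k2, k1) = (j, q)" "(j, q) \<in> JJ N M \<delta>" "\<sigma> \<in> {0, 1}"
    "real j = 2 * k1 - real \<sigma>" "real q = m2 - k2" "real n = m1 - k1" "N = j + \<sigma> + 2 * n"
proof -
  have d: "\<sigma> \<in> {0, 1}" "k2 - m1 \<in> \<int>" "k1 - m1 \<in> \<int>" "m2 \<ge> k2" "k2 \<ge> m1" "m1 \<ge> k1" "k1 \<ge> 0" "k2 \<ge> s"
      "s \<ge> k1"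
    "T = \<int> \<longrightarrow> \<sigma> = 1 \<longrightarrow> k1 \<ge> 1"
    using assms unfolding diagram_indices_def by (simp_all add: T)
  obtain z where z: "k1 - m1 = of_int z" using d(3) by (auto elim: Ints_cases)
  obtain y where y: "k2 - m1 = of_int y" using d(2) by (auto elim: Ints_cases)
  have "z \<le> 0" using z d(6) by linarith
  define n where "n = nat (- z)"
  have n: "real n = m1 - k1" using z \<open>z \<le> 0\<close> by (simp add: n_def)
  have yM: "of_int y \<le> real M" using y M d(4) by linarith
  then have "y \<le> int M" by linarith
  define q where "q = nat (int M - y)"
  have q: "real q = m2 - k2" using y M \<open>y \<le> int M\<close> by (simp add: q_def)
  \<comment> \<open>This says that the exponent \<open>j\<close> of x1 is not negative. For \<sigma>
    = 1 it is the extra condition on \<open>k1\<close> when \<open>N\<close> is even, and a matter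
    of parity when \<open>N\<close> is odd.\<close>
  have "real (\<sigma> + 2 * n) \<le> real N"
  proof (cases "\<sigma> = 1")
    case False
    then show ?thesis using d(1) n N d(7) by auto
  next
    case True
    show ?thesis
    proof (cases "even N")
      case True
      then show ?thesis using TZ d(10) \<open>\<sigma> = 1\<close> n N by auto
    next
      case False
      have "real (2 * n) \<le> real N" using n N d(7) by simp
      then have "2 * n \<le> N" by linarith
      then have "2 * n < N" using False by (metis dvd_triv_left le_neq_implies_less)
      then show ?thesis using \<open>\<sigma> = 1\<close> by simp
    qed
  qed
  then have le: "\<sigma> + 2 * n \<le> N" by linarith
  define j where "j = N - \<sigma> - 2 * n"
  have Nj: "N = j + \<sigma> + 2 * n" using le by (simp add: j_def)
  have j: "real j = 2 * k1 - real \<sigma>" using n N Nj by (simp add: algebra_simps)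
  have e: "exps m2 (\<sigma>, k2, k1) = (j, q)"
    by (simp add: exps_def flip: j q)
  \<comment> \<open>The least exponent with \<open>\<delta> + k\<close> not negative. The other two
    conditions amount to s >= k1 and to k2 >= s or k2 >= m1, according to the sign of
    \<delta>.\<close>
  have "nat (- \<delta>) \<in> KK N M \<delta> j q"
  proof -
    have "real_of_int (- \<delta>) \<le> real n" using s d(9) n by linarith
    then have "- \<delta> \<le> int n" by linarith
    moreover have "real q + of_int \<delta> \<le> real M" using q M s d(8) by linarith
    then have "int q + \<delta> \<le> int M" by linarith
    moreover have "real q \<le> real M" using q M d(5) by linarith
    then have "q \<le> M" by linarith
    ultimately show ?thesis using Nj by (auto simp: KK_def)
  qed
  then have "(j, q) \<in> JJ N M \<delta>" by (auto simp: JJ_def)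
  then show ?thesis using that e d(1) j q n Nj by blast
qed

text \<open>The parity of \<open>N - j\<close> recovers \<sigma>, after which \<open>j\<close> and
  \<open>q\<close> determine k1 and k2. That some admissible \<open>k\<close> exists expresses the
  betweenness conditions.\<close>

lemma exps_bij: "bij_betw (exps m2) I (JJ N M \<delta>)"
proof (rule bij_betwI')
  fix x y assume x: "x \<in> I" and y: "y \<in> I"
  obtain \<sigma> k2 k1 where xe: "x = (\<sigma>, k2, k1)" by (cases x)
  obtain \<sigma>' k2' k1' where ye: "y = (\<sigma>', k2', k1')" by (cases y)
  obtain j q n where a: "exps m2 x = (j, q)" "\<sigma> \<in> {0, 1}" "real j = 2 * k1 - real \<sigma>"
      "real q = m2 - k2" "N = j + \<sigma> + 2 * n"
    using index_numbers x unfolding xe by metis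
  obtain j' q' n' where b: "exps m2 y = (j', q')" "\<sigma>' \<in> {0, 1}" "real j' = 2 * k1' - real \<sigma>'"
      "real q' = m2 - k2'" "N = j' + \<sigma>' + 2 * n'"
    using index_numbers y unfolding ye by metis
  show "exps m2 x = exps m2 y \<longleftrightarrow> x = y"
  proof
    assume "exps m2 x = exps m2 y"
    then have jq: "j = j'" "q = q'" using a(1) b(1) by auto
    then have "\<sigma> + 2 * n = \<sigma>' + 2 * n'" using a(5) b(5) by simp
    then have "(\<sigma> + 2 * n) mod 2 = (\<sigma>' + 2 * n') mod 2" by simp
    then have "\<sigma> = \<sigma>'" using a(2) b(2) by auto
    then show "x = y" using a(3,4) b(3,4) jq by (simp add: xe ye)
  qed simp
next
  fix x assume x: "x \<in> I"
  obtain \<sigma> k2 k1 where xe: "x = (\<sigma>, k2, k1)" by (cases x)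
  show "exps m2 x \<in> JJ N M \<delta>" using index_numbers x unfolding xe by metis
next
  fix y assume y: "y \<in> JJ N M \<delta>"
  obtain j q where ye: "y = (j, q)" by (cases y)
  obtain k where k: "k \<in> KK N M \<delta> j q" using y by (auto simp: ye JJ_def)
  define \<sigma> where "\<sigma> = (N - j) mod 2"
  define n where "n = (N - j) div 2"
  have jN: "j \<le> N" using k by (simp add: KK_def)
  have Nj: "N = j + \<sigma> + 2 * n" using jN unfolding \<sigma>_def n_def by (simp add: add.assoc)
  have \<sigma>: "\<sigma> \<in> {0, 1}" by (auto simp: \<sigma>_def)
  define k1 where "k1 = m1 - real n"
  define k2 where "k2 = m2 - real q"
  have j: "real j = 2 * k1 - real \<sigma>" using arg_cong[OF Nj, of real] N by (simp add: k1_def)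
  have kn: "int k \<le> int n" using k Nj \<sigma> by (auto simp: KK_def)
  have "(\<sigma>, k2, k1) \<in> I"
    unfolding diagram_indices_def mem_Collect_eq split
  proof (intro conjI)
    show "\<sigma> \<in> {0, 1}" by (rule \<sigma>)
    have "k2 - m1 = of_int (int M - int q)" using M by (simp add: k2_def)
    then show "k2 \<in> T" unfolding T by simp
    have "k1 - m1 = of_int (- int n)" by (simp add: k1_def)
    then show "k1 \<in> T" unfolding T by (metis Ints_of_int)
    have "s - m1 = of_int \<delta>" by (simp add: s)
    then show "s \<in> T" unfolding T by simp
    show "m2 \<ge> k2" "m1 \<ge> k1" by (simp_all add: k2_def k1_def)
    show "0 \<le> k1" using j by linarith
    have kq: "int q \<le> int M" "int q + \<delta> \<le> int M" "- \<delta> \<le> int n"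
      using k kn by (auto simp: KK_def)
    have "real_of_int (int q) \<le> of_int (int M)" "real_of_int (int q + \<delta>) \<le> of_int (int M)"
        "real_of_int (- \<delta>) \<le> of_int (int n)"
      using kq unfolding of_int_le_iff .
    then show "m1 \<le> k2" "s \<le> k2" "k1 \<le> s"
      using M by (simp_all add: k2_def k1_def s)
    show "T = \<int> \<longrightarrow> \<sigma> = 1 \<longrightarrow> 1 \<le> k1"
    proof (intro impI)
      assume "T = \<int>" "\<sigma> = 1"
      then have "even N" using TZ by simp
      \<comment> \<open>For even \<open>N\<close> and \<sigma> = 1 the exponent \<open>j\<close> is
        odd.\<close>
      then have "j \<noteq> 0" using Nj \<open>\<sigma> = 1\<close> by (metis add_0 even_add even_mult_iff even_numeral odd_one)
      then show "1 \<le> k1" using j \<open>\<sigma> = 1\<close> by simp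
    qed
  qed
  moreover have "exps m2 (\<sigma>, k2, k1) = y"
    by (simp add: exps_def ye k2_def flip: j)
  ultimately show "\<exists>x\<in>I. y = exps m2 x" by blast
qed

text \<open>The power of \<open>minor (-2) (-1)\<close> stays abstract so that both types are
  covered. The factor \<open>h$1$1 ^ \<sigma>\<close> comes from \<open>minor (-2) 0\<close> and
  makes up for the shift of the exponent by \<sigma>, which leaves x1 with exponent 2 k1 - \<sigma>;
  the constant \<open>u\<close> absorbs the sign of the chosen root.\<close>

lemma diagram_value_cover:
  assumes d: "(\<sigma>, k2, k1) \<in> I" and h: "h \<in> Sp4"
    and pw: "h$1$1 ^ \<sigma> * pw (k1 - real \<sigma>) = u * h$1$1 ^ fst (exps m2 (\<sigma>, k2, k1))"
  shows "diagram_value m2 m1 s (\<sigma>, k2, k1) pw (cover h)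
    = (- root2) ^ \<sigma> * (- 1) ^ nat \<lfloor>m1 - k1\<rfloor> * u * Vf N M \<delta> (coefG N M \<delta>) (exps m2 (\<sigma>, k2, k1)) h"
proof -
  obtain j q n where x: "exps m2 (\<sigma>, k2, k1) = (j, q)" "(j, q) \<in> JJ N M \<delta>" "\<sigma> \<in> {0, 1}"
    "real j = 2 * k1 - real \<sigma>" "real q = m2 - k2" "real n = m1 - k1" "N = j + \<sigma> + 2 * n"
    by (rule index_numbers[OF d])
  have fl: "\<lfloor>m2 - k2\<rfloor> = int q" "\<lfloor>s - m1\<rfloor> = \<delta>" "\<lfloor>m1 - k1\<rfloor> = int n"
    by (simp_all add: s flip: x(5,6))
  have "k2 - s = of_int (int M - int q - \<delta>)" using M x(5) by (simp add: s)
  then have fl2: "\<lfloor>k2 - s\<rfloor> = int M - int q - \<delta>" by (simp only: floor_of_int)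
  have K: "{k. 0 \<le> \<delta> + int k \<and> int k \<le> int M - int q - \<delta> \<and> int k \<le> int n} = KK N M \<delta> j q"
    using x(3,7) by (auto simp: KK_def)
  let ?y = "yv h"
  note mc = minor_cover[OF h]
  have summand: "(pl h 1 2 ^ nat (\<delta> + int k) * pl h 1 3 ^ nat (int M - int q - \<delta> - int k) *
        (- (h$1$2)\<^sup>2) ^ nat (int n - int k) * (- ?y) ^ k /
        (fact (nat (\<delta> + int k)) * fact (nat (int M - int q - \<delta> - int k)) * fact (nat
            (int n - int k)) * fact k)) * (h$1$2 ^ \<sigma> * pl h 2 4 ^ q)
     = (- 1) ^ n * (coefG N M \<delta> j q k * mval 0 (N - j - 2 * k) k (nat (\<delta> + int k)) (nat
         (int M - int q - \<delta> - int k)) q h)"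
    if "k \<in> KK N M \<delta> j q" for k
  proof -
    have kn: "k \<le> n" using that K by auto
    \<comment> \<open>Both minors carry a minus sign and their exponents add up to \<open>n\<close>.
      The sign is therefore common to all summands, and the remaining coefficients are the positive
      ones of \<open>good_coefG\<close>.\<close>
    have 1: "(- (h$1$2)\<^sup>2) ^ nat (int n - int k) * (- ?y) ^ k = (- 1) ^ n * (h$1$2 ^ (2 * (n - k))
        * ?y ^ k)"
    proof -
      have a: "nat (int n - int k) = n - k" by simp
      have b: "(- (h$1$2)\<^sup>2) ^ (n - k) = (- 1) ^ (n - k) * h$1$2 ^ (2 * (n - k))"
        unfolding power_mult by (rule power_minus)
      have c: "(- 1 :: complex) ^ (n - k) * (- 1) ^ k = (- 1) ^ n"
        using kn by (simp flip: power_add)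
      have "(- (h$1$2)\<^sup>2) ^ nat (int n - int k) * (- ?y) ^ k
          = (- 1) ^ (n - k) * h$1$2 ^ (2 * (n - k)) * ((- 1) ^ k * ?y ^ k)"
        unfolding a b power_minus[of ?y] ..
      also have "\<dots> = (- 1) ^ (n - k) * (- 1) ^ k * (h$1$2 ^ (2 * (n - k)) * ?y ^ k)"
        by (simp only: mult_ac)
      finally show ?thesis unfolding c .
    qed
    \<comment> \<open>The exponent of x2: \<sigma> from \<open>minor (-2) 0\<close> and
      \<open>n - k\<close> squares from \<open>minor (-2) 1\<close>.\<close>
    have e: "N - j - 2 * k = \<sigma> + 2 * (n - k)" using x(7) kn by simp
    have "(N - j) div 2 = n" using x(3,7) by auto
    then have c: "coefG N M \<delta> j q k = 1 / (fact (nat (\<delta> + int k)) * fact (nat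
        (int M - int q - \<delta> - int k)) * fact (nat (int n - int k)) * fact k)"
      using kn by (simp add: coefG_def nat_diff_distrib')
    have "pl h 1 2 ^ nat (\<delta> + int k) * pl h 1 3 ^ nat (int M - int q - \<delta> - int k) *
        (- (h$1$2)\<^sup>2) ^ nat (int n - int k) * (- ?y) ^ k * (h$1$2 ^ \<sigma> * pl h 2 4 ^ q)
      = (- 1) ^ n * mval 0 (N - j - 2 * k) k (nat (\<delta> + int k)) (nat (int M - int q - \<delta> - int k)) q h"
    proof -
      have "pl h 1 2 ^ nat (\<delta> + int k) * pl h 1 3 ^ nat (int M - int q - \<delta> - int k) *
          (- (h$1$2)\<^sup>2) ^ nat (int n - int k) * (- ?y) ^ k * (h$1$2 ^ \<sigma> * pl h 2 4 ^ q)
        = pl h 1 2 ^ nat (\<delta> + int k) * pl h 1 3 ^ nat (int M - int q - \<delta> - int k) *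
          ((- (h$1$2)\<^sup>2) ^ nat (int n - int k) * (- ?y) ^ k) * (h$1$2 ^ \<sigma> * pl h 2 4 ^ q)"
        by (simp only: mult.assoc)
      then show ?thesis unfolding 1 mval_def e power_add power_0 by (simp only: mult_ac mult_1_left)
    qed
    then show ?thesis unfolding c by (simp add: field_simps)
  qed
  have el: "elt (-2) (cover h) = pl h 1 2" "elt (-1) (cover h) = pl h 1 3" "elt 1 (cover h) = pl h 2 4"
    by (simp_all add: elt_def cover_rows pl_def)
  have "diagram_value m2 m1 s (\<sigma>, k2, k1) pw (cover h) = (- root2 * h$1$1 * h$1$2) ^
      \<sigma> * pl h 2 4 ^ q * pw (k1 - real \<sigma>) *
     (\<Sum>k\<in>KK N M \<delta> j q. pl h 1 2 ^ nat (\<delta> + int k) * pl h 1 3 ^ nat (int M - int q - \<delta> - int k) *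
        (- (h$1$2)\<^sup>2) ^ nat (int n - int k) * (- ?y) ^ k /
        (fact (nat (\<delta> + int k)) * fact (nat (int M - int q - \<delta> - int k)) * fact (nat
            (int n - int k)) * fact k))"
    unfolding diagram_value_def split fl fl2 Gamma_hyp_series_B1 K el mc yv_def[symmetric] by simp
  also have "\<dots> = (- root2) ^ \<sigma> * (h$1$1 ^ \<sigma> * pw (k1 - real \<sigma>)) *
     (\<Sum>k\<in>KK N M \<delta> j q. (pl h 1 2 ^ nat (\<delta> + int k) * pl h 1 3 ^ nat (int M - int q - \<delta> - int k) *
        (- (h$1$2)\<^sup>2) ^ nat (int n - int k) * (- ?y) ^ k /
        (fact (nat (\<delta> + int k)) * fact (nat (int M - int q - \<delta> - int k)) * fact (nat
            (int n - int k)) * fact k)) * (h$1$2 ^ \<sigma> * pl h 2 4 ^ q))"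
    unfolding sum_distrib_right[symmetric] power_mult_distrib by (simp only: mult_ac)
  also have "\<dots> = (- root2) ^ \<sigma> * (u * h$1$1 ^ j) * (\<Sum>k\<in>KK N M \<delta> j q.
      (- 1) ^ n * (coefG N M \<delta> j q k * mval 0 (N - j - 2 * k) k (nat (\<delta> + int k)) (nat
          (int M - int q - \<delta> - int k)) q h))"
    unfolding pw x(1) fst_conv by (intro arg_cong2[where f = "(*)"] refl sum.cong summand)
  also have "\<dots> = (- root2) ^ \<sigma> * (- 1) ^ n * u * Vf N M \<delta> (coefG N M \<delta>) (j, q) h"
    unfolding Vf_factor[OF h] sum_distrib_left[symmetric] by (simp only: mult_ac)
  finally show ?thesis unfolding x(1) fl by simp
qed

lemma weights:
  assumes "(\<sigma>, k2, k1) \<in> I"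
  shows "act_Sp4 (-2) (-2) (Vf N M \<delta> cf (exps m2 (\<sigma>, k2, k1))) = fscale (of_real s) (Vf N M \<delta> cf
      (exps m2 (\<sigma>, k2, k1)))"
    "act_Sp4 (-1) (-1) (Vf N M \<delta> cf (exps m2 (\<sigma>, k2, k1)))
      = fscale (of_real (minus1_weight m2 m1 s (\<sigma>, k2, k1))) (Vf N M \<delta> cf (exps m2 (\<sigma>, k2, k1)))"
proof -
  obtain j q n where x: "exps m2 (\<sigma>, k2, k1) = (j, q)" "real j = 2 * k1 - real \<sigma>" "real q = m2 - k2"
    by (rule index_numbers[OF assms])
  have N2: "(of_nat N / 2 :: complex) = of_real m1"
    using arg_cong[OF N, of complex_of_real] by simp
  have w: "(of_nat N / 2 + of_int \<delta> :: complex) = of_real s"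
    unfolding N2 by (simp add: s)
  have "of_real (real j - m1 + real M - of_int \<delta> - 2 * real q) = (of_real (minus1_weight m2 m1 s
      (\<sigma>, k2, k1)) :: complex)"
    unfolding x(2,3) M by (simp add: minus1_weight_def s)
  then have w1: "(of_nat j - of_nat N / 2 + of_nat M - of_int \<delta> - 2 * of_nat q :: complex)
      = of_real (minus1_weight m2 m1 s (\<sigma>, k2, k1))"
    unfolding N2 by simp
  show "act_Sp4 (-2) (-2) (Vf N M \<delta> cf (exps m2 (\<sigma>, k2, k1))) = fscale (of_real s) (Vf N M \<delta> cf
      (exps m2 (\<sigma>, k2, k1)))"
    unfolding Vf_weight_minus2 w ..
  show "act_Sp4 (-1) (-1) (Vf N M \<delta> cf (exps m2 (\<sigma>, k2, k1)))
      = fscale (of_real (minus1_weight m2 m1 s (\<sigma>, k2, k1))) (Vf N M \<delta> cf (exps m2 (\<sigma>, k2, k1)))"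
    unfolding x(1) Vf_weight_minus1 w1 ..
qed

end

lemma is_indexed_basisI:
  assumes fin: "finite I" and ind: "\<And>c. (\<Sum>i\<in>I. fscale (c i) (v i)) = 0 \<Longrightarrow> \<forall>i\<in>I. c i = 0"
    and sub: "fun_vs.subspace U" "v ` I \<subseteq> U" "U \<subseteq> fun_vs.span (v ` I)"
  shows "is_indexed_basis I v U"
  unfolding is_indexed_basis_def
proof (intro conjI)
  show inj: "inj_on v I"
  proof (rule inj_onI, rule ccontr)
    fix i l assume il: "i \<in> I" "l \<in> I" "v i = v l" "i \<noteq> l"
    let ?c = "\<lambda>k. if k = i then 1 else if k = l then - 1 else 0"
    have "(\<Sum>k\<in>I. fscale (?c k) (v k)) = (\<Sum>k\<in>I. (if k = i then v i else 0) +
        (if k = l then - v i else 0))"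
      using il by (intro sum.cong refl) (auto simp: fscale_def fun_eq_iff)
    also have "\<dots> = v i + - v i"
      unfolding sum.distrib using il fin by (simp only: sum.delta if_True)
    finally have "(\<Sum>k\<in>I. fscale (?c k) (v k)) = 0" by simp
    from ind[OF this] il(1) show False by auto
  qed
  show "fun_vs.independent (v ` I)"
  proof
    assume "fun_vs.dependent (v ` I)"
    then obtain u where u: "\<exists>x\<in>v ` I. u x \<noteq> 0" "(\<Sum>x\<in>v ` I. fscale (u x) x) = 0"
      using fun_vs.dependent_finite[of "v ` I"] fin by auto
    have "(\<Sum>i\<in>I. fscale (u (v i)) (v i)) = 0"
      using u(2) unfolding sum.reindex[OF inj] comp_def .
    from ind[OF this] u(1) show False by auto
  qed
  show "fun_vs.span (v ` I) = U"
    using sub fun_vs.span_minimal by blast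
qed

lemma o3_highest_subspace_W: "fun_vs.subspace (o3_highest_vectors act_Sp4 (W N M) s)"
  by (rule o3_highest_subspace[OF shift_action_Sp4 W_subspace]) (auto intro: W_regular)

lemma (in diagram_setup) highest_vectors_basis:
  assumes c: "\<And>d. d \<in> I \<Longrightarrow> c d \<noteq> 0"
    and v: "\<And>d. d \<in> I \<Longrightarrow> v d = fscale (c d) (Vf N M \<delta> (coefG N M \<delta>) (exps m2 d))"
  shows "is_indexed_basis I v (o3_highest_vectors act_Sp4 (W N M) s)"
    and "\<And>d. d \<in> I \<Longrightarrow> act_Sp4 (-2) (-2) (v d) = fscale (of_real s) (v d)"
    and "\<And>d. d \<in> I \<Longrightarrow> act_Sp4 (-1) (-1) (v d) = fscale (of_real (minus1_weight m2 m1 s d)) (v d)"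
proof -
  let ?V = "Vf N M \<delta> (coefG N M \<delta>)"
  have fin: "finite I" using exps_bij finite_JJ bij_betw_finite by blast
  show w2: "act_Sp4 (-2) (-2) (v d) = fscale (of_real s) (v d)" if "d \<in> I" for d
    using that weights(1)[of "fst d" "fst (snd d)" "snd (snd d)"]
    by (simp add: v act_Sp4_scale regular_Vf fscale_simps mult.commute)
  show "act_Sp4 (-1) (-1) (v d) = fscale (of_real (minus1_weight m2 m1 s d)) (v d)" if "d \<in> I" for d
    using that weights(2)[of "fst d" "fst (snd d)" "snd (snd d)"]
    by (simp add: v act_Sp4_scale regular_Vf fscale_simps mult.commute)
  show "is_indexed_basis I v (o3_highest_vectors act_Sp4 (W N M) s)"
  proof (rule is_indexed_basisI[OF fin _ o3_highest_subspace_W])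
    fix b assume b: "(\<Sum>i\<in>I. fscale (b i) (v i)) = 0"
    let ?b = "\<lambda>i. b i * c i"
    let ?inv = "inv_into I (exps m2)"
    have inv: "?inv (exps m2 d) = d" if "d \<in> I" for d
      using exps_bij that by (simp add: bij_betw_def)
    have "(\<Sum>i\<in>JJ N M \<delta>. fscale (?b (?inv i)) (?V i)) = (\<Sum>d\<in>I. fscale (?b (?inv (exps m2 d))) (?V
        (exps m2 d)))"
      by (rule sum.reindex_bij_betw[OF exps_bij, symmetric])
    also have "\<dots> = (\<Sum>d\<in>I. fscale (b d) (v d))"
      by (intro sum.cong refl) (simp add: inv v fscale_simps)
    finally have z: "(\<Sum>i\<in>JJ N M \<delta>. fscale (?b (?inv i)) (?V i)) = 0" using b by simp
    show "\<forall>d\<in>I. b d = 0"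
    proof
      fix d assume d: "d \<in> I"
      have "?b (?inv (exps m2 d)) = 0"
        by (rule Vf_independent[OF good_coefG z]) (use exps_bij d in \<open>auto simp: bij_betw_def\<close>)
      then show "b d = 0" using c[OF d] by (simp add: inv[OF d])
    qed
  next
    show "v ` I \<subseteq> o3_highest_vectors act_Sp4 (W N M) s"
    proof
      fix f assume "f \<in> v ` I"
      then obtain d where d: "d \<in> I" "f = v d" by blast
      have "v d \<in> W N M" unfolding v[OF d(1)] by (intro fun_vs.subspace_scale[OF W_subspace] Vf_W)
      moreover have "act_Sp4 (-2) 0 (v d) = 0"
        unfolding v[OF d(1)] by (simp add: act_Sp4_scale regular_Vf Vf_annihilated fscale_simps)
      ultimately show "f \<in> o3_highest_vectors act_Sp4 (W N M) s"
        using w2[OF d(1)] by (simp add: o3_highest_vectors_def d(2))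
    qed
  next
    have N2: "(of_nat N / 2 :: complex) = of_real m1"
      using arg_cong[OF N, of complex_of_real] by simp
    have w: "(of_real s :: complex) = of_nat N / 2 + of_int \<delta>"
      unfolding N2 by (simp add: s)
    have "?V ` JJ N M \<delta> \<subseteq> fun_vs.span (v ` I)"
    proof
      fix f assume "f \<in> ?V ` JJ N M \<delta>"
      then have "f \<in> ?V ` exps m2 ` I" unfolding bij_betw_imp_surj_on[OF exps_bij] .
      then obtain d where d: "d \<in> I" "f = ?V (exps m2 d)" by blast
      have "fscale (1 / c d) (v d) \<in> fun_vs.span (v ` I)"
        by (intro fun_vs.span_scale fun_vs.span_base imageI d(1))
      then show "f \<in> fun_vs.span (v ` I)" using c[OF d(1)] by (simp add: v[OF d(1)] d(2) fscale_simps)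
    qed
    then have "fun_vs.span (?V ` JJ N M \<delta>) \<subseteq> fun_vs.span (v ` I)"
      by (rule fun_vs.span_minimal[OF _ fun_vs.subspace_span])
    moreover have "o3_highest_vectors act_Sp4 (W N M) s \<subseteq> fun_vs.span (?V ` JJ N M \<delta>)"
      unfolding o3_highest_vectors_def w by (auto intro!: highest_span_Vf good_coefG)
    ultimately show "o3_highest_vectors act_Sp4 (W N M) s \<subseteq> fun_vs.span (v ` I)" by blast
  qed
qed

lemma highest_vectors_trivial:
  assumes "real N = 2 * m1" "s - m1 \<notin> \<int>"
  shows "is_indexed_basis {} v (o3_highest_vectors act_Sp4 (W N M) s)"
proof (rule is_indexed_basisI[OF _ _ o3_highest_subspace_W])
  have "(of_real s - of_nat N / 2 :: complex) = of_real (s - m1)"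
    using arg_cong[OF assms(1), of complex_of_real] by simp
  then have "(of_real s - of_nat N / 2 :: complex) \<notin> \<int>"
    using assms(2) by (simp add: of_real_in_Ints_iff del: of_real_diff)
  then have "f = 0" if "f \<in> o3_highest_vectors act_Sp4 (W N M) s" for f
    using that highest_weight_integral unfolding o3_highest_vectors_def by blast
  then show "o3_highest_vectors act_Sp4 (W N M) s \<subseteq> fun_vs.span (v ` {})" by auto
qed auto

subsection \<open>Pull-back to the covering group\<close>

definition pull :: "(complex^5^5 \<Rightarrow> complex) \<Rightarrow> complex^4^4 \<Rightarrow> complex" where
  "pull f = res (\<lambda>h. f (cover h))"

lemma pull_on_group: "pull (on_group SO5 P) = res (\<lambda>h. P (cover h))"
  unfolding pull_def on_group_eq_iff using cover_in_SO5 by (simp add: on_group_def)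

lemma pull_add: "pull (f + g) = pull f + pull g"
  and pull_scale: "pull (fscale c f) = fscale c (pull f)"
  and pull_zero: "pull 0 = 0"
  by (auto simp: pull_def on_group_def fun_eq_iff fscale_def)

lemma pull_sum: "pull (\<Sum>i\<in>A. F i) = (\<Sum>i\<in>A. pull (F i))"
  using sum_comp_morphism[of pull F A, OF pull_zero pull_add] unfolding comp_def by (rule sym)

text \<open>Functions on SO5 are determined by their pull-backs because the covering is
  onto.\<close>

lemma pull_inject:
  assumes "on_group SO5 f = f" "on_group SO5 g = g" "pull f = pull g"
  shows "f = g"
proof -
  have "f (cover h) = g (cover h)" if "h \<in> Sp4" for h
    using assms(3) that by (simp add: pull_def on_group_eq_iff)
  then have "f k = g k" if "k \<in> SO5" for k
    using that cover_image by force
  then have "on_group SO5 f = on_group SO5 g" by (simp add: on_group_eq_iff)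
  then show ?thesis using assms(1,2) by simp
qed

lemma mat_exp_gen_F_SO5: "mat_exp (mscale t (gen_F i j)) \<in> SO5"
  unfolding SO5_def
  using mat_exp_preserves_form[OF gen_F_o5] det_mat_exp[OF gen_F_o5 det_scalar_prod_mat] by simp

lemma SO5_mult: "g \<in> SO5 \<Longrightarrow> k \<in> SO5 \<Longrightarrow> g ** k \<in> SO5"
  using SO5_cover_mult SO5_subset_cover by blast

lemma act_SO5_on_group: "act_SO5 i j (on_group SO5 P) = on_group SO5 (poly_shift (gen_F i j) P)"
  unfolding act_SO5_def by (rule lie_shift_on_group) (intro SO5_mult mat_exp_gen_F_SO5)

lemma has_mat_deriv_cover: "has_mat_deriv (\<lambda>t. cover (mat_exp (mscale t X))) (dcover X) 0"
proof -
  let ?E = "\<lambda>t. mat_exp (mscale t X)"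
  have E: "has_mat_deriv ?E X 0" using has_mat_deriv_exp[of X 0] by (simp add: mat_exp_zero)
  have *: "has_mat_deriv (\<lambda>t. ?E t ** B ** transpose (?E t)) (X ** B + B ** transpose X) 0" for B
    using has_mat_deriv_mult[OF has_mat_deriv_mult[OF E has_mat_deriv_const[of B]]
        has_mat_deriv_transpose[OF E]]
    by (simp add: mat_exp_zero matrix_mult_zero transpose_mat)
  have "((\<lambda>t. ext_coord i (A t)) has_field_derivative ext_coord i A') (at 0)" if
      "has_mat_deriv A A' 0" for i A A'
    using exhaust_5[of i] that unfolding has_mat_deriv_def
    by (elim disjE) (simp_all add: ext_coord_simps, auto intro!: derivative_intros DERIV_cdivide)
  from this[OF *] show ?thesis
    by (simp add: has_mat_deriv_def cover_entry dcover_def)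
qed

text \<open>The image of the one-parameter group of \<open>sp_of (gen_F i j)\<close> and the
  one-parameter group of \<open>gen_F i j\<close> have the same velocity at the identity, and the
  derivative of a polynomial along a curve depends on nothing else.\<close>

lemma pull_act:
  assumes "regular_on SO5 f"
  shows "pull (act_SO5 i j f) = act_Sp4 i j (pull f)"
proof -
  obtain P where P: "polynomial_fun P" "f = on_group SO5 P" using assms by (auto simp: regular_on_def)
  let ?F = "gen_F i j" and ?X = "sp_of (gen_F i j)"
  have X: "dcover ?X = ?F" by (rule dcover_sp_of) (rule gen_F_antisym)
  have "poly_shift ?F P (cover h) = poly_shift ?X (\<lambda>h. P (cover h)) h" if h: "h \<in> Sp4" for h
  proof -
    obtain D where D: "\<And>c. c 0 = cover h \<Longrightarrow> has_mat_deriv c (cover h ** ?F) 0 \<Longrightarrow>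
        ((\<lambda>t. P (c t)) has_field_derivative D) (at 0)"
      using polynomial_fun_curve_deriv[OF P(1)] by blast
    have 1: "poly_shift ?F P (cover h) = D"
      by (rule poly_shift_eqI, rule D) (simp_all add: mat_exp_zero has_mat_deriv_shift)
    have "((\<lambda>t. P (cover h ** cover (mat_exp (mscale t ?X)))) has_field_derivative D) (at 0)"
    proof (rule D)
      show "has_mat_deriv (\<lambda>t. cover h ** cover (mat_exp (mscale t ?X))) (cover h ** ?F) 0"
        using has_mat_deriv_mult[OF has_mat_deriv_const[of "cover h"] has_mat_deriv_cover[of ?X]]
        by (simp add: X matrix_mult_zero)
    qed (simp add: mat_exp_zero cover_one)
    then have "((\<lambda>t. P (cover (h ** mat_exp (mscale t ?X)))) has_field_derivative D) (at 0)"
      by (simp add: cover_mult mat_exp_Sp4 sp_of_gen_F_in_sp4)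
    then have "poly_shift ?X (\<lambda>h. P (cover h)) h = D" by (rule poly_shift_eqI)
    then show ?thesis using 1 by simp
  qed
  then show ?thesis
    unfolding P(2) act_SO5_on_group pull_on_group act_Sp4_res on_group_eq_iff by blast
qed

lemma shift_action_SO5: "shift_action SO5 act_SO5"
  unfolding shift_action_def by (intro exI[of _ gen_F]) (simp add: act_SO5_on_group)

lemmas regular_act_SO5 = act_regular[OF shift_action_SO5]

lemma generated_subrep_closed:
  "fun_vs.subspace (generated_subrep act f)" "f \<in> generated_subrep act f"
  "u \<in> generated_subrep act f \<Longrightarrow> act i j u \<in> generated_subrep act f"
  unfolding generated_subrep_def by (auto intro!: fun_vs.subspace_Inter)

lemma generated_subrep_least:
  "fun_vs.subspace U \<Longrightarrow> f \<in> U \<Longrightarrow> (\<And>i j u. u \<in> U \<Longrightarrow> act i j u \<in> U) \<Longrightarrow> generated_subrep act f \<subseteq> U"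
  unfolding generated_subrep_def by blast

lemma generated_subrep_regular:
  assumes "regular_on SO5 f"
  shows "generated_subrep act_SO5 f \<subseteq> {f. regular_on SO5 f}"
  by (rule generated_subrep_least[OF subspace_regular]) (use assms regular_act_SO5 in auto)

lemma pull_generated_subrep:
  assumes f: "regular_on SO5 f"
  shows "pull ` generated_subrep act_SO5 f = generated_subrep act_Sp4 (pull f)"
proof
  let ?V = "generated_subrep act_SO5 f" and ?V' = "generated_subrep act_Sp4 (pull f)"
  let ?S = "{g. regular_on SO5 g \<and> pull g \<in> ?V'}"
  have "?V \<subseteq> ?S"
  proof (rule generated_subrep_least)
    show "fun_vs.subspace ?S"
      using generated_subrep_closed(1)[of act_Sp4 "pull f"] unfolding fun_vs.subspace_def
      by (auto simp: regular_zero regular_add regular_scale pull_zero pull_add pull_scale)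
    show "f \<in> ?S" using f generated_subrep_closed(2) by simp
    fix i j u assume "u \<in> ?S"
    then show "act_SO5 i j u \<in> ?S"
      using generated_subrep_closed(3)[of "pull u" act_Sp4
          "pull f" i j] by (simp add: regular_act_SO5 pull_act)
  qed
  then show "pull ` ?V \<subseteq> ?V'" by blast
  have reg: "regular_on SO5 g" if "g \<in> ?V" for g using generated_subrep_regular[OF f] that by blast
  show "?V' \<subseteq> pull ` ?V"
  proof (rule generated_subrep_least)
    have "pull 0 \<in> pull ` ?V"
      by (rule imageI) (rule fun_vs.subspace_0[OF generated_subrep_closed(1)])
    then show "fun_vs.subspace (pull ` ?V)"
      using generated_subrep_closed(1)[of act_SO5 f] unfolding fun_vs.subspace_def pull_zero
      by (auto simp flip: pull_add pull_scale)
    show "pull f \<in> pull ` ?V" using generated_subrep_closed(2) by blast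
    fix i j u assume "u \<in> pull ` ?V"
    then obtain a where a: "u = pull a" "a \<in> ?V" by blast
    then show "act_Sp4 i j u \<in> pull ` ?V"
      using pull_act[OF reg[OF a(2)], of i j] generated_subrep_closed(3)[OF a(2), of i j] by
          (metis image_eqI)
  qed
qed

lemma pull_eq_iff:
  assumes "regular_on SO5 f" "regular_on SO5 g"
  shows "pull f = pull g \<longleftrightarrow> f = g"
  using pull_inject[OF on_group_regular[OF assms(1)] on_group_regular[OF assms(2)]] by blast

text \<open>As \<open>pull\<close> is injective and maps the representation on SO5 onto the one on
  Sp4, a function whose pull-back lies in the latter lies in the former. Regularity of
  \<open>v d\<close> is a consequence, and linear relations and weight conditions transfer as
  well.\<close>

lemma descend_basis:
  assumes f: "regular_on SO5 f" and fin: "finite I"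
    and v: "\<And>d. d \<in> I \<Longrightarrow> on_group SO5 (v d) = v d"
    and basis: "is_indexed_basis I (\<lambda>d. pull (v d)) (o3_highest_vectors act_Sp4
        (generated_subrep act_Sp4 (pull f)) s)"
  shows "is_indexed_basis I v (o3_highest_vectors act_SO5 (generated_subrep act_SO5 f) s)"
    and "\<And>d. d \<in> I \<Longrightarrow> regular_on SO5 (v d)"
proof -
  let ?V = "generated_subrep act_SO5 f" and ?V' = "generated_subrep act_Sp4 (pull f)"
  let ?H = "o3_highest_vectors act_SO5 ?V s" and ?H' = "o3_highest_vectors act_Sp4 ?V' s"
  have reg: "regular_on SO5 g" if "g \<in> ?V" for g using generated_subrep_regular[OF f] that by blast
  have span: "fun_vs.span ((\<lambda>d. pull (v d)) ` I) = ?H'" and ind: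
      "fun_vs.independent ((\<lambda>d. pull (v d)) ` I)"
    and inj: "inj_on (\<lambda>d. pull (v d)) I"
    using basis by (auto simp: is_indexed_basis_def)
  have vV: "v d \<in> ?V" if "d \<in> I" for d
  proof -
    have "pull (v d) \<in> ?H'" unfolding span[symmetric] using that by (intro fun_vs.span_base) blast
    then have "pull (v d) \<in> pull ` ?V" by (simp add: o3_highest_vectors_def pull_generated_subrep[OF f])
    then obtain g where g: "g \<in> ?V" "pull (v d) = pull g" by blast
    then have "v d = g" using pull_inject[OF v[OF that] on_group_regular[OF reg[OF g(1)]]] by blast
    then show ?thesis using g(1) by simp
  qed
  show rv: "regular_on SO5 (v d)" if "d \<in> I" for d using reg[OF vV[OF that]] .
  have H_iff: "g \<in> ?H \<longleftrightarrow> pull g \<in> ?H'" if g: "g \<in> ?V" for g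
  proof -
    have r: "regular_on SO5 g" by (rule reg[OF g])
    have "pull g \<in> ?V'" using g pull_generated_subrep[OF f] by blast
    moreover have "act_SO5 (-2) 0 g = 0 \<longleftrightarrow> act_Sp4 (-2) 0 (pull g) = 0"
      unfolding pull_act[OF r, symmetric] pull_zero[symmetric]
      by (rule pull_eq_iff[OF regular_act_SO5[OF r] regular_zero, symmetric])
    moreover have "act_SO5 (-2) (-2) g = fscale (of_real s) g \<longleftrightarrow> act_Sp4 (-2) (-2) (pull g)
        = fscale (of_real s) (pull g)"
      unfolding pull_act[OF r, symmetric] pull_scale[symmetric]
      by (rule pull_eq_iff[OF regular_act_SO5[OF r] regular_scale[OF r], symmetric])
    ultimately show ?thesis using g by (simp add: o3_highest_vectors_def)
  qed
  show "is_indexed_basis I v ?H"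
  proof (rule is_indexed_basisI[OF fin])
    fix c assume "(\<Sum>i\<in>I. fscale (c i) (v i)) = 0"
    then have "pull (\<Sum>i\<in>I. fscale (c i) (v i)) = 0" by (simp only: pull_zero)
    then have z: "(\<Sum>i\<in>I. fscale (c i) (pull (v i))) = 0" by (simp only: pull_sum pull_scale)
    let ?u = "\<lambda>x. c (inv_into I (\<lambda>d. pull (v d)) x)"
    have "(\<Sum>x\<in>(\<lambda>d. pull (v d)) ` I. fscale (?u x) x) = (\<Sum>i\<in>I. fscale (c i) (pull (v i)))"
      unfolding sum.reindex[OF inj] by (intro sum.cong refl) (simp add: inv_into_f_f[OF inj])
    then have u: "(\<Sum>x\<in>(\<lambda>d. pull (v d)) ` I. fscale (?u x) x) = 0" using z by simp
    show "\<forall>i\<in>I. c i = 0"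
    proof (rule ccontr)
      assume "\<not> ?thesis"
      then obtain i where i: "i \<in> I" "c i \<noteq> 0" by blast
      have "?u (pull (v i)) \<noteq> 0" using i by (simp add: inv_into_f_f[OF inj])
      then have "\<exists>x\<in>(\<lambda>d. pull (v d)) ` I. ?u x \<noteq> 0" using i(1) by blast
      then have "fun_vs.dependent ((\<lambda>d. pull (v d)) ` I)"
        unfolding fun_vs.dependent_finite[OF finite_imageI[OF fin]] using u by
            (intro exI[of _ ?u] conjI)
      then show False using ind by blast
    qed
  next
    show "v ` I \<subseteq> ?H"
    proof
      fix g assume "g \<in> v ` I"
      then obtain d where d: "d \<in> I" "g = v d" by blast
      have "pull (v d) \<in> ?H'" unfolding span[symmetric] using d(1) by (intro fun_vs.span_base) blast
      then show "g \<in> ?H" using H_iff[OF vV[OF d(1)]] d(2) by simp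
    qed
  next
    show "?H \<subseteq> fun_vs.span (v ` I)"
    proof
      fix g assume g: "g \<in> ?H"
      then have gV: "g \<in> ?V" by (simp add: o3_highest_vectors_def)
      have "pull g \<in> fun_vs.span ((\<lambda>d. pull (v d)) ` I)" unfolding span using H_iff[OF gV] g by simp
      then obtain c where c: "pull g = (\<Sum>i\<in>I. fscale (c i) (pull (v i)))"
        by (rule span_image_coefficients[OF fin])
      let ?g = "\<Sum>i\<in>I. fscale (c i) (v i)"
      have "?g \<in> {f. regular_on SO5 f}"
        by (intro fun_vs.subspace_sum[OF subspace_regular]) (simp add: regular_scale rv)
      moreover have "pull g = pull ?g" unfolding c by (simp only: pull_sum pull_scale)
      ultimately have "g = ?g" using pull_eq_iff[OF reg[OF gV]] by simp
      moreover have "?g \<in> fun_vs.span (v ` I)"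
        by (intro fun_vs.span_sum fun_vs.span_scale fun_vs.span_base imageI)
      ultimately show "g \<in> fun_vs.span (v ` I)" by simp
    qed
  next
    show "fun_vs.subspace ?H"
      by (rule o3_highest_subspace[OF shift_action_SO5 generated_subrep_closed(1)
          generated_subrep_regular[OF f]])
  qed
qed

subsection \<open>Square roots of the minor\<close>

text \<open>On the irreducible group the product of \<open>P h - h$1$1\<close> and
  \<open>P h + h$1$1\<close> vanishes, hence one factor does. The choice of the root thus affects
  nothing but signs.\<close>

lemma square_root_sign:
  assumes "regular r" "\<forall>h\<in>Sp4. (r h)\<^sup>2 = minor (-2) (-1) (cover h)"
  obtains \<epsilon> where "\<epsilon> = 1 \<or> \<epsilon> = - 1" "\<And>h. h \<in> Sp4 \<Longrightarrow> r h = \<epsilon> * h$1$1"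
proof -
  obtain P where P: "polynomial_fun P" "r = res P" using assms(1) by (rule regularE)
  have "(\<forall>h\<in>Sp4. P h - h$1$1 = 0) \<or> (\<forall>h\<in>Sp4. P h + h$1$1 = 0)"
  proof (rule Sp4_irreducible)
    fix h :: "complex^4^4" assume "h \<in> Sp4"
    then have "(P h)\<^sup>2 = (h$1$1)\<^sup>2" using assms(2) by (simp add: P on_group_def minor_cover)
    then show "(P h - h$1$1) * (P h + h$1$1) = 0" by (simp add: algebra_simps power2_eq_square)
  qed (intro polynomial_fun_intros P(1))+
  then show ?thesis
  proof
    assume "\<forall>h\<in>Sp4. P h - h$1$1 = 0"
    then show ?thesis by (intro that[of 1]) (auto simp: P on_group_def)
  next
    assume "\<forall>h\<in>Sp4. P h + h$1$1 = 0"
    then show ?thesis by (intro that[of "- 1"]) (auto simp: P on_group_def eq_neg_iff_add_eq_0)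
  qed
qed

lemma generated_subrep_fscale:
  assumes "c \<noteq> 0"
  shows "generated_subrep act (fscale c f) = generated_subrep act f"
proof -
  have "fscale c f \<in> U \<longleftrightarrow> f \<in> U" if "fun_vs.subspace U" for U
  proof
    assume "fscale c f \<in> U"
    then have "fscale (1 / c) (fscale c f) \<in> U" by (rule fun_vs.subspace_scale[OF that])
    then show "f \<in> U" using assms by (simp add: fscale_simps)
  qed (rule fun_vs.subspace_scale[OF that])
  then show ?thesis unfolding generated_subrep_def by (intro arg_cong[where f = Inter]) blast
qed

subsection \<open>Integer and half-integer highest weights\<close>

lemma integer_case:
  fixes m2 m1 s :: real
  assumes "m2 \<ge> m1" and "m1 \<ge> 0" and "m2 \<in> \<int>" "m1 \<in> \<int>"
  defines "V \<equiv> generated_subrep act_SO5 (on_group SO5 (\<lambda>g. highest_value m2 m1 (minor_pow g) g))"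
    and "I \<equiv> diagram_indices \<int> m2 m1 s"
    and "v \<equiv> (\<lambda>d. on_group SO5 (\<lambda>g. diagram_value m2 m1 s d (minor_pow g) g))"
  shows "is_indexed_basis I v (o3_highest_vectors act_SO5 V s) \<and>
      (\<forall>d\<in>I. act_SO5 (-2) (-2) (v d) = fscale (of_real s) (v d) \<and>
             act_SO5 (-1) (-1) (v d) = fscale (of_real (minus1_weight m2 m1 s d)) (v d))"
proof -
  obtain z1 where z1: "m1 = of_int z1" using assms(4) by (rule Ints_cases)
  obtain z2 where z2: "m2 = of_int z2" using assms(3) by (rule Ints_cases)
  define n M where "n = nat z1" and "M = nat (z2 - z1)"
  have n: "real n = m1" and M: "real M = m2 - m1"
    using assms(1,2) by (simp_all add: n_def M_def z1 z2)
  have fl: "\<lfloor>m2 - m1\<rfloor> = int M" "\<lfloor>m1\<rfloor> = int n" by (simp flip: M, simp flip: n)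
  let ?f = "on_group SO5 (\<lambda>g. highest_value m2 m1 (minor_pow g) g)"
  have "highest_value m2 m1 (minor_pow g) g = (g $ (-2) $ (-2)) ^ M *
     (g $ (-2) $ (-2) * g $ (-1) $ (-1) - g $ (-2) $ (-1) * g $ (-1) $ (-2)) ^ n" for g
    by (simp add: highest_value_def minor_pow_def fl elt_def minor_def)
  moreover have "polynomial_fun (\<lambda>g :: complex^5^5. (g $ (-2) $ (-2)) ^ M *
     (g $ (-2) $ (-2) * g $ (-1) $ (-1) - g $ (-2) $ (-1) * g $ (-1) $ (-2)) ^ n)"
    by (intro polynomial_fun_intros)
  ultimately have reg: "regular_on SO5 ?f" by (auto simp: regular_on_def)
  have pull_f: "pull ?f = highest (2 * n) M"
    unfolding pull_on_group highest_def on_group_eq_iff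
    by (simp add: highest_value_def minor_pow_def fl elt_def minor_cover cover_rows flip: power_mult)
  have VW: "generated_subrep act_Sp4 (pull ?f) = W (2 * n) M"
    unfolding pull_f by (rule generated_subrep_Sp4)
  have fixed: "on_group SO5 (v d) = v d" for d
    by (simp add: v_def on_group_def fun_eq_iff)
  show ?thesis
  proof (cases "s - m1 \<in> \<int>")
    case False
    have "s \<notin> \<int>" using False assms(4) Ints_diff by blast
    then have I: "I = {}" by (auto simp: I_def diagram_indices_def)
    show ?thesis
      unfolding I V_def
      using descend_basis(1)[OF reg finite.emptyI, of v s] highest_vectors_trivial[of "2 * n" m1 s
          "\<lambda>d. pull (v d)" M] n False
      by (simp add: VW)
  next
    case True
    then obtain \<delta> where "s - m1 = of_int \<delta>" by (rule Ints_cases)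
    then have \<delta>: "s = m1 + of_int \<delta>" by simp
    interpret diagram_setup \<int> m2 m1 s "2 * n" M \<delta>
    proof
      show "x \<in> \<int> \<longleftrightarrow> x - m1 \<in> \<int>" for x
        using assms(4) by (metis Ints_add Ints_diff diff_add_cancel)
    qed (use n M \<delta> in simp_all)
    define c :: "nat \<times> real \<times> real \<Rightarrow> complex" where
      "c = (\<lambda>(\<sigma>, k2, k1). (- root2) ^ \<sigma> * (- 1) ^ nat \<lfloor>m1 - k1\<rfloor>)"
    have c: "c d \<noteq> 0" for d by (cases d) (simp add: c_def)
    have pv: "pull (v d) = fscale (c d) (Vf (2 * n) M \<delta> (coefG (2 * n) M \<delta>) (exps m2 d))" if
        "d \<in> I" for d
    proof -
      obtain \<sigma> k2 k1 where d: "d = (\<sigma>, k2, k1)" by (cases d)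
      have dI: "(\<sigma>, k2, k1) \<in> diagram_indices \<int> m2 m1 s" using that by (simp add: d I_def)
      obtain j q n' where x: "exps m2 (\<sigma>, k2, k1) = (j, q)" "\<sigma> \<in> {0, 1}" "real j = 2 * k1 - real \<sigma>"
        by (rule index_numbers[OF dI])
      have k: "k1 \<in> \<int>" "\<sigma> = 1 \<longrightarrow> k1 \<ge> 1" "k1 \<ge> 0" using dI by (auto simp: diagram_indices_def)
      obtain y where y: "k1 = of_int y" using k(1) by (rule Ints_cases)
      define l where "l = nat (y - int \<sigma>)"
      have "y - int \<sigma> \<ge> 0" using k x(2) y by auto
      then have l: "k1 - real \<sigma> = real l" by (simp add: l_def y)
      then have j: "j = 2 * l + \<sigma>" using x(3) by linarith
      have "diagram_value m2 m1 s (\<sigma>, k2, k1) (minor_pow (cover h)) (cover h)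
        = c d * Vf (2 * n) M \<delta> (coefG (2 * n) M \<delta>) (exps m2 d) h" if h: "h \<in> Sp4" for h
      proof -
        \<comment> \<open>The exponent is \<open>\<sigma> + 2 * (k1 - \<sigma>) = j\<close>; the
          condition on \<open>k1\<close> for \<sigma> = 1 keeps \<open>k1 - \<sigma>\<close> a
          natural number.\<close>
        have "h$1$1 ^ \<sigma> * minor_pow (cover h) (k1 - real \<sigma>) = 1 * h$1$1 ^ fst (exps m2 (\<sigma>, k2, k1))"
          by (simp add: minor_pow_def l minor_cover[OF h] x(1) j power_add power_mult)
        from diagram_value_cover[where pw = "minor_pow (cover h)", OF dI h this] show ?thesis by
            (simp add: c_def d)
      qed
      moreover have "res (Vf (2 * n) M \<delta> (coefG (2 * n) M \<delta>) (exps m2 d)) = Vf (2 * n) M \<delta> (coefG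
          (2 * n) M \<delta>) (exps m2 d)"
        by (rule on_group_regular[OF regular_Vf])
      then have "fscale (c d) (Vf (2 * n) M \<delta> (coefG (2 * n) M \<delta>) (exps m2 d))
        = res (\<lambda>h. c d * Vf (2 * n) M \<delta> (coefG (2 * n) M \<delta>) (exps m2 d) h)"
        by (metis res_simps(3))
      ultimately show ?thesis
        unfolding v_def pull_on_group by (simp add: on_group_eq_iff d)
    qed
    have fin: "finite I" unfolding I_def using exps_bij finite_JJ bij_betw_finite by blast
    note hb = highest_vectors_basis[of c "\<lambda>d. pull (v d)", OF c pv[unfolded I_def]]
    have b: "is_indexed_basis I (\<lambda>d. pull (v d)) (o3_highest_vectors act_Sp4
        (generated_subrep act_Sp4 (pull ?f)) s)"
      unfolding VW I_def by (rule hb(1)) auto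
    note db = descend_basis[OF reg fin fixed b]
    have "act_SO5 (-2) (-2) (v d) = fscale (of_real s) (v d)"
      "act_SO5 (-1) (-1) (v d) = fscale (of_real (minus1_weight m2 m1 s d)) (v d)" if d: "d \<in> I" for d
    proof -
      have r: "regular_on SO5 (v d)" by (rule db(2)[OF d])
      have "act_Sp4 (-2) (-2) (pull (v d)) = fscale (of_real s) (pull (v d))"
        by (rule hb(2)) (use d in \<open>simp_all add: I_def\<close>)
      then show "act_SO5 (-2) (-2) (v d) = fscale (of_real s) (v d)"
        unfolding pull_act[OF r, symmetric] pull_scale[symmetric] pull_eq_iff[OF
            regular_act_SO5[OF r] regular_scale[OF r]] .
      have "act_Sp4 (-1) (-1) (pull (v d)) = fscale (of_real (minus1_weight m2 m1 s d)) (pull (v d))"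
        by (rule hb(3)) (use d in \<open>simp_all add: I_def\<close>)
      then show "act_SO5 (-1) (-1) (v d) = fscale (of_real (minus1_weight m2 m1 s d)) (v d)"
        unfolding pull_act[OF r, symmetric] pull_scale[symmetric] pull_eq_iff[OF
            regular_act_SO5[OF r] regular_scale[OF r]] .
    qed
    then show ?thesis using db(1) unfolding V_def by blast
  qed
qed

lemma half_integer_case:
  fixes m2 m1 s :: real
  assumes "m2 \<ge> m1" and "m1 \<ge> 0" and "m2 \<in> half_integers" "m1 \<in> half_integers"
    and r: "regular r" "\<forall>h\<in>Sp4. (r h)\<^sup>2 = minor (-2) (-1) (cover h)"
  defines "V \<equiv> generated_subrep act_Sp4 (on_group Sp4 (\<lambda>h. highest_value m2 m1 (root_pow r h)
      (cover h)))"
    and "I \<equiv> diagram_indices half_integers m2 m1 s"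
  shows "\<exists>v. (\<forall>d\<in>I. corresponds_on_cover (v d)
                           (\<lambda>h. diagram_value m2 m1 s d (root_pow r h) (cover h))) \<and>
                 is_indexed_basis I v (o3_highest_vectors act_Sp4 V s) \<and>
                 (\<forall>d\<in>I. act_Sp4 (-2) (-2) (v d) = fscale (of_real s) (v d) \<and>
                        act_Sp4 (-1) (-1) (v d) = fscale (of_real (minus1_weight m2 m1 s d)) (v d))"
proof -
  have half_iff: "x \<in> half_integers \<longleftrightarrow> x - m1 \<in> \<int>" for x
  proof -
    have "x - 1 / 2 \<in> \<int>" if "x - m1 \<in> \<int>"
      using Ints_add[OF that assms(4)[unfolded half_integers_def mem_Collect_eq]] by simp
    moreover have "x - m1 \<in> \<int>" if "x - 1 / 2 \<in> \<int>"
      using Ints_diff[OF that assms(4)[unfolded half_integers_def mem_Collect_eq]] by simp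
    ultimately show ?thesis by (auto simp: half_integers_def)
  qed
  obtain z1 where "m1 - 1 / 2 = of_int z1" using assms(4) by (auto simp: half_integers_def elim:
      Ints_cases)
  then have z1: "m1 = of_int z1 + 1 / 2" by simp
  obtain z2 where "m2 - m1 = of_int z2" using assms(3) unfolding half_iff by (auto elim: Ints_cases)
  then have z2: "m2 = m1 + of_int z2" by simp
  have z1_pos: "z1 \<ge> 0" using assms(2) z1 by linarith
  define N M where "N = 2 * nat z1 + 1" and "M = nat z2"
  have N: "real N = 2 * m1" using z1 z1_pos by (simp add: N_def)
  have M: "real M = m2 - m1" using assms(1) z2 by (simp add: M_def)
  have oddN: "odd N" by (simp add: N_def)
  have fl: "\<lfloor>m2 - m1\<rfloor> = int M" "\<lfloor>2 * m1\<rfloor> = int N" by (simp flip: M, simp flip: N)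
  obtain \<epsilon> where \<epsilon>: "\<epsilon> = 1 \<or> \<epsilon> = - 1" "\<And>h. h \<in> Sp4 \<Longrightarrow> r h = \<epsilon> * h$1$1"
    using square_root_sign[OF r] by metis
  have \<epsilon>0: "\<epsilon> \<noteq> 0" using \<epsilon>(1) by auto
  \<comment> \<open>The other root changes the highest vector by the sign
    \<open>\<epsilon> ^ N\<close> only, so it generates the same space.\<close>
  have "on_group Sp4 (\<lambda>h. highest_value m2 m1 (root_pow r h) (cover h)) = fscale (\<epsilon> ^ N) (highest N M)"
    unfolding highest_def res_simps on_group_eq_iff
    by (simp add: highest_value_def root_pow_def fl elt_def cover_rows \<epsilon>(2) power_mult_distrib)
  then have VW: "V = W N M"
    unfolding V_def using \<epsilon>0 by (simp add: generated_subrep_fscale generated_subrep_Sp4)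
  show ?thesis
  proof (cases "s - m1 \<in> \<int>")
    case False
    then have I: "I = {}" using half_iff by (auto simp: I_def diagram_indices_def)
    show ?thesis
      unfolding I VW using highest_vectors_trivial[OF N False] by auto
  next
    case True
    then obtain \<delta> where "s - m1 = of_int \<delta>" by (rule Ints_cases)
    then have \<delta>: "s = m1 + of_int \<delta>" by simp
    interpret diagram_setup half_integers m2 m1 s N M \<delta>
    proof
      have "(0 :: real) \<notin> half_integers"
      proof
        assume "(0 :: real) \<in> half_integers"
        then obtain z where "(- 1 / 2 :: real) = of_int z" by
            (auto simp: half_integers_def elim: Ints_cases)
        then have "of_int (- 1) = (of_int (2 * z) :: real)" by simp
        then have "- 1 = 2 * z" by (simp only: of_int_eq_iff)
        then show False by presburger
      qed
      then have "half_integers \<noteq> \<int>" by (metis Ints_0)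
      then show "half_integers = \<int> \<longleftrightarrow> even N" using oddN by simp
    qed (use N M \<delta> half_iff in simp_all)
    define c :: "nat \<times> real \<times> real \<Rightarrow> complex" where
      "c = (\<lambda>(\<sigma>, k2, k1). (- root2) ^ \<sigma> * (- 1) ^ nat \<lfloor>m1 - k1\<rfloor> * \<epsilon> powi \<lfloor>2 * (k1 - real \<sigma>)\<rfloor>)"
    have c: "c d \<noteq> 0" for d using \<epsilon>0 by (cases d) (simp add: c_def)
    define v where "v = (\<lambda>d. fscale (c d) (Vf N M \<delta> (coefG N M \<delta>) (exps m2 d)))"
    have vd: "v d = fscale (c d) (Vf N M \<delta> (coefG N M \<delta>) (exps m2 d))" for d by (simp add: v_def)
    note hb = highest_vectors_basis[of c v, OF c vd]
    have "corresponds_on_cover (v d) (\<lambda>h. diagram_value m2 m1 s d (root_pow r h) (cover h))" if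
        "d \<in> I" for d
      unfolding corresponds_on_cover_def
    proof (intro conjI ballI impI)
      show "regular (v d)" unfolding v_def by (intro regular_scale regular_Vf)
      fix h assume h: "h \<in> Sp4" "minor (-2) (-1) (cover h) \<noteq> 0"
      \<comment> \<open>For k1 = 1/2 and \<sigma> = 1 the exponent \<open>j - \<sigma>\<close> is
        -1, so the powers of \<open>h$1$1\<close> can be merged only where it is nonzero.\<close>
      have x0: "h$1$1 \<noteq> 0" using h by (auto simp: minor_cover)
      obtain \<sigma> k2 k1 where d: "d = (\<sigma>, k2, k1)" by (cases d)
      have dI: "(\<sigma>, k2, k1) \<in> diagram_indices half_integers m2 m1 s" using that by (simp add: d I_def)
      obtain j q n' where x: "exps m2 (\<sigma>, k2, k1) = (j, q)" "real j = 2 * k1 - real \<sigma>"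
        by (rule index_numbers[OF dI])
      have "2 * (k1 - real \<sigma>) = of_int (int j - int \<sigma>)" using x(2) by simp
      then have fl': "\<lfloor>2 * (k1 - real \<sigma>)\<rfloor> = int j - int \<sigma>" by (simp only: floor_of_int)
      have "h$1$1 ^ \<sigma> * root_pow r h (k1 - real \<sigma>)
          = \<epsilon> powi (int j - int \<sigma>) * (h$1$1 powi int \<sigma> * h$1$1 powi (int j - int \<sigma>))"
        unfolding root_pow_def fl' \<epsilon>(2)[OF h(1)] by (simp add: power_int_mult_distrib)
      also have "\<dots> = \<epsilon> powi (int j - int \<sigma>) * h$1$1 ^ fst (exps m2 (\<sigma>, k2, k1))"
      proof -
        have "h$1$1 powi int \<sigma> * h$1$1 powi (int j - int \<sigma>) = h$1$1 powi int j"
          using power_int_add[of "h$1$1" "int \<sigma>" "int j - int \<sigma>"] x0 by simp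
        then show ?thesis unfolding x(1) by (simp only: power_int_of_nat fst_conv)
      qed
      finally have "h$1$1 ^ \<sigma> * root_pow r h (k1 - real \<sigma>)
          = \<epsilon> powi (int j - int \<sigma>) * h$1$1 ^ fst (exps m2 (\<sigma>, k2, k1))" .
      from diagram_value_cover[where pw = "root_pow r h", OF dI h(1) this]
      show "v d h = diagram_value m2 m1 s d (root_pow r h) (cover h)"
        unfolding vd c_def d fscale_def split fl' by simp
    qed
    moreover have "is_indexed_basis I v (o3_highest_vectors act_Sp4 V s)"
      unfolding VW I_def by (rule hb(1))
    ultimately show ?thesis using hb(2,3) unfolding I_def by blast
  qed
qed

theorem lemma1:
  fixes m2 m1 s :: real
  assumes "m2 \<ge> m1" and "m1 \<ge> 0"
  shows
    "(m2 \<in> \<int> \<and> m1 \<in> \<int> \<longrightarrow>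
       (let V = generated_subrep act_SO5
                  (on_group SO5 (\<lambda>g. highest_value m2 m1 (minor_pow g) g));
            I = diagram_indices \<int> m2 m1 s;
            v = (\<lambda>d. on_group SO5 (\<lambda>g. diagram_value m2 m1 s d (minor_pow g) g))
        in is_indexed_basis I v (o3_highest_vectors act_SO5 V s) \<and>
           (\<forall>d\<in>I. act_SO5 (-2) (-2) (v d) = fscale (of_real s) (v d) \<and>
                  act_SO5 (-1) (-1) (v d) = fscale (of_real (minus1_weight m2 m1 s d)) (v d)))) \<and>
     (m2 \<in> half_integers \<and> m1 \<in> half_integers \<longrightarrow>
       (\<forall>r. regular_on Sp4 r \<and> (\<forall>h\<in>Sp4. (r h)\<^sup>2 = minor (-2) (-1) (cover h)) \<longrightarrow>
         (let V = generated_subrep act_Sp4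
                    (on_group Sp4 (\<lambda>h. highest_value m2 m1 (root_pow r h) (cover h)));
              I = diagram_indices half_integers m2 m1 s
          in \<exists>v. (\<forall>d\<in>I. corresponds_on_cover (v d)
                           (\<lambda>h. diagram_value m2 m1 s d (root_pow r h) (cover h))) \<and>
                 is_indexed_basis I v (o3_highest_vectors act_Sp4 V s) \<and>
                 (\<forall>d\<in>I. act_Sp4 (-2) (-2) (v d) = fscale (of_real s) (v d) \<and>
                        act_Sp4 (-1) (-1) (v d) = fscale (of_real (minus1_weight m2 m1 s d)) (v d)))))"
  unfolding Let_def
  by (rule conjI; intro allI impI; elim conjE)
     (rule integer_case[OF assms], assumption+, rule half_integer_case[OF assms], assumption+)

end
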